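(* Let $p:\Sigma_\varDelta\to M_\varDelta=\Sigma_\varDelta/N_{\mathbb C}$ be the GIT quotient construction of the toric variety $M_\varDelta$ of a Delzant polytope $\varDelta$ with $d$ facets. Then every positive bivector $\pi\in\wedge^2\mathbb C^d$ induces Poisson structures $\pi_\Sigma$ on $\Sigma_\varDelta$ and $\pi_M$ on $M_\varDelta$ for which the quotient map $p:(\Sigma_\varDelta,\pi_\Sigma)\to(M_\varDelta,\pi_M)$ is a Poisson submersion with Poisson fibres. Here $\pi_\Sigma=\wedge^2\rho(\pi)|_{\Sigma_\varDelta}$, where $\rho$ is the infinitesimal action associated with the action of $\mathbb C^d$ on $\mathbb C^d$ given by $(w_1,\dots,w_d)\cdot(z_1,\dots,z_d)=(e^{w_1}z_1,\dots,e^{w_d}z_d)$, and $\pi_M$ is the pushforward of $\pi_\Sigma$ under $p$.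
   Context: Delzant polytope and GIT quotient: let $T$ be an $n$-dimensional compact torus with Lie algebra $\mathfrak t$ and $\varLambda=\ker(\exp:\mathfrak t\to T)$. A Delzant polytope is a compact set $\varDelta=\bigcap_{i=1}^d\{\xi\in\mathfrak t^*:\langle\xi,u_i\rangle\ge c_i\}$ with $c_i\in\mathbb R$, $u_i\in\varLambda$ normal to the facets of $\varDelta$, such that at each vertex the normals $u_i$ of the facets through that vertex form a $\mathbb Z$-basis of $\varLambda$. Let $N$ be the kernel of the homomorphism $\mathbb T^d\to T$ whose differential sends the standard basis vector $e_i\in\mathbb R^d=\mathrm{Lie}(\mathbb T^d)$ to $u_i$, and $N_{\mathbb C}\subset(\mathbb C^\times)^d$ its complexification. For $I\subset\{1,\dots,d\}$ put $\mathbb C^d_I=\{z:z_i=0\Leftrightarrow i\in I\}$ and $F(\varDelta)_I=\{\xi\in\varDelta:\langle\xi,u_i\rangle=c_i\Leftrightarrow i\in I\}$, and $\Sigma_\varDelta=\bigcup_{F(\varDelta)_I\ne\varnothing}\mathbb C^d_I$, an open subset of $\mathbb C^d$. $N_{\mathbb C}$ acts freely on $\Sigma_\varDelta$ by coordinatewise multiplication, and $M_\varDelta=\Sigma_\varDelta/N_{\mathbb C}$ is a compact complex manifold, with quotient map $p$. Positive bivector: let $J$ be the standard complex structure of $A=\mathbb C^d$. A bivector $\pi\in\wedge^2A$ (real exterior square) is positive if $S:=\pi^\sharp(A^* )$ is a complex subspace, $J|_S$ preserves the symplectic form $\omega_S$ on $S$ determined by $\pi$ (convention $\omega_S(\pi^\sharp\xi,\pi^\sharp\eta)=\pi(\xi,\eta)$),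 and $\omega_S(u,Jv)$ is symmetric and positive-definite. Infinitesimal action of a vector space action $\alpha:A\times M\to M$: $\rho(v)_x=\frac{d}{dt}\alpha(-tv,x)|_{t=0}$. A Poisson submersion is a submersion which is a Poisson map. With $\mathrm{Gr}(\pi_\Sigma)=\{\pi_\Sigma^\sharp(\xi)+\xi\}$, a submanifold $i:X\to\Sigma$ is Poisson-Dirac if $\{u+i^*\xi:i_*u=\pi_\Sigma^\sharp(\xi)\}$ is the graph of a smooth (automatically Poisson) bivector on $X$. A submersion from a Poisson manifold has Poisson fibres if each fibre is a Poisson-Dirac submanifold. *)

theory Defs
  imports "HOL-Analysis.Analysis"
begin

section \<open>Smooth maps between open subsets of Euclidean spaces\<close>

primrec Ck_on :: "nat \<Rightarrow> ('a::euclidean_space \<Rightarrow> 'b::euclidean_space) \<Rightarrow> 'a set \<Rightarrow> bool" where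
  "Ck_on 0 f S \<longleftrightarrow> continuous_on S f"
| "Ck_on (Suc k) f S \<longleftrightarrow> (\<forall>x\<in>S. f differentiable at x) \<and>
     (\<forall>v. Ck_on k (\<lambda>x. frechet_derivative f (at x) v) S)"

text \<open>Only used for open \<^term>\<open>S\<close>.\<close>

definition smooth_on :: "'a::euclidean_space set \<Rightarrow> ('a \<Rightarrow> 'b::euclidean_space) \<Rightarrow> bool" where
  "smooth_on S f \<longleftrightarrow> (\<forall>k. Ck_on k f S)"

definition total_deriv :: "('a::euclidean_space \<Rightarrow> 'b::euclidean_space) \<Rightarrow> 'a \<Rightarrow> 'a \<Rightarrow>\<^sub>L 'b" where
  "total_deriv f x = Blinfun (frechet_derivative f (at x))"

definition holomorphic_map_on ::
    "(complex^'m) set \<Rightarrow> (complex^'m::finite \<Rightarrow> complex) \<Rightarrow> bool" where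
  "holomorphic_map_on W f \<longleftrightarrow> smooth_on W f \<and>
     (\<forall>z\<in>W. \<forall>v. total_deriv f z (\<i> *s v) = \<i> * total_deriv f z v)"


section \<open>Bivectors\<close>

text \<open>An element of the exterior square of a finite-dimensional real vector space \<open>E\<close> is
  represented by the alternating bilinear form on the dual of \<open>E\<close> that it defines; the dual is
  \<^typ>\<open>'e \<Rightarrow>\<^sub>L real\<close>.\<close>

type_synonym 'e bivector = "('e \<Rightarrow>\<^sub>L real) \<Rightarrow> ('e \<Rightarrow>\<^sub>L real) \<Rightarrow> real"

definition is_bivector :: "'e::euclidean_space bivector \<Rightarrow> bool" where
  "is_bivector \<pi> \<longleftrightarrow> bilinear \<pi> \<and> (\<forall>\<xi>. \<pi> \<xi> \<xi> = 0)"

definition sharp :: "'e::euclidean_space bivector \<Rightarrow> ('e \<Rightarrow>\<^sub>L real) \<Rightarrow> 'e" where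
  "sharp \<pi> \<xi> = (THE v. \<forall>\<eta>. blinfun_apply \<eta> v = \<pi> \<xi> \<eta>)"

text \<open>The map induced by \<^term>\<open>L\<close> on exterior squares.\<close>

definition push_bivector ::
    "('e::euclidean_space \<Rightarrow>\<^sub>L 'f::euclidean_space) \<Rightarrow> 'e bivector \<Rightarrow> 'f bivector" where
  "push_bivector L \<pi> = (\<lambda>\<xi> \<eta>. \<pi> (\<xi> o\<^sub>L L) (\<eta> o\<^sub>L L))"

text \<open>The form \<open>\<omega>\<^sub>S\<close> on \<open>S = range (sharp \<pi>)\<close>; meaningful only for arguments in \<open>S\<close>.\<close>

definition symplectic_form :: "'e::euclidean_space bivector \<Rightarrow> 'e \<Rightarrow> 'e \<Rightarrow> real" where
  "symplectic_form \<pi> u v = (THE r. \<exists>\<xi> \<eta>. sharp \<pi> \<xi> = u \<and> sharp \<pi> \<eta> = v \<and> r = \<pi> \<xi> \<eta>)"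

definition positive_bivector :: "(complex^'d::finite) bivector \<Rightarrow> bool" where
  "positive_bivector \<pi> \<longleftrightarrow> is_bivector \<pi> \<and>
     (let S = range (sharp \<pi>); \<omega> = symplectic_form \<pi>; J = (\<lambda>v. \<i> *s v) in
        vec.subspace S \<and>
        (\<forall>u\<in>S. \<forall>v\<in>S. \<omega> (J u) (J v) = \<omega> u v) \<and>
        (\<forall>u\<in>S. \<forall>v\<in>S. \<omega> u (J v) = \<omega> v (J u)) \<and>
        (\<forall>u\<in>S. u \<noteq> 0 \<longrightarrow> \<omega> u (J u) > 0))"


section \<open>Poisson structures on open subsets of Euclidean spaces\<close>

definition smooth_bivector_on ::
    "'e::euclidean_space set \<Rightarrow> ('e \<Rightarrow> 'e bivector) \<Rightarrow> bool" where
  "smooth_bivector_on S \<pi> \<longleftrightarrow> (\<forall>x\<in>S. is_bivector (\<pi> x)) \<and>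
     (\<forall>\<xi> \<eta>. smooth_on S (\<lambda>x. \<pi> x \<xi> \<eta>))"

definition poisson_bracket ::
    "('e::euclidean_space \<Rightarrow> 'e bivector) \<Rightarrow> ('e \<Rightarrow> real) \<Rightarrow> ('e \<Rightarrow> real) \<Rightarrow> 'e \<Rightarrow> real" where
  "poisson_bracket \<pi> f g = (\<lambda>x. \<pi> x (total_deriv f x) (total_deriv g x))"

definition poisson_on :: "'e::euclidean_space set \<Rightarrow> ('e \<Rightarrow> 'e bivector) \<Rightarrow> bool" where
  "poisson_on S \<pi> \<longleftrightarrow> smooth_bivector_on S \<pi> \<and>
     (\<forall>f g h. smooth_on S f \<longrightarrow> smooth_on S g \<longrightarrow> smooth_on S h \<longrightarrow>
       (\<forall>x\<in>S. poisson_bracket \<pi> f (poisson_bracket \<pi> g h) x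
             + poisson_bracket \<pi> g (poisson_bracket \<pi> h f) x
             + poisson_bracket \<pi> h (poisson_bracket \<pi> f g) x = 0))"


section \<open>Manifolds with an atlas, and Poisson structures on them\<close>

type_synonym ('x, 'e) chart = "'x set \<times> ('x \<Rightarrow> 'e)"

definition smooth_atlas :: "'x topology \<Rightarrow> ('x, 'e::euclidean_space) chart set \<Rightarrow> bool" where
  "smooth_atlas X A \<longleftrightarrow>
     (\<forall>(U, \<phi>)\<in>A. openin X U \<and> open (\<phi> ` U) \<and>
        homeomorphic_map (subtopology X U) (top_of_set (\<phi> ` U)) \<phi>) \<and>
     (\<Union>(U, \<phi>)\<in>A. U) = topspace X \<and>
     (\<forall>(U, \<phi>)\<in>A. \<forall>(V, \<psi>)\<in>A. smooth_on (\<phi> ` (U \<inter> V)) (\<psi> \<circ> inv_into U \<phi>))"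

definition smooth_manifold :: "'x topology \<Rightarrow> ('x, 'e::euclidean_space) chart set \<Rightarrow> bool" where
  "smooth_manifold X A \<longleftrightarrow> Hausdorff_space X \<and> second_countable X \<and> smooth_atlas X A"

definition local_rep ::
    "('x, 'e::euclidean_space) chart \<Rightarrow> ('y, 'f::euclidean_space) chart \<Rightarrow> ('x \<Rightarrow> 'y) \<Rightarrow> 'e \<Rightarrow> 'f" where
  "local_rep a b f = snd b \<circ> f \<circ> inv_into (fst a) (snd a)"

definition smooth_map ::
    "'x topology \<Rightarrow> ('x, 'e::euclidean_space) chart set \<Rightarrow>
     'y topology \<Rightarrow> ('y, 'f::euclidean_space) chart set \<Rightarrow> ('x \<Rightarrow> 'y) \<Rightarrow> bool" where
  "smooth_map X A Y B f \<longleftrightarrow> continuous_map X Y f \<and>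
     (\<forall>a\<in>A. \<forall>b\<in>B. smooth_on (snd a ` (fst a \<inter> f -` fst b)) (local_rep a b f))"

definition submersion ::
    "'x topology \<Rightarrow> ('x, 'e::euclidean_space) chart set \<Rightarrow>
     'y topology \<Rightarrow> ('y, 'f::euclidean_space) chart set \<Rightarrow> ('x \<Rightarrow> 'y) \<Rightarrow> bool" where
  "submersion X A Y B f \<longleftrightarrow> smooth_map X A Y B f \<and>
     (\<forall>a\<in>A. \<forall>b\<in>B. \<forall>x \<in> fst a \<inter> f -` fst b.
        surj (blinfun_apply (total_deriv (local_rep a b f) (snd a x))))"

text \<open>A bivector field on a manifold is given by its coordinate expression in each chart of the
  atlas; these expressions have to transform into each other under the transition maps.\<close>

type_synonym ('x, 'e) bivector_field = "('x, 'e) chart \<Rightarrow> 'e \<Rightarrow> 'e bivector"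

definition smooth_bivector_field ::
    "('x, 'e::euclidean_space) chart set \<Rightarrow> ('x, 'e) bivector_field \<Rightarrow> bool" where
  "smooth_bivector_field A P \<longleftrightarrow>
     (\<forall>a\<in>A. smooth_bivector_on (snd a ` fst a) (P a)) \<and>
     (\<forall>a\<in>A. \<forall>b\<in>A. \<forall>x \<in> fst a \<inter> fst b.
        P b (snd b x) = push_bivector (total_deriv (local_rep a b id) (snd a x)) (P a (snd a x)))"

definition poisson_manifold ::
    "'x topology \<Rightarrow> ('x, 'e::euclidean_space) chart set \<Rightarrow> ('x, 'e) bivector_field \<Rightarrow> bool" where
  "poisson_manifold X A P \<longleftrightarrow> smooth_manifold X A \<and> smooth_bivector_field A P \<and>
     (\<forall>a\<in>A. poisson_on (snd a ` fst a) (P a))"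

definition poisson_map ::
    "'x topology \<Rightarrow> ('x, 'e::euclidean_space) chart set \<Rightarrow> ('x, 'e) bivector_field \<Rightarrow>
     'y topology \<Rightarrow> ('y, 'f::euclidean_space) chart set \<Rightarrow> ('y, 'f) bivector_field \<Rightarrow>
     ('x \<Rightarrow> 'y) \<Rightarrow> bool" where
  "poisson_map X A P Y B Q f \<longleftrightarrow> smooth_map X A Y B f \<and>
     (\<forall>a\<in>A. \<forall>b\<in>B. \<forall>x \<in> fst a \<inter> f -` fst b.
        Q b (snd b (f x)) =
          push_bivector (total_deriv (local_rep a b f) (snd a x)) (P a (snd a x)))"

definition poisson_submersion ::
    "'x topology \<Rightarrow> ('x, 'e::euclidean_space) chart set \<Rightarrow> ('x, 'e) bivector_field \<Rightarrow>
     'y topology \<Rightarrow> ('y, 'f::euclidean_space) chart set \<Rightarrow> ('y, 'f) bivector_field \<Rightarrow>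
     ('x \<Rightarrow> 'y) \<Rightarrow> bool" where
  "poisson_submersion X A P Y B Q f \<longleftrightarrow> submersion X A Y B f \<and> poisson_map X A P Y B Q f"

text \<open>The pushforward of a bivector field is only well defined if the pushed-forward bivectors
  agree along each fibre; otherwise the value is unspecified.\<close>

definition pushforward ::
    "('x, 'e::euclidean_space) chart set \<Rightarrow> ('x, 'e) bivector_field \<Rightarrow> ('x \<Rightarrow> 'y) \<Rightarrow>
     ('y, 'f::euclidean_space) bivector_field" where
  "pushforward A P f = (\<lambda>b y. THE \<sigma>. \<exists>a\<in>A. \<exists>x \<in> fst a \<inter> f -` fst b. snd b (f x) = y \<and>
     \<sigma> = push_bivector (total_deriv (local_rep a b f) (snd a x)) (P a (snd a x)))"

definition open_atlas :: "'e::euclidean_space set \<Rightarrow> ('e, 'e) chart set" where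
  "open_atlas S = {(S, id)}"


section \<open>Poisson-Dirac submanifolds of open subsets of Euclidean spaces\<close>

definition embedded_submanifold :: "'e::euclidean_space set \<Rightarrow> bool" where
  "embedded_submanifold X \<longleftrightarrow> (\<forall>x\<in>X. \<exists>W (\<theta>::'e \<Rightarrow> 'e) L. open W \<and> x \<in> W \<and> open (\<theta> ` W) \<and>
     inj_on \<theta> W \<and> smooth_on W \<theta> \<and> smooth_on (\<theta> ` W) (inv_into W \<theta>) \<and>
     subspace L \<and> \<theta> ` (X \<inter> W) = \<theta> ` W \<inter> L)"

definition tangent_space :: "'e::euclidean_space set \<Rightarrow> 'e \<Rightarrow> 'e set" where
  "tangent_space X x = {v. \<exists>\<gamma> \<epsilon>. \<epsilon> > 0 \<and> smooth_on {-\<epsilon><..<\<epsilon>::real} \<gamma> \<and>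
     \<gamma> ` {-\<epsilon><..<\<epsilon>} \<subseteq> X \<and> \<gamma> 0 = x \<and> (\<gamma> has_vector_derivative v) (at 0)}"

definition smooth_on_submanifold :: "'e::euclidean_space set \<Rightarrow> ('e \<Rightarrow> real) \<Rightarrow> bool" where
  "smooth_on_submanifold X f \<longleftrightarrow>
     (\<forall>x\<in>X. \<exists>W F. open W \<and> x \<in> W \<and> smooth_on W F \<and> (\<forall>y \<in> X \<inter> W. F y = f y))"

definition graph_bivector :: "'e::euclidean_space bivector \<Rightarrow> ('e \<times> ('e \<Rightarrow>\<^sub>L real)) set" where
  "graph_bivector \<pi> = {(sharp \<pi> \<xi>, \<xi>) | \<xi>. True}"

text \<open>For a subspace \<^term>\<open>W\<close>, covectors on \<^term>\<open>W\<close> are the restrictions to \<^term>\<open>W\<close> of covectors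
  on the ambient space, and bivectors on \<^term>\<open>W\<close> are the ambient bivectors \<open>\<beta>\<close> with
  \<open>range (sharp \<beta>) \<subseteq> W\<close>; for such \<open>\<beta>\<close>, the vector \<open>sharp \<beta> \<eta>\<close> depends only on the restriction
  of \<open>\<eta>\<close> to \<^term>\<open>W\<close>.\<close>

definition dirac_pullback ::
    "'e::euclidean_space set \<Rightarrow> ('e \<times> ('e \<Rightarrow>\<^sub>L real)) set \<Rightarrow> ('e \<times> ('e \<Rightarrow> real)) set" where
  "dirac_pullback W D = {(u, restrict (blinfun_apply \<xi>) W) | u \<xi>. u \<in> W \<and> (u, \<xi>) \<in> D}"

definition graph_bivector_in ::
    "'e::euclidean_space set \<Rightarrow> 'e bivector \<Rightarrow> ('e \<times> ('e \<Rightarrow> real)) set" where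
  "graph_bivector_in W \<beta> = {(sharp \<beta> \<eta>, restrict (blinfun_apply \<eta>) W) | \<eta>. True}"

definition poisson_dirac ::
    "'e::euclidean_space set \<Rightarrow> ('e \<Rightarrow> 'e bivector) \<Rightarrow> 'e set \<Rightarrow> bool" where
  "poisson_dirac S \<pi> X \<longleftrightarrow> X \<subseteq> S \<and> embedded_submanifold X \<and>
     (\<exists>\<beta> :: 'e \<Rightarrow> 'e bivector.
        (\<forall>\<xi> \<eta>. smooth_on_submanifold X (\<lambda>x. \<beta> x \<xi> \<eta>)) \<and>
        (\<forall>x\<in>X. is_bivector (\<beta> x) \<and> range (sharp (\<beta> x)) \<subseteq> tangent_space X x \<and>
           dirac_pullback (tangent_space X x) (graph_bivector (\<pi> x)) =
             graph_bivector_in (tangent_space X x) (\<beta> x)))"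

definition has_poisson_fibres ::
    "'e::euclidean_space set \<Rightarrow> ('e \<Rightarrow> 'e bivector) \<Rightarrow> 'y set \<Rightarrow> ('e \<Rightarrow> 'y) \<Rightarrow> bool" where
  "has_poisson_fibres S \<pi> Y f \<longleftrightarrow> (\<forall>y\<in>Y. poisson_dirac S \<pi> {x \<in> S. f x = y})"


section \<open>Delzant polytopes\<close>

text \<open>The Lie algebra of the torus is \<^typ>\<open>real^'n\<close>, the torus is its quotient by the lattice
  \<open>\<Lambda>\<close>, and the dual of the Lie algebra is \<^typ>\<open>real^'n\<close> with pairing \<open>\<xi> \<bullet> v\<close>.\<close>

interpretation zmod: module "\<lambda>(k::int) (v::'a::real_vector). of_int k *\<^sub>R v"
  by unfold_locales (simp_all add: scaleR_add_right scaleR_add_left)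

definition full_lattice :: "'a::real_vector set \<Rightarrow> bool" where
  "full_lattice \<Lambda> \<longleftrightarrow> (\<exists>B. independent B \<and> span B = UNIV \<and> zmod.span B = \<Lambda>)"

definition zbasis_family :: "'a::real_vector set \<Rightarrow> ('i \<Rightarrow> 'a) \<Rightarrow> 'i set \<Rightarrow> bool" where
  "zbasis_family \<Lambda> u I \<longleftrightarrow> inj_on u I \<and> zmod.independent (u ` I) \<and> zmod.span (u ` I) = \<Lambda>"

definition polytope_of :: "('d \<Rightarrow> real^'n::finite) \<Rightarrow> ('d \<Rightarrow> real) \<Rightarrow> (real^'n) set" where
  "polytope_of u c = (\<Inter>i. {\<xi>. \<xi> \<bullet> u i \<ge> c i})"

text \<open>The polytope has exactly \<^term>\<open>CARD('d)\<close> facets, and \<^term>\<open>u i\<close> is the inward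
  normal to the \<open>i\<close>-th one.\<close>

definition delzant ::
    "(real^'n::finite) set \<Rightarrow> ('d::finite \<Rightarrow> real^'n) \<Rightarrow> ('d \<Rightarrow> real) \<Rightarrow> bool" where
  "delzant \<Lambda> u c \<longleftrightarrow> (let \<Delta> = polytope_of u c in
     compact \<Delta> \<and> range u \<subseteq> \<Lambda> \<and>
     bij_betw (\<lambda>i. {\<xi>\<in>\<Delta>. \<xi> \<bullet> u i = c i}) UNIV {F. F facet_of \<Delta>} \<and>
     (\<forall>v. v extreme_point_of \<Delta> \<longrightarrow> zbasis_family \<Lambda> u {i. v \<bullet> u i = c i}))"

definition open_face ::
    "('d \<Rightarrow> real^'n::finite) \<Rightarrow> ('d \<Rightarrow> real) \<Rightarrow> 'd set \<Rightarrow> (real^'n) set" where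
  "open_face u c I = {\<xi> \<in> polytope_of u c. \<forall>i. \<xi> \<bullet> u i = c i \<longleftrightarrow> i \<in> I}"

definition coord_stratum :: "'d::finite set \<Rightarrow> (complex^'d) set" where
  "coord_stratum I = {z. \<forall>i. z $ i = 0 \<longleftrightarrow> i \<in> I}"

definition Sigma_delzant ::
    "('d::finite \<Rightarrow> real^'n::finite) \<Rightarrow> ('d \<Rightarrow> real) \<Rightarrow> (complex^'d) set" where
  "Sigma_delzant u c = (\<Union>I \<in> {I. open_face u c I \<noteq> {}}. coord_stratum I)"


section \<open>The GIT quotient\<close>

text \<open>The exponential map of \<open>(\<complex>\<^sup>\<times>)\<^sup>d\<close>, normalised so that the kernel of its restriction to the
  Lie algebra \<^typ>\<open>real^'d\<close> of the compact torus is the integer lattice.  Multiplication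
  in \<^typ>\<open>complex^'d\<close> is coordinatewise.\<close>

definition torus_exp :: "complex^'d::finite \<Rightarrow> complex^'d" where
  "torus_exp w = (\<chi> j. exp (2 * of_real pi * \<i> * w $ j))"

definition of_real_vec :: "real^'d::finite \<Rightarrow> complex^'d" where
  "of_real_vec a = (\<chi> j. of_real (a $ j))"

definition kernel_group ::
    "(real^'n::finite) set \<Rightarrow> ('d::finite \<Rightarrow> real^'n) \<Rightarrow> (complex^'d) set" where
  "kernel_group \<Lambda> u = {torus_exp (of_real_vec a) | a. (\<Sum>j\<in>UNIV. a $ j *\<^sub>R u j) \<in> \<Lambda>}"

definition lie_algebra :: "(complex^'d::finite) set \<Rightarrow> (real^'d) set" where
  "lie_algebra K = {a. \<forall>t::real. torus_exp (of_real_vec (t *\<^sub>R a)) \<in> K}"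

text \<open>The complexification of a closed subgroup \<^term>\<open>K\<close> of the compact torus, by the polar
  decomposition \<open>K\<^sub>\<complex> = K exp(\<i> Lie K)\<close>.\<close>

definition complexification :: "(complex^'d::finite) set \<Rightarrow> (complex^'d) set" where
  "complexification K = {g * torus_exp (\<i> *s of_real_vec a) | g a. g \<in> K \<and> a \<in> lie_algebra K}"

definition git_proj ::
    "(real^'n::finite) set \<Rightarrow> ('d::finite \<Rightarrow> real^'n) \<Rightarrow> complex^'d \<Rightarrow> (complex^'d) set" where
  "git_proj \<Lambda> u z = (\<lambda>g. g * z) ` complexification (kernel_group \<Lambda> u)"

definition quotient_topology :: "'x topology \<Rightarrow> ('x \<Rightarrow> 'y) \<Rightarrow> 'y topology" where
  "quotient_topology X f =
     topology (\<lambda>V. V \<subseteq> f ` topspace X \<and> openin X {x \<in> topspace X. f x \<in> V})"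

text \<open>The complex manifold structure of a quotient \<open>f : S \<rightarrow> f ` S\<close> has as holomorphic functions
  on an open \<open>V\<close> the functions \<open>h\<close> such that \<open>h \<circ> f\<close> is holomorphic on the preimage of \<open>V\<close>.  Its
  charts are the isomorphisms, for these sheaves of functions, of open subsets with open
  subsets of \<open>\<complex>\<^sup>n\<close>.\<close>

definition quotient_atlas ::
    "(complex^'d::finite) set \<Rightarrow> (complex^'d \<Rightarrow> 'y) \<Rightarrow> ('y, complex^'n::finite) chart set" where
  "quotient_atlas S f = {(V, \<phi>).
     openin (quotient_topology (top_of_set S) f) V \<and> open (\<phi> ` V) \<and>
     homeomorphic_map (subtopology (quotient_topology (top_of_set S) f) V)
       (top_of_set (\<phi> ` V)) \<phi> \<and>
     (\<forall>W h. open W \<and> W \<subseteq> \<phi> ` V \<longrightarrow>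
        (holomorphic_map_on W h \<longleftrightarrow>
         holomorphic_map_on {z \<in> S. f z \<in> V \<and> \<phi> (f z) \<in> W} (h \<circ> \<phi> \<circ> f)))}"


section \<open>The bivector field induced by an action of a vector space\<close>

definition infinitesimal_action ::
    "('a::euclidean_space \<Rightarrow> 'm::euclidean_space \<Rightarrow> 'm) \<Rightarrow> 'a \<Rightarrow> 'm \<Rightarrow> 'm" where
  "infinitesimal_action \<alpha> v x = vector_derivative (\<lambda>t. \<alpha> (- (t *\<^sub>R v)) x) (at 0)"

definition exp_action :: "complex^'d::finite \<Rightarrow> complex^'d \<Rightarrow> complex^'d" where
  "exp_action w z = (\<chi> i. exp (w $ i) * z $ i)"

definition action_bivector ::
    "('a::euclidean_space \<Rightarrow> 'm::euclidean_space \<Rightarrow> 'm) \<Rightarrow> 'a bivector \<Rightarrow> 'm \<Rightarrow> 'm bivector" where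
  "action_bivector \<alpha> \<pi> x = push_bivector (Blinfun (\<lambda>v. infinitesimal_action \<alpha> v x)) \<pi>"

end

theory Submission
  imports Defs
begin

text \<open>A vertex of the polytope, with set \<open>I\<close> of facets through it, gives the open set \<open>U\<^sub>I\<close> of all
  \<open>z\<close> with \<open>z\<^sub>j \<noteq> 0\<close> for \<open>j \<notin> I\<close>, and \<open>\<Sigma>\<close> is the union of these sets.  Writing
  \<open>u\<^sub>j = \<Sum>\<^sub>i\<^sub>\<in>\<^sub>I m\<^sub>i\<^sub>j u\<^sub>i\<close> with integers \<open>m\<^sub>i\<^sub>j\<close>, setting the monomials \<open>z\<^sub>i \<Prod>\<^sub>j\<^sub>\<notin>\<^sub>I z\<^sub>j\<^bsup>m\<^sub>i\<^sub>j\<^esup>\<close>, \<open>i \<in> I\<close>, equal to \<open>1\<close>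
  cuts out \<open>N\<^sub>\<complex>\<close>; on \<open>U\<^sub>I\<close> these monomials separate the orbits and have holomorphic sections, so they are charts of
  the quotient.

  The bivector field \<open>\<pi>\<^sub>\<Sigma>\<close> is Poisson because the vector fields of the action commute, and it is invariant
  under \<open>N\<^sub>\<complex>\<close>, so it descends.  Positivity of \<open>\<pi>\<close> means that \<open>(\<xi>, \<eta>) \<mapsto> \<pi>(\<xi> \<circ> J, \<eta>)\<close> is a
  positive semidefinite symmetric form on covectors; this survives complex linear maps.  Projecting covectors
  orthogonally to the annihilator of a complex subspace \<open>W\<close> shows that the Dirac pullback to \<open>W\<close> is the graph
  of a bivector.  On an orbit, this bivector is the image under the action of one constant bivector, hence it is
  smooth.\<close>

section \<open>Smooth maps\<close>

text \<open>Three difficulties shape the proof. The quotient must be Hausdorff although the acting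
  group is not compact: two points without a common vertex chart are separated by comparing the
  functions \<open>sep I\<close>, moduli of generalised monomials attached to the vertices, all of
  which a group element multiplies by one and the same factor. The atlas of the quotient contains
  every chart that respects the sheaf of holomorphic functions, and nothing else is known about such
  a chart; so each statement about it is lifted to \<Sigma> and brought back along local sections
  that come from the vertex charts. Finally, \<pi> may be degenerate: the form on covectors is only
  semidefinite, orthogonal projections are not unique, and the bivector on a fibre is first found at
  a single point, without any smoothness. Two facts repair this: a null vector of a semidefinite
  form lies in its radical, and along an orbit both the tangent spaces and the bivector field arise
  from those at one base point by invertible linear maps.\<close>

lemma Ck_on_cong:
  assumes "open S" "\<And>x. x \<in> S \<Longrightarrow> f x = g x"
  shows "Ck_on k f S \<longleftrightarrow> Ck_on k g S"
  using assms(2)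
proof (induction k arbitrary: f g)
  case 0
  then show ?case by (simp cong: continuous_on_cong)
next
  case (Suc k)
  \<comment> \<open>\<open>frechet_derivative\<close> is a choice among all derivatives. Equality of
    the two predicates makes the choices equal, even where no derivative exists.\<close>
  have *: "(f has_derivative D) (at x) \<longleftrightarrow> (g has_derivative D) (at x)" if "x \<in> S" for x D
    using has_derivative_transform_within_open[OF _ assms(1) that, of f D UNIV g]
      has_derivative_transform_within_open[OF _ assms(1) that, of g D UNIV f] Suc.prems by auto
  then have "frechet_derivative f (at x) = frechet_derivative g (at x)"
     and 1: "f differentiable at x \<longleftrightarrow> g differentiable at x" if "x \<in> S" for x
    using that unfolding frechet_derivative_def differentiable_def by auto
  then have "Ck_on k (\<lambda>x. frechet_derivative f (at x) v) S \<longleftrightarrow> Ck_on k (\<lambda>x. frechet_derivative g (at x) v) S" for v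
    by (intro Suc.IH) simp
  with 1 show ?case by simp
qed

lemma Ck_on_subset: "Ck_on k f S \<Longrightarrow> T \<subseteq> S \<Longrightarrow> Ck_on k f T"
  by (induction k arbitrary: f) (auto intro: continuous_on_subset)

lemma Ck_on_Suc_D: "Ck_on (Suc k) f S \<Longrightarrow> Ck_on k f S"
proof (induction k arbitrary: f)
  case 0
  then show ?case
    by (auto intro!: continuous_at_imp_continuous_on differentiable_imp_continuous_within)
next
  case (Suc k)
  then have "Ck_on k (\<lambda>x. frechet_derivative f (at x) v) S" for v
    by (intro Suc.IH) (simp only: Ck_on.simps(2)[of "Suc k"])
  then show ?case using Suc.prems by simp
qed

lemma Ck_on_SucI:
  assumes "open S" "\<And>x. x \<in> S \<Longrightarrow> (f has_derivative f' x) (at x)"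
    "\<And>v. Ck_on k (\<lambda>x. f' x v) S"
  shows "Ck_on (Suc k) f S"
proof -
  have "frechet_derivative f (at x) = f' x" if "x \<in> S" for x
    using frechet_derivative_at[OF assms(2)[OF that]] by simp
  then have "Ck_on k (\<lambda>x. frechet_derivative f (at x) v) S" for v
    using assms(3)[of v] by (subst Ck_on_cong[OF assms(1)]) auto
  with assms(2) show ?thesis by (auto simp: differentiable_def)
qed

lemma Ck_on_const: "open S \<Longrightarrow> Ck_on k (\<lambda>x. c) S"
proof (induction k arbitrary: c)
  case (Suc k)
  show ?case
    by (rule Ck_on_SucI[OF Suc.prems, where f' = "\<lambda>x v. 0"]) (auto intro: Suc)
qed auto

lemma Ck_on_linear:
  assumes "open S" "bounded_linear f" shows "Ck_on k f S"
proof (cases k)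
  case 0
  then show ?thesis by (simp add: assms bounded_linear.linear linear_continuous_on)
next
  case (Suc l)
  show ?thesis unfolding Suc
    by (rule Ck_on_SucI[OF assms(1), where f' = "\<lambda>x. f"])
       (auto intro!: Ck_on_const assms bounded_linear_imp_has_derivative)
qed

lemma Ck_on_add:
  "open S \<Longrightarrow> Ck_on k f S \<Longrightarrow> Ck_on k g S \<Longrightarrow> Ck_on k (\<lambda>x. f x + g x) S"
proof (induction k arbitrary: f g)
  case 0
  then show ?case by (auto intro: continuous_intros)
next
  case (Suc k)
  show ?case
    by (rule Ck_on_SucI[OF Suc.prems(1), where
          f' = "\<lambda>x v. frechet_derivative f (at x) v + frechet_derivative g (at x) v"])
       (use Suc in \<open>auto intro!: has_derivative_add simp: frechet_derivative_works\<close>)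
qed

lemma Ck_on_sum:
  "open S \<Longrightarrow> (\<And>i. i \<in> A \<Longrightarrow> Ck_on k (f i) S) \<Longrightarrow> Ck_on k (\<lambda>x. \<Sum>i\<in>A. f i x) S"
  by (induction A rule: infinite_finite_induct) (auto intro!: Ck_on_const Ck_on_add)

lemma Ck_on_bilinear:
  assumes "open S" "bounded_bilinear B"
  shows "Ck_on k f S \<Longrightarrow> Ck_on k g S \<Longrightarrow> Ck_on k (\<lambda>x. B (f x) (g x)) S"
proof (induction k arbitrary: f g)
  case 0
  then show ?case by (auto intro: bounded_bilinear.continuous_on[OF assms(2)])
next
  case (Suc k)
  have "Ck_on k f S" "Ck_on k g S" using Suc.prems Ck_on_Suc_D by blast+
  with Suc show ?case
    by (intro Ck_on_SucI[OF assms(1), where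
          f' = "\<lambda>x v. B (f x) (frechet_derivative g (at x) v) + B (frechet_derivative f (at x) v) (g x)"])
       (auto intro!: bounded_bilinear.FDERIV[OF assms(2)] Ck_on_add[OF assms(1)]
         simp: frechet_derivative_works)
qed

lemma Ck_on_compose:
  assumes "open S" "open T"
  shows "Ck_on k f S \<Longrightarrow> f ` S \<subseteq> T \<Longrightarrow> Ck_on k g T \<Longrightarrow> Ck_on k (\<lambda>x. g (f x)) S"
proof (induction k arbitrary: g)
  case 0
  then show ?case by (auto intro: continuous_on_compose2)
next
  case (Suc k)
  let ?D = "\<lambda>x v. frechet_derivative f (at x) v"
  let ?G = "\<lambda>y v. frechet_derivative g (at y) v"
  have fk: "Ck_on k f S" using Suc.prems Ck_on_Suc_D by blast
  \<comment> \<open>The direction \<open>?D x v\<close> moves with x, whereas \<open>Ck_on\<close>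
    differentiates in fixed directions. Expanding it in the basis leaves fixed directions b with
    scalar coefficients, and the induction hypothesis applies to each
    \<open>?G (f x) b\<close>.\<close>
  have eq: "?G (f x) (?D x v) = (\<Sum>b\<in>Basis. (?D x v \<bullet> b) *\<^sub>R ?G (f x) b)" if "x \<in> S" for x v
  proof -
    have "linear (?G (f x))"
      using Suc.prems that by (auto intro!: linear_frechet_derivative)
    then show ?thesis
      by (subst euclidean_representation[symmetric, of "?D x v"])
         (simp add: linear_sum linear_scale del: euclidean_representation)
  qed
  have "Ck_on k (\<lambda>x. ?G (f x) (?D x v)) S" for v
  proof (subst Ck_on_cong[OF assms(1) eq], assumption, rule Ck_on_sum[OF assms(1)])
    fix b :: 'b assume "b \<in> Basis"
    show "Ck_on k (\<lambda>x. (?D x v \<bullet> b) *\<^sub>R ?G (f x) b) S"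
    proof (rule Ck_on_bilinear[OF assms(1) bounded_bilinear_scaleR])
      show "Ck_on k (\<lambda>x. ?D x v \<bullet> b) S"
        by (rule Ck_on_bilinear[OF assms(1) bounded_bilinear_inner])
           (use Suc.prems Ck_on_const assms in auto)
      show "Ck_on k (\<lambda>x. ?G (f x) b) S"
        using Suc.prems(3) by (intro Suc.IH[OF fk Suc.prems(2)]) simp
    qed
  qed
  then show ?case
    using Suc.prems
    by (intro Ck_on_SucI[OF assms(1), where f' = "\<lambda>x v. ?G (f x) (?D x v)"])
       (auto intro!: has_derivative_compose[of f _ _ _ g] simp: frechet_derivative_works)
qed

lemma Ck_on_local:
  "(\<And>x. x \<in> S \<Longrightarrow> \<exists>U. open U \<and> x \<in> U \<and> Ck_on k f (U \<inter> S)) \<Longrightarrow> Ck_on k f S"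
proof (induction k arbitrary: f)
  case 0
  have "continuous (at x within S) f" if x: "x \<in> S" for x
  proof -
    obtain U where U: "open U" "x \<in> U" "continuous_on (U \<inter> S) f" using 0 x by auto
    then have "continuous (at x within U \<inter> S) f"
      using x by (auto simp: continuous_on_eq_continuous_within)
    moreover have "at x within U \<inter> S = at x within S"
      using at_within_nhd[of x U "U \<inter> S" S] U by auto
    ultimately show ?thesis by simp
  qed
  then show ?case by (simp add: continuous_on_eq_continuous_within)
next
  case (Suc k)
  have "\<exists>U. open U \<and> x \<in> U \<and> Ck_on k (\<lambda>x. frechet_derivative f (at x) v) (U \<inter> S)" if "x \<in> S" for x v
    using Suc.prems[OF that] by auto
  then have "Ck_on k (\<lambda>x. frechet_derivative f (at x) v) S" for v by (intro Suc.IH) blast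
  moreover have "f differentiable at x" if "x \<in> S" for x
    using Suc.prems[OF that] that by auto
  ultimately show ?case by simp
qed

lemma smooth_on_cong:
  "open S \<Longrightarrow> (\<And>x. x \<in> S \<Longrightarrow> f x = g x) \<Longrightarrow> smooth_on S f \<longleftrightarrow> smooth_on S g"
  unfolding smooth_on_def using Ck_on_cong by blast

lemma smooth_on_subset: "smooth_on S f \<Longrightarrow> T \<subseteq> S \<Longrightarrow> smooth_on T f"
  unfolding smooth_on_def using Ck_on_subset by blast

lemma smooth_on_local:
  "(\<And>x. x \<in> S \<Longrightarrow> \<exists>U. open U \<and> x \<in> U \<and> smooth_on (U \<inter> S) f) \<Longrightarrow> smooth_on S f"
  unfolding smooth_on_def using Ck_on_local by metis

lemma smooth_on_const: "open S \<Longrightarrow> smooth_on S (\<lambda>x. c)"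
  and smooth_on_linear: "open S \<Longrightarrow> bounded_linear f \<Longrightarrow> smooth_on S f"
  and smooth_on_add: "open S \<Longrightarrow> smooth_on S g \<Longrightarrow> smooth_on S h \<Longrightarrow> smooth_on S (\<lambda>x. g x + h x)"
  and smooth_on_sum: "open S \<Longrightarrow> (\<And>i. i \<in> A \<Longrightarrow> smooth_on S (F i)) \<Longrightarrow> smooth_on S (\<lambda>x. \<Sum>i\<in>A. F i x)"
  unfolding smooth_on_def by (auto intro: Ck_on_const Ck_on_linear Ck_on_add Ck_on_sum)

lemma smooth_on_bilinear:
  "open S \<Longrightarrow> bounded_bilinear B \<Longrightarrow> smooth_on S f \<Longrightarrow> smooth_on S g \<Longrightarrow> smooth_on S (\<lambda>x. B (f x) (g x))"
  unfolding smooth_on_def by (auto intro: Ck_on_bilinear)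

lemma smooth_on_compose:
  assumes "open S" "open T" "smooth_on S f" "f ` S \<subseteq> T" "smooth_on T g"
  shows "smooth_on S (\<lambda>x. g (f x))"
  using assms Ck_on_compose[OF assms(1,2) _ assms(4)] unfolding smooth_on_def by blast

lemma smooth_on_linear_compose:
  assumes "open S" "bounded_linear g" "smooth_on S f"
  shows "smooth_on S (\<lambda>x. g (f x))"
  by (rule smooth_on_compose[OF assms(1) open_UNIV assms(3) _ smooth_on_linear[OF open_UNIV assms(2)]]) auto

text \<open>Bootstrapping for functions whose derivative is expressed through the function itself,
  such as the inverse and the exponential: k derivatives of the function yield k derivatives of its
  derivative.\<close>

lemma smooth_onI_induct:
  assumes "continuous_on S f"
    and "\<And>k. Ck_on k f S \<Longrightarrow> Ck_on (Suc k) f S"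
  shows "smooth_on S f"
  unfolding smooth_on_def
proof
  fix k show "Ck_on k f S"
    by (induction k) (use assms in \<open>auto simp del: Ck_on.simps(2)\<close>)
qed

lemma smooth_on_continuous_on: "smooth_on S f \<Longrightarrow> continuous_on S f"
  unfolding smooth_on_def by (metis Ck_on.simps(1))

lemma smooth_on_differentiable: "smooth_on S f \<Longrightarrow> x \<in> S \<Longrightarrow> f differentiable (at x)"
  unfolding smooth_on_def by (metis Ck_on.simps(2))

lemma differentiable_total_deriv:
  "f differentiable (at x) \<Longrightarrow> (f has_derivative blinfun_apply (total_deriv f x)) (at x)"
  unfolding total_deriv_def
  by (simp add: bounded_linear_Blinfun_apply frechet_derivative_works has_derivative_bounded_linear)

lemma smooth_on_total_deriv_works:
  "smooth_on S f \<Longrightarrow> x \<in> S \<Longrightarrow> (f has_derivative blinfun_apply (total_deriv f x)) (at x)"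
  by (simp add: differentiable_total_deriv smooth_on_differentiable)

lemma total_derivI:
  "(f has_derivative f') (at x) \<Longrightarrow> blinfun_apply (total_deriv f x) = f'"
  by (metis differentiableI differentiable_total_deriv has_derivative_unique)

lemma total_deriv_cong:
  assumes "open S" "x \<in> S" "\<And>y. y \<in> S \<Longrightarrow> f y = g y"
  shows "total_deriv f x = total_deriv g x"
proof -
  have "(f has_derivative D) (at x) \<longleftrightarrow> (g has_derivative D) (at x)" for D
    using has_derivative_transform_within_open[OF _ assms(1,2), of f D UNIV g]
      has_derivative_transform_within_open[OF _ assms(1,2), of g D UNIV f] assms(3) by auto
  then show ?thesis by (simp add: total_deriv_def frechet_derivative_def)
qed

lemma smooth_on_total_deriv:
  assumes "open S" "smooth_on S f" shows "smooth_on S (\<lambda>x. blinfun_apply (total_deriv f x) v)"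
proof -
  have "blinfun_apply (total_deriv f x) v = frechet_derivative f (at x) v" if "x \<in> S" for x
    using smooth_on_total_deriv_works[OF assms(2) that] frechet_derivative_at by metis
  then have "smooth_on S (\<lambda>x. blinfun_apply (total_deriv f x) v)
      \<longleftrightarrow> smooth_on S (\<lambda>x. frechet_derivative f (at x) v)"
    by (rule smooth_on_cong[OF assms(1)])
  moreover have "Ck_on k (\<lambda>x. frechet_derivative f (at x) v) S" for k
    using assms(2) Ck_on.simps(2)[of k f S] unfolding smooth_on_def by blast
  ultimately show ?thesis unfolding smooth_on_def by blast
qed

lemma total_deriv_compose:
  assumes "f differentiable (at x)" "g differentiable (at (f x))"
  shows "total_deriv (\<lambda>x. g (f x)) x = total_deriv g (f x) o\<^sub>L total_deriv f x"
  using total_derivI[OF has_derivative_compose[OF differentiable_total_deriv[OF assms(1)]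
      differentiable_total_deriv[OF assms(2)]]]
  by (intro blinfun_eqI) simp

lemma total_deriv_linear:
  "bounded_linear f \<Longrightarrow> blinfun_apply (total_deriv f x) = f"
  by (rule total_derivI) (rule bounded_linear_imp_has_derivative)

section \<open>Smoothness of explicit maps: components, products, integer powers,
  exponentials\<close>

lemma smooth_on_vec:
  fixes f :: "'a::euclidean_space \<Rightarrow> 'b::euclidean_space ^'n::finite"
  assumes "open S" "\<And>i. smooth_on S (\<lambda>x. f x $ i)"
  shows "smooth_on S f"
proof -
  have eq: "f x = (\<Sum>i\<in>UNIV. axis i (f x $ i))" for x
    by (simp add: vec_eq_iff axis_def)
  have lin: "bounded_linear (axis i :: 'b \<Rightarrow> 'b^'n)" for i
    by (rule linear_conv_bounded_linear[THEN iffD1], rule linearI) (auto simp: axis_def vec_eq_iff)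
  have "smooth_on S (\<lambda>x. \<Sum>i\<in>UNIV. axis i (f x $ i))"
    by (rule smooth_on_sum[OF assms(1)], rule smooth_on_linear_compose[OF assms(1) lin assms(2)])
  then show ?thesis by (simp only: eq[symmetric])
qed

lemma smooth_on_mult:
  fixes f g :: "'a::euclidean_space \<Rightarrow> complex"
  shows "open S \<Longrightarrow> smooth_on S f \<Longrightarrow> smooth_on S g \<Longrightarrow> smooth_on S (\<lambda>x. f x * g x)"
  by (rule smooth_on_bilinear[OF _ bounded_bilinear_mult])

lemma smooth_on_inverse_complex: "smooth_on (- {0::complex}) inverse"
proof (rule smooth_onI_induct)
  show "continuous_on (-{0::complex}) inverse" by (auto intro!: continuous_intros)
  fix k assume k: "Ck_on k (inverse :: complex \<Rightarrow> complex) (-{0})"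
  have o: "open (-{0::complex})" by auto
  have *: "Ck_on k (\<lambda>x. - (inverse x * v * inverse x)) (-{0::complex})" for v
    by (rule Ck_on_compose[OF o open_UNIV _ _ Ck_on_linear[OF open_UNIV bounded_linear_minus[OF bounded_linear_ident]]],
        rule Ck_on_bilinear[OF o bounded_bilinear_mult _ k], rule Ck_on_bilinear[OF o bounded_bilinear_mult k Ck_on_const[OF o]])
       simp
  show "Ck_on (Suc k) (inverse :: complex \<Rightarrow> complex) (-{0})"
    by (rule Ck_on_SucI[OF o _ *]) (auto intro!: has_derivative_inverse')
qed

lemma smooth_on_power:
  fixes f :: "'a::euclidean_space \<Rightarrow> complex"
  shows "open S \<Longrightarrow> smooth_on S f \<Longrightarrow> smooth_on S (\<lambda>x. f x ^ n)"
  by (induction n) (auto intro!: smooth_on_const smooth_on_mult)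

lemma smooth_on_power_int:
  fixes f :: "'a::euclidean_space \<Rightarrow> complex"
  assumes "open S" "smooth_on S f" "\<And>x. x \<in> S \<Longrightarrow> f x \<noteq> 0"
  shows "smooth_on S (\<lambda>x. f x powi n)"
proof (cases "n \<ge> 0")
  case True
  then show ?thesis using assms by (simp add: power_int_def smooth_on_power)
next
  case False
  have "smooth_on S (\<lambda>x. inverse (f x))"
    by (rule smooth_on_compose[OF assms(1) _ assms(2) _ smooth_on_inverse_complex]) (use assms in auto)
  with False assms show ?thesis by (simp add: power_int_def smooth_on_power)
qed

lemma smooth_on_exp_line:
  assumes "open S" shows "smooth_on S (\<lambda>t::real. exp (of_real t * w) :: complex)"
proof (rule smooth_onI_induct)
  show "continuous_on S (\<lambda>t::real. exp (of_real t * w) :: complex)" by (intro continuous_intros)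
  fix k assume k: "Ck_on k (\<lambda>t::real. exp (of_real t * w) :: complex) S"
  have *: "Ck_on k (\<lambda>t::real. exp (of_real t * w) * (of_real v * w)) S" for v
    by (rule Ck_on_bilinear[OF assms bounded_bilinear_mult k Ck_on_const[OF assms]])
  show "Ck_on (Suc k) (\<lambda>t::real. exp (of_real t * w) :: complex) S"
  proof (rule Ck_on_SucI[OF assms _ *])
    fix x :: real
    have "((\<lambda>t. of_real t * w) has_derivative (\<lambda>v. of_real v * w)) (at x)"
      by (intro has_derivative_mult_left has_derivative_of_real has_derivative_ident)
    from has_derivative_compose[OF this DERIV_exp[unfolded has_field_derivative_def]]
    show "((\<lambda>t. exp (of_real t * w)) has_derivative (\<lambda>v. exp (of_real x * w) * (of_real v * w))) (at x)" .
  qed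
qed

text \<open>The mean value theorem is applied twice: to the difference of two parallel slices in
  direction v, then to the derivative in direction v along w. The intermediate point is not
  controlled, so the whole parallelogram has to lie in S.\<close>

lemma mixed_difference_mvt:
  fixes f :: "'a::euclidean_space \<Rightarrow> real"
  assumes S: "open S" "smooth_on S f" and h: "h > 0"
    and sub: "\<And>s t. 0 \<le> s \<Longrightarrow> s \<le> h \<Longrightarrow> 0 \<le> t \<Longrightarrow> t \<le> h \<Longrightarrow> x + s *\<^sub>R v + t *\<^sub>R w \<in> S"
  shows "\<exists>s t. 0 \<le> s \<and> s \<le> h \<and> 0 \<le> t \<and> t \<le> h \<and>
     f (x + h *\<^sub>R v + h *\<^sub>R w) - f (x + h *\<^sub>R v) - f (x + h *\<^sub>R w) + f x =
       h\<^sup>2 * total_deriv (\<lambda>y. total_deriv f y v) (x + s *\<^sub>R v + t *\<^sub>R w) w"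
proof -
  let ?d = "\<lambda>y. total_deriv f y v"
  have d: "smooth_on S ?d" by (rule smooth_on_total_deriv[OF S])
  have 1: "((\<lambda>s. f (x + s *\<^sub>R v + h *\<^sub>R w) - f (x + s *\<^sub>R v)) has_derivative
      (\<lambda>r. r * (?d (x + s *\<^sub>R v + h *\<^sub>R w) - ?d (x + s *\<^sub>R v)))) (at s within {0..h})"
    if "s \<in> {0..h}" for s
  proof -
    have "x + s *\<^sub>R v + h *\<^sub>R w \<in> S" "x + s *\<^sub>R v + 0 *\<^sub>R w \<in> S" using that h by (intro sub; simp)+
    then have a: "(f has_derivative total_deriv f (x + s *\<^sub>R v + h *\<^sub>R w)) (at (x + s *\<^sub>R v + h *\<^sub>R w))"
       "(f has_derivative total_deriv f (x + s *\<^sub>R v)) (at (x + s *\<^sub>R v))"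
      using smooth_on_total_deriv_works[OF S(2)] by auto
    have "((\<lambda>s. f (x + s *\<^sub>R v + h *\<^sub>R w)) has_derivative (\<lambda>r. total_deriv f (x + s *\<^sub>R v + h *\<^sub>R w) (r *\<^sub>R v)))
       (at s within {0..h})"
      by (rule has_derivative_compose[where f = "\<lambda>s. x + s *\<^sub>R v + h *\<^sub>R w" and f' = "\<lambda>r. r *\<^sub>R v" and g = f, OF _ a(1)]) (auto intro!: derivative_eq_intros)
    moreover have "((\<lambda>s. f (x + s *\<^sub>R v)) has_derivative (\<lambda>r. total_deriv f (x + s *\<^sub>R v) (r *\<^sub>R v)))
       (at s within {0..h})"
      by (rule has_derivative_compose[where f = "\<lambda>s. x + s *\<^sub>R v" and f' = "\<lambda>r. r *\<^sub>R v" and g = f, OF _ a(2)]) (auto intro!: derivative_eq_intros)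
    ultimately show ?thesis
      by (auto intro!: derivative_eq_intros simp: blinfun.scaleR_right algebra_simps)
  qed
  obtain s where s: "s \<in> {0<..<h}" "(f (x + h *\<^sub>R v + h *\<^sub>R w) - f (x + h *\<^sub>R v))
       - (f (x + 0 *\<^sub>R v + h *\<^sub>R w) - f (x + 0 *\<^sub>R v)) = (h - 0) * (?d (x + s *\<^sub>R v + h *\<^sub>R w) - ?d (x + s *\<^sub>R v))"
    using mvt_simple[OF h 1] by auto
  have 2: "((\<lambda>t. ?d (x + s *\<^sub>R v + t *\<^sub>R w)) has_derivative
      (\<lambda>r. r * total_deriv ?d (x + s *\<^sub>R v + t *\<^sub>R w) w)) (at t within {0..h})"
    if "t \<in> {0..h}" for t
  proof -
    have "x + s *\<^sub>R v + t *\<^sub>R w \<in> S" using that s by (intro sub; simp)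
    note a = smooth_on_total_deriv_works[OF d this]
    have "((\<lambda>t. ?d (x + s *\<^sub>R v + t *\<^sub>R w)) has_derivative (\<lambda>r. total_deriv ?d (x + s *\<^sub>R v + t *\<^sub>R w) (r *\<^sub>R w)))
       (at t within {0..h})"
      by (rule has_derivative_compose[where f = "\<lambda>t. x + s *\<^sub>R v + t *\<^sub>R w" and f' = "\<lambda>r. r *\<^sub>R w" and g = "?d", OF _ a]) (auto intro!: derivative_eq_intros)
    then show ?thesis by (simp add: blinfun.scaleR_right)
  qed
  obtain t where t: "t \<in> {0<..<h}" "?d (x + s *\<^sub>R v + h *\<^sub>R w) - ?d (x + s *\<^sub>R v + 0 *\<^sub>R w)
     = (h - 0) * total_deriv ?d (x + s *\<^sub>R v + t *\<^sub>R w) w"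
    using mvt_simple[OF h 2] by auto
  show ?thesis
    using s t by (intro exI[of _ s] exI[of _ t]) (auto simp: power2_eq_square algebra_simps)
qed

text \<open>The mixed second difference is symmetric in v and w. It equals \<open>h\<^sup>2\<close>
  times either mixed derivative at some point near x, so the continuous functions \<open>?A\<close>
  and \<open>?B\<close> take equal values at points arbitrarily close to x.\<close>

lemma total_deriv_symmetric:
  fixes f :: "'a::euclidean_space \<Rightarrow> real"
  assumes S: "open S" "smooth_on S f" and x: "x \<in> S"
  shows "total_deriv (\<lambda>y. total_deriv f y v) x w = total_deriv (\<lambda>y. total_deriv f y w) x v"
    (is "?A x = ?B x")
proof (rule ccontr)
  assume ne: "?A x \<noteq> ?B x"
  \<comment> \<open>Half the gap: a value within e of \<open>?A x\<close> cannot equal a value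
    within e of \<open>?B x\<close>.\<close>
  define e where "e = \<bar>?A x - ?B x\<bar> / 2"
  have e: "e > 0" using ne by (simp add: e_def)
  have cont: "continuous_on S ?A" "continuous_on S ?B"
    by (intro smooth_on_continuous_on smooth_on_total_deriv S)+
  obtain d1 where d1: "d1 > 0" "\<And>y. y \<in> S \<Longrightarrow> dist y x < d1 \<Longrightarrow> dist (?A y) (?A x) < e"
    using cont(1) x e unfolding continuous_on_iff by meson
  obtain d2 where d2: "d2 > 0" "\<And>y. y \<in> S \<Longrightarrow> dist y x < d2 \<Longrightarrow> dist (?B y) (?B x) < e"
    using cont(2) x e unfolding continuous_on_iff by meson
  obtain d3 where d3: "d3 > 0" "ball x d3 \<subseteq> S" using S(1) x openE by blast
  define d where "d = min d1 (min d2 d3)"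
  have d: "d > 0" using d1 d2 d3 by (simp add: d_def)
  \<comment> \<open>Small enough for the parallelogram with sides \<open>h *\<^sub>R v\<close> and
    \<open>h *\<^sub>R w\<close> to stay within d of x; the 1 keeps the denominator positive when
    both vectors vanish.\<close>
  define h where "h = d / 2 / (norm v + norm w + 1)"
  have pos: "norm v + norm w + 1 > 0" by (simp add: add_nonneg_pos)
  have h: "h > 0" using d pos by (simp add: h_def)
  have near: "dist (x + s *\<^sub>R v + t *\<^sub>R w) x < d" if "0 \<le> s" "s \<le> h" "0 \<le> t" "t \<le> h" for s t
  proof -
    have "norm (s *\<^sub>R v + t *\<^sub>R w) \<le> s * norm v + t * norm w"
      using norm_triangle_ineq[of "s *\<^sub>R v" "t *\<^sub>R w"] that by simp
    also have "\<dots> \<le> h * norm v + h * norm w" using that by (intro add_mono mult_right_mono) auto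
    also have "\<dots> \<le> h * (norm v + norm w + 1)" using h by (simp add: algebra_simps)
    also have "\<dots> = d / 2"
      using pos unfolding h_def by (metis less_numeral_extra(3) nonzero_divide_eq_eq)
    also have "\<dots> < d" using d by simp
    finally show ?thesis by (simp add: dist_norm add.assoc)
  qed
  then have sub: "x + s *\<^sub>R v + t *\<^sub>R w \<in> S" if "0 \<le> s" "s \<le> h" "0 \<le> t" "t \<le> h" for s t
    using d3(2) that near[OF that] by (auto simp: d_def dist_commute subset_iff)
  obtain s t where st: "0 \<le> s" "s \<le> h" "0 \<le> t" "t \<le> h"
     "f (x + h *\<^sub>R v + h *\<^sub>R w) - f (x + h *\<^sub>R v) - f (x + h *\<^sub>R w) + f x = h\<^sup>2 * ?A (x + s *\<^sub>R v + t *\<^sub>R w)"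
    using mixed_difference_mvt[OF S h sub] by auto
  have sub': "x + s *\<^sub>R w + t *\<^sub>R v \<in> S" if "0 \<le> s" "s \<le> h" "0 \<le> t" "t \<le> h" for s t
    using sub[of t s] that by (simp add: add_ac)
  obtain s' t' where st': "0 \<le> s'" "s' \<le> h" "0 \<le> t'" "t' \<le> h"
     "f (x + h *\<^sub>R w + h *\<^sub>R v) - f (x + h *\<^sub>R w) - f (x + h *\<^sub>R v) + f x = h\<^sup>2 * ?B (x + s' *\<^sub>R w + t' *\<^sub>R v)"
    using mixed_difference_mvt[OF S h sub'] by auto
  have "h\<^sup>2 * ?A (x + s *\<^sub>R v + t *\<^sub>R w) = h\<^sup>2 * ?B (x + s' *\<^sub>R w + t' *\<^sub>R v)"
    using st(5) st'(5) by (simp add: add_ac algebra_simps)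
  then have eq: "?A (x + s *\<^sub>R v + t *\<^sub>R w) = ?B (x + t' *\<^sub>R v + s' *\<^sub>R w)" using h by (simp add: add_ac)
  have "dist (?A (x + s *\<^sub>R v + t *\<^sub>R w)) (?A x) < e"
    using st near[of s t] sub[of s t] by (intro d1) (auto simp: d_def)
  moreover have "dist (?B (x + t' *\<^sub>R v + s' *\<^sub>R w)) (?B x) < e"
    using st' near[of t' s'] sub[of t' s'] by (intro d2) (auto simp: d_def)
  ultimately show False using eq unfolding e_def dist_real_def by (auto simp: abs_if split: if_splits)
qed

section \<open>Bivectors and Poisson brackets\<close>

lemma covector_expand:
  fixes \<xi> :: "'e::euclidean_space \<Rightarrow>\<^sub>L real"
  shows "\<xi> = (\<Sum>b\<in>Basis. \<xi> b *\<^sub>R blinfun_inner_right b)"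
proof (rule blinfun_eqI)
  fix v :: 'e
  have "\<xi> v = \<xi> (\<Sum>b\<in>Basis. (v \<bullet> b) *\<^sub>R b)" by (simp add: euclidean_representation)
  also have "\<dots> = (\<Sum>b\<in>Basis. (v \<bullet> b) * \<xi> b)"
    by (simp add: blinfun.sum_right blinfun.scaleR_right)
  finally show "\<xi> v = (\<Sum>b\<in>Basis. \<xi> b *\<^sub>R blinfun_inner_right b) v"
    by (simp add: blinfun.sum_left blinfun.scaleR_left inner_commute mult.commute)
qed

lemma bivector_bilinear: "is_bivector \<pi> \<Longrightarrow> bilinear \<pi>"
  and bivector_refl: "is_bivector \<pi> \<Longrightarrow> \<pi> \<xi> \<xi> = 0"
  by (auto simp: is_bivector_def)

lemma bivector_antisym:
  assumes "is_bivector \<pi>" shows "\<pi> \<xi> \<eta> = - \<pi> \<eta> \<xi>"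
proof -
  note b = bivector_bilinear[OF assms]
  have "\<pi> (\<xi> + \<eta>) (\<xi> + \<eta>) = 0" by (rule bivector_refl[OF assms])
  then have "\<pi> \<xi> \<eta> + \<pi> \<eta> \<xi> = 0"
    by (simp add: bilinear_ladd[OF b] bilinear_radd[OF b]
        bivector_refl[OF assms, of \<xi>] bivector_refl[OF assms, of \<eta>])
  then show ?thesis by linarith
qed

lemma bivector_expand:
  assumes "is_bivector \<pi>"
  shows "\<pi> \<xi> \<eta> = (\<Sum>a\<in>Basis. \<Sum>b\<in>Basis.
     \<pi> (blinfun_inner_right a) (blinfun_inner_right b) * (\<xi> a * \<eta> b))"
proof -
  note b = bivector_bilinear[OF assms]
  then have lin: "linear (\<lambda>\<xi>. \<pi> \<xi> \<eta>)" "linear (\<pi> \<xi>)" for \<xi> \<eta> by (auto simp: bilinear_def)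
  have "\<pi> \<xi> \<eta> = \<pi> (\<Sum>b\<in>Basis. \<xi> b *\<^sub>R blinfun_inner_right b) (\<Sum>b\<in>Basis. \<eta> b *\<^sub>R blinfun_inner_right b)"
    using covector_expand by metis
  also have "\<dots> = (\<Sum>b\<in>Basis. \<Sum>a\<in>Basis. \<eta> b * (\<xi> a * \<pi> (blinfun_inner_right a) (blinfun_inner_right b)))"
    by (simp add: linear_sum[OF lin(1)] linear_sum[OF lin(2)] bilinear_lmul[OF b] bilinear_rmul[OF b]
        sum_distrib_left)
  finally show ?thesis by (subst sum.swap) (simp add: mult_ac)
qed

lemma smooth_on_mult_real:
  fixes f g :: "'a::euclidean_space \<Rightarrow> real"
  shows "open S \<Longrightarrow> smooth_on S f \<Longrightarrow> smooth_on S g \<Longrightarrow> smooth_on S (\<lambda>x. f x * g x)"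
  by (rule smooth_on_bilinear[OF _ bounded_bilinear_mult])

lemma smooth_on_bivector_apply:
  assumes "open S" "\<And>\<xi> \<eta>. smooth_on S (\<lambda>x. \<pi> x \<xi> \<eta>)" "\<And>x. x \<in> S \<Longrightarrow> is_bivector (\<pi> x)"
    "\<And>v. smooth_on S (\<lambda>x. blinfun_apply (\<xi> x) v)" "\<And>v. smooth_on S (\<lambda>x. blinfun_apply (\<eta> x) v)"
  shows "smooth_on S (\<lambda>x. \<pi> x (\<xi> x) (\<eta> x))"
proof -
  have "smooth_on S (\<lambda>x. \<Sum>a\<in>Basis. \<Sum>b\<in>Basis.
     \<pi> x (blinfun_inner_right a) (blinfun_inner_right b) * (\<xi> x a * \<eta> x b))"
    by (intro smooth_on_sum smooth_on_mult_real assms)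
  then show ?thesis
    by (subst smooth_on_cong[OF assms(1) bivector_expand[OF assms(3)]])
qed

lemma smooth_on_poisson_bracket:
  assumes "open S" "smooth_bivector_on S \<pi>" "smooth_on S f" "smooth_on S g"
  shows "smooth_on S (poisson_bracket \<pi> f g)"
  unfolding poisson_bracket_def
  by (rule smooth_on_bivector_apply)
     (use assms in \<open>auto simp: smooth_bivector_on_def intro!: smooth_on_total_deriv\<close>)

section \<open>Pushforward of bivectors and the sharp map\<close>

lemma bilinear_push_bivector: "bilinear \<pi> \<Longrightarrow> bilinear (push_bivector L \<pi>)"
  by (simp add: bilinear_def push_bivector_def linear_iff bounded_bilinear.add_left[OF bounded_bilinear_blinfun_compose]
      bounded_bilinear.scaleR_left[OF bounded_bilinear_blinfun_compose])

lemma is_bivector_push: "is_bivector \<pi> \<Longrightarrow> is_bivector (push_bivector L \<pi>)"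
  unfolding is_bivector_def using bilinear_push_bivector by (auto simp: push_bivector_def)

lemma blinfun_compose_assoc: "(f o\<^sub>L g) o\<^sub>L h = f o\<^sub>L (g o\<^sub>L h)"
  by (rule blinfun_eqI) simp

lemma blinfun_compose_id: "f o\<^sub>L id_blinfun = f"
  by (rule blinfun_eqI) simp

lemma push_bivector_compose: "push_bivector L (push_bivector K \<pi>) = push_bivector (L o\<^sub>L K) \<pi>"
  by (simp add: push_bivector_def blinfun_compose_assoc)

lemma push_bivector_id: "push_bivector id_blinfun \<pi> = \<pi>"
  by (simp add: push_bivector_def blinfun_compose_id)

lemma covector_ext:
  fixes v w :: "'e::euclidean_space"
  assumes "\<And>\<eta>::'e \<Rightarrow>\<^sub>L real. \<eta> v = \<eta> w" shows "v = w"
  using assms[of "blinfun_inner_right b" for b] by (metis blinfun_inner_right.rep_eq euclidean_eqI inner_commute)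

text \<open>The vector with coordinates \<open>\<pi> \<xi> (blinfun_inner_right b)\<close> is a
  solution and covectors separate points, so the definite description in \<open>sharp\<close>
  denotes.\<close>

lemma sharp_apply:
  assumes "is_bivector \<pi>" shows "blinfun_apply \<eta> (sharp \<pi> \<xi>) = \<pi> \<xi> \<eta>"
proof -
  have lin: "linear (\<pi> \<xi>)" using bivector_bilinear[OF assms] by (auto simp: bilinear_def)
  have "blinfun_apply \<eta> (\<Sum>b\<in>Basis. \<pi> \<xi> (blinfun_inner_right b) *\<^sub>R b) = \<pi> \<xi> \<eta>" for \<eta>
    by (subst (2) covector_expand)
       (simp add: linear_sum[OF lin] linear_cmul[OF lin] blinfun.sum_right blinfun.scaleR_right mult.commute)
  then have "\<exists>!v. \<forall>\<eta>. blinfun_apply \<eta> v = \<pi> \<xi> \<eta>"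
    by (intro ex1I[of _ "\<Sum>b\<in>Basis. \<pi> \<xi> (blinfun_inner_right b) *\<^sub>R b"], blast)
       (rule covector_ext, simp)
  from theI'[OF this] show ?thesis by (simp add: sharp_def)
qed

lemma sharp_eqI:
  assumes "is_bivector \<pi>" "\<And>\<eta>. blinfun_apply \<eta> v = \<pi> \<xi> \<eta>" shows "sharp \<pi> \<xi> = v"
  by (rule covector_ext) (simp add: sharp_apply[OF assms(1)] assms(2))

lemma sharp_push:
  assumes "is_bivector \<pi>" shows "sharp (push_bivector L \<pi>) \<xi> = L (sharp \<pi> (\<xi> o\<^sub>L L))"
  by (rule sharp_eqI[OF is_bivector_push[OF assms]])
     (simp add: push_bivector_def sharp_apply[OF assms, symmetric])

text \<open>The algebra of the Jacobi identity for constant coefficients p: f1, g1, h1 stand for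
  first and f2, g2, h2 for second derivatives, and \<open>J\<close> is an expanded iterated bracket.
  Each \<open>J\<close> is a difference of two contractions \<open>T\<close>. Reversing the four
  indices changes two signs, so \<open>T u v w = T w v u\<close> for symmetric v, and the six
  contractions cancel in pairs.\<close>

lemma jacobi_sum:
  fixes p :: "'i \<Rightarrow> 'i \<Rightarrow> real" and I :: "'i set"
  assumes p: "\<And>a b. p a b = - p b a"
    and sym: "\<And>a b. f2 a b = f2 b a" "\<And>a b. g2 a b = g2 b a" "\<And>a b. h2 a b = h2 b a"
  defines "J \<equiv> \<lambda>u v1 v2 w1 w2. \<Sum>a\<in>I. \<Sum>b\<in>I. p a b * (u a * (\<Sum>c\<in>I. \<Sum>d\<in>I. p c d * (v2 b c * w1 d + v1 c * w2 b d)))"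
  shows "J f1 g1 g2 h1 h2 + J g1 h1 h2 f1 f2 + J h1 f1 f2 g1 g2 = 0"
proof -
  define T where "T = (\<lambda>u v w. \<Sum>(a,b,c,d)\<in>I\<times>I\<times>I\<times>I. p a b * p c d * u a * v b c * w d)"
  have J: "J u v1 v2 w1 w2 = T u v2 w1 - T u w2 v1" for u v1 v2 w1 w2
  proof -
    have "J u v1 v2 w1 w2 = (\<Sum>(a,b,c,d)\<in>I\<times>I\<times>I\<times>I. p a b * p c d * u a * (v2 b c * w1 d + v1 c * w2 b d))"
      by (simp add: J_def sum.cartesian_product[symmetric] sum_distrib_left mult_ac)
    also have "\<dots> = T u v2 w1 + (\<Sum>(a,b,c,d)\<in>I\<times>I\<times>I\<times>I. p a b * p c d * u a * v1 c * w2 b d)"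
      by (simp add: T_def sum.distrib[symmetric] case_prod_unfold algebra_simps)
    also have "(\<Sum>(a,b,c,d)\<in>I\<times>I\<times>I\<times>I. p a b * p c d * u a * v1 c * w2 b d)
       = (\<Sum>(a,b,c,d)\<in>I\<times>I\<times>I\<times>I. p a b * p d c * u a * v1 d * w2 b c)"
      by (rule sum.reindex_bij_witness[where i = "\<lambda>(a,b,c,d). (a,b,d,c)" and j = "\<lambda>(a,b,c,d). (a,b,d,c)"]) auto
    also have "\<dots> = - T u w2 v1"
      by (simp add: T_def sum_negf[symmetric] case_prod_unfold p[of "snd (snd (snd x))" "fst (snd (snd x))" for x] mult_ac)
    finally show ?thesis by simp
  qed
  have T: "T u v w = T w v u" if "\<And>a b. v a b = v b a" for u v w
  proof -
    have "T u v w = (\<Sum>(a,b,c,d)\<in>I\<times>I\<times>I\<times>I. p d c * p b a * u d * v c b * w a)"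
      unfolding T_def
      by (rule sum.reindex_bij_witness[where i = "\<lambda>(a,b,c,d). (d,c,b,a)" and j = "\<lambda>(a,b,c,d). (d,c,b,a)"]) auto
    also have "\<dots> = T w v u" unfolding T_def
    proof (rule sum.cong[OF refl], clarify)
      fix a b c d
      show "p d c * p b a * u d * v c b * w a = p a b * p c d * w a * v b c * u d"
        by (simp add: p[of d c] p[of b a] that[of c b])
    qed
    finally show ?thesis .
  qed
  show ?thesis
    using T[OF sym(1), where u = g1 and w = h1] T[OF sym(2), where u = f1 and w = h1]
      T[OF sym(3), where u = f1 and w = g1] by (simp add: J)
qed

text \<open>For fixed a, sending x to \<open>B x a\<close> is a linear vector field;
  \<open>commute\<close> says that two of them commute as endomorphisms, which for linear fields
  means that their Lie bracket vanishes.\<close>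

locale commuting_action =
  fixes B :: "'e::euclidean_space \<Rightarrow> 'a::euclidean_space \<Rightarrow> 'e"
  assumes bounded_bilinear_B: "bounded_bilinear B"
    and commute: "B (B x a) b = B (B x b) a"
begin

lemma bounded_linear_B: "bounded_linear (B x)"
  using bounded_bilinear.bounded_linear_right[OF bounded_bilinear_B] .

lemma bounded_linear_B_left: "bounded_linear (\<lambda>x. B x a)"
  using bounded_bilinear.bounded_linear_left[OF bounded_bilinear_B] .

definition lie_deriv :: "'a \<Rightarrow> ('e \<Rightarrow> real) \<Rightarrow> 'e \<Rightarrow> real" where
  "lie_deriv a f x = total_deriv f x (B x a)"

lemma lie_deriv_expand:
  "lie_deriv a f x = (\<Sum>e\<in>Basis. (B x a \<bullet> e) * total_deriv f x e)"
  unfolding lie_deriv_def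
  by (subst euclidean_representation[of "B x a", symmetric])
     (simp add: blinfun.sum_right blinfun.scaleR_right del: euclidean_representation)

lemma smooth_lie_deriv:
  assumes "open S" "smooth_on S f" shows "smooth_on S (lie_deriv a f)"
proof -
  have "smooth_on S (\<lambda>x. \<Sum>e\<in>Basis. (B x a \<bullet> e) * total_deriv f x e)"
    by (intro smooth_on_sum smooth_on_mult_real smooth_on_total_deriv assms
        smooth_on_linear bounded_linear_inner_left_comp bounded_linear_B_left)
  then show ?thesis by (simp add: lie_deriv_expand[abs_def])
qed

text \<open>An iterated Lie derivative is a Hessian term plus the first derivative in direction
  \<open>B (B x a) b\<close>. The former is symmetric in a and b by equality of mixed partials, the
  latter by \<open>commute\<close>.\<close>

lemma lie_deriv_symmetric:
  assumes S: "open S" "smooth_on S f" and x: "x \<in> S"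
  shows "lie_deriv a (lie_deriv b f) x = lie_deriv b (lie_deriv a f) x"
proof -
  let ?H = "\<lambda>e e'. total_deriv (\<lambda>y. total_deriv f y e) x e'"
  have main: "lie_deriv a (lie_deriv b f) x = total_deriv f x (B (B x a) b) +
     (\<Sum>e\<in>Basis. \<Sum>e'\<in>Basis. (B x b \<bullet> e) * (B x a \<bullet> e') * ?H e e')" for a b
  proof -
    have "((\<lambda>x. \<Sum>e\<in>Basis. (B x b \<bullet> e) * total_deriv f x e) has_derivative
      (\<lambda>w. \<Sum>e\<in>Basis. (B x b \<bullet> e) * ?H e w + (B w b \<bullet> e) * total_deriv f x e)) (at x)"
      by (intro has_derivative_sum has_derivative_mult
          smooth_on_total_deriv_works[OF smooth_on_total_deriv[OF S] x]
          bounded_linear_imp_has_derivative bounded_linear_inner_left_comp bounded_linear_B_left)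
    note D = total_derivI[OF this]
    have H: "?H e (B x a) = (\<Sum>e'\<in>Basis. (B x a \<bullet> e') * ?H e e')" for e
      by (subst (1) euclidean_representation[of "B x a", symmetric])
         (simp add: blinfun.sum_right blinfun.scaleR_right del: euclidean_representation)
    have "total_deriv (lie_deriv b f) x w =
        (\<Sum>e\<in>Basis. (B x b \<bullet> e) * ?H e w + (B w b \<bullet> e) * total_deriv f x e)" for w
      unfolding lie_deriv_expand[abs_def] D ..
    then have "lie_deriv a (lie_deriv b f) x =
       (\<Sum>e\<in>Basis. (B x b \<bullet> e) * ?H e (B x a)) + (\<Sum>e\<in>Basis. (B (B x a) b \<bullet> e) * total_deriv f x e)"
      by (subst lie_deriv_def) (simp add: sum.distrib)
    also have "(\<Sum>e\<in>Basis. (B (B x a) b \<bullet> e) * total_deriv f x e) = total_deriv f x (B (B x a) b)"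
      by (subst (2) euclidean_representation[of "B (B x a) b", symmetric])
         (simp add: blinfun.sum_right blinfun.scaleR_right del: euclidean_representation)
    finally show ?thesis by (simp add: H sum_distrib_left mult_ac)
  qed
  have "(\<Sum>e\<in>Basis. \<Sum>e'\<in>Basis. (B x b \<bullet> e) * (B x a \<bullet> e') * ?H e e')
      = (\<Sum>e\<in>Basis. \<Sum>e'\<in>Basis. (B x a \<bullet> e) * (B x b \<bullet> e') * ?H e e')"
    by (subst sum.swap) (simp add: total_deriv_symmetric[OF S x] mult_ac)
  then show ?thesis by (simp add: main commute[of x a b])
qed

definition field :: "'a bivector \<Rightarrow> 'e \<Rightarrow> 'e bivector" where
  "field \<pi> x = push_bivector (Blinfun (B x)) \<pi>"

lemma bracket_field:
  assumes "is_bivector \<pi>"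
  shows "poisson_bracket (field \<pi>) f g x = (\<Sum>a\<in>Basis. \<Sum>b\<in>Basis.
     \<pi> (blinfun_inner_right a) (blinfun_inner_right b) * (lie_deriv a f x * lie_deriv b g x))"
  unfolding poisson_bracket_def field_def push_bivector_def
  by (subst bivector_expand[OF assms])
     (simp add: lie_deriv_def bounded_linear_Blinfun_apply[OF bounded_linear_B])

lemma smooth_field:
  assumes "open S" "is_bivector \<pi>" shows "smooth_bivector_on S (field \<pi>)"
  unfolding smooth_bivector_on_def
proof (intro conjI ballI allI)
  fix x assume "x \<in> S"
  show "is_bivector (field \<pi> x)" by (simp add: field_def is_bivector_push assms)
next
  fix \<xi> \<eta> :: "'e \<Rightarrow>\<^sub>L real"
  have *: "smooth_on S (\<lambda>x. blinfun_apply (\<xi> o\<^sub>L Blinfun (B x)) a)" for \<xi> :: "'e \<Rightarrow>\<^sub>L real" and a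
  proof -
    have "bounded_linear (\<lambda>x. \<xi> (B x a))"
      by (rule bounded_linear_compose[OF blinfun.bounded_linear_right bounded_linear_B_left])
    then show ?thesis
      by (simp add: bounded_linear_Blinfun_apply[OF bounded_linear_B] smooth_on_linear[OF assms(1)])
  qed
  show "smooth_on S (\<lambda>x. field \<pi> x \<xi> \<eta>)"
    unfolding field_def push_bivector_def
    by (rule smooth_on_bivector_apply[OF assms(1) smooth_on_const[OF assms(1)] assms(2) * *])
qed

text \<open>Written through the commuting fields, the bivector field has constant coefficients, so
  its brackets look like those of a constant bivector with \<open>lie_deriv\<close> in place of
  partial derivatives, and \<open>jacobi_sum\<close> applies.\<close>

lemma poisson_field:
  assumes S: "open S" and \<pi>: "is_bivector \<pi>" shows "poisson_on S (field \<pi>)"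
  unfolding poisson_on_def
proof (intro conjI allI impI ballI)
  show "smooth_bivector_on S (field \<pi>)" by (rule smooth_field[OF assms])
  let ?p = "\<lambda>a b. \<pi> (blinfun_inner_right a) (blinfun_inner_right b)"
  have main: "poisson_bracket (field \<pi>) f (poisson_bracket (field \<pi>) g h) x =
    (\<Sum>a\<in>Basis. \<Sum>b\<in>Basis. ?p a b * (lie_deriv a f x * (\<Sum>c\<in>Basis. \<Sum>d\<in>Basis. ?p c d *
       (lie_deriv b (lie_deriv c g) x * lie_deriv d h x + lie_deriv c g x * lie_deriv b (lie_deriv d h) x))))"
    if f: "smooth_on S f" "smooth_on S g" "smooth_on S h" "x \<in> S" for f g h x
  proof -
    have "lie_deriv b (poisson_bracket (field \<pi>) g h) x = (\<Sum>c\<in>Basis. \<Sum>d\<in>Basis. ?p c d *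
       (lie_deriv b (lie_deriv c g) x * lie_deriv d h x + lie_deriv c g x * lie_deriv b (lie_deriv d h) x))" for b
    proof -
      have "((\<lambda>x. \<Sum>a\<in>Basis. \<Sum>b\<in>Basis. ?p a b * (lie_deriv a g x * lie_deriv b h x)) has_derivative
        (\<lambda>w. \<Sum>a\<in>Basis. \<Sum>b\<in>Basis. ?p a b * (lie_deriv a g x * total_deriv (lie_deriv b h) x w
            + total_deriv (lie_deriv a g) x w * lie_deriv b h x))) (at x)"
        by (intro has_derivative_sum has_derivative_mult_right has_derivative_mult
          smooth_on_total_deriv_works[OF smooth_lie_deriv[OF S] f(4)] f)
      then show ?thesis
        unfolding lie_deriv_def[of b] bracket_field[OF \<pi>, abs_def]
        by (simp add: total_derivI add.commute)
    qed
    then show ?thesis by (simp add: bracket_field[OF \<pi>])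
  qed
  fix f g h :: "'e \<Rightarrow> real" and x assume a: "smooth_on S f" "smooth_on S g" "smooth_on S h" "x \<in> S"
  show "poisson_bracket (field \<pi>) f (poisson_bracket (field \<pi>) g h) x +
       poisson_bracket (field \<pi>) g (poisson_bracket (field \<pi>) h f) x +
       poisson_bracket (field \<pi>) h (poisson_bracket (field \<pi>) f g) x = 0"
    unfolding main[OF a] main[OF a(2,3,1,4)] main[OF a(3,1,2,4)]
    by (rule jacobi_sum) (rule bivector_antisym[OF \<pi>] lie_deriv_symmetric[OF S _ a(4)] a)+
qed

end

section \<open>Poisson brackets under pushforward\<close>

lemma poisson_bracket_pushforward:
  assumes "F differentiable (at z)" "f differentiable (at (F z))" "g differentiable (at (F z))"
    and "\<sigma> (F z) = push_bivector (total_deriv F z) (\<pi> z)"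
  shows "poisson_bracket \<sigma> f g (F z) = poisson_bracket \<pi> (\<lambda>x. f (F x)) (\<lambda>x. g (F x)) z"
  by (simp add: poisson_bracket_def assms push_bivector_def total_deriv_compose)

lemma poisson_bracket_cong:
  assumes "open S" "z \<in> S" "\<And>x. x \<in> S \<Longrightarrow> g x = g' x"
  shows "poisson_bracket \<pi> f g z = poisson_bracket \<pi> f g' z"
  using total_deriv_cong[OF assms] by (simp add: poisson_bracket_def)

text \<open>Pulling functions back along F intertwines the brackets, and since the inner bracket is
  again smooth, also the iterated ones. Each point of the target is some \<open>F z\<close>, and at
  z the Jacobi identity of \<pi> applies.\<close>

lemma poisson_on_pushforward:
  assumes S: "open S" and T: "open (F ` S)" and F: "smooth_on S F"
    and P: "poisson_on S \<pi>" and \<sigma>: "smooth_bivector_on (F ` S) \<sigma>"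
    and rel: "\<And>z. z \<in> S \<Longrightarrow> \<sigma> (F z) = push_bivector (total_deriv F z) (\<pi> z)"
  shows "poisson_on (F ` S) \<sigma>"
  unfolding poisson_on_def
proof (intro conjI allI impI ballI \<sigma>)
  fix f g h :: "'b \<Rightarrow> real" and y assume fgh: "smooth_on (F ` S) f" "smooth_on (F ` S) g" "smooth_on (F ` S) h" and "y \<in> F ` S"
  then obtain z where z: "z \<in> S" "y = F z" by blast
  have sm: "smooth_on S (\<lambda>x. f (F x))" if "smooth_on (F ` S) f" for f :: "'b \<Rightarrow> real"
    by (rule smooth_on_compose[OF S T F _ that]) auto
  have br: "poisson_bracket \<sigma> f g (F z) = poisson_bracket \<pi> (\<lambda>x. f (F x)) (\<lambda>x. g (F x)) z"
    if "smooth_on (F ` S) f" "smooth_on (F ` S) g" "z \<in> S" for f g z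
    by (rule poisson_bracket_pushforward)
       (use that F rel smooth_on_differentiable in blast)+
  have br2: "poisson_bracket \<sigma> f (poisson_bracket \<sigma> g h) (F z) =
     poisson_bracket \<pi> (\<lambda>x. f (F x)) (poisson_bracket \<pi> (\<lambda>x. g (F x)) (\<lambda>x. h (F x))) z"
    if "smooth_on (F ` S) f" "smooth_on (F ` S) g" "smooth_on (F ` S) h" for f g h
    unfolding br[OF that(1) smooth_on_poisson_bracket[OF T \<sigma> that(2,3)] z(1)]
    by (rule poisson_bracket_cong[OF S z(1)]) (rule br[OF that(2,3)])
  show "poisson_bracket \<sigma> f (poisson_bracket \<sigma> g h) y + poisson_bracket \<sigma> g (poisson_bracket \<sigma> h f) y +
      poisson_bracket \<sigma> h (poisson_bracket \<sigma> f g) y = 0"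
    using P sm[OF fgh(1)] sm[OF fgh(2)] sm[OF fgh(3)] z(1) unfolding poisson_on_def z(2)
    by (simp add: br2 fgh)
qed

section \<open>Positive bivectors and Dirac pullbacks\<close>

definition times_i :: "(complex^'d::finite) \<Rightarrow>\<^sub>L (complex^'d)" where
  "times_i = Blinfun (\<lambda>v. \<i> *s v)"

lemma times_i_apply: "blinfun_apply times_i v = \<i> *s v"
  unfolding times_i_def
  by (subst bounded_linear_Blinfun_apply)
     (auto intro!: linearI simp: linear_conv_bounded_linear[symmetric] vec_eq_iff algebra_simps)

lemma times_i_times_i: "(\<xi> o\<^sub>L times_i) o\<^sub>L times_i = - \<xi>"
  by (rule blinfun_eqI) (simp add: times_i_apply vector_smult_assoc blinfun.minus_left blinfun.minus_right vector_smult_lneg)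

text \<open>Positivity moved from the image of \<open>sharp\<close> to all covectors, where it is
  stable under pushforward. By antisymmetry of \<pi>, the second clause is the symmetry of
  \<open>\<pi> (\<xi> o\<^sub>L times_i) \<eta>\<close> in \<xi> and \<eta>.\<close>

definition positive_form :: "(complex^'d::finite) bivector \<Rightarrow> bool" where
  "positive_form \<pi> \<longleftrightarrow> is_bivector \<pi> \<and>
     (\<forall>\<xi> \<eta>. \<pi> (\<xi> o\<^sub>L times_i) \<eta> = - \<pi> \<xi> (\<eta> o\<^sub>L times_i)) \<and> (\<forall>\<xi>. \<pi> (\<xi> o\<^sub>L times_i) \<xi> \<ge> 0)"

text \<open>Well-definedness of the symplectic form: \<open>\<pi> \<xi> \<eta>\<close> is \<eta>
  evaluated at \<open>sharp \<pi> \<xi>\<close>, so it depends on \<xi> only through its sharp, and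
  by antisymmetry the same holds for \<eta>.\<close>

lemma symplectic_form_sharp:
  assumes b: "is_bivector \<pi>" shows "symplectic_form \<pi> (sharp \<pi> \<xi>) (sharp \<pi> \<eta>) = \<pi> \<xi> \<eta>"
  unfolding symplectic_form_def
proof (rule the_equality)
  fix r assume "\<exists>\<xi>' \<eta>'. sharp \<pi> \<xi>' = sharp \<pi> \<xi> \<and> sharp \<pi> \<eta>' = sharp \<pi> \<eta> \<and> r = \<pi> \<xi>' \<eta>'"
  then obtain \<xi>' \<eta>' where *: "sharp \<pi> \<xi>' = sharp \<pi> \<xi>" "sharp \<pi> \<eta>' = sharp \<pi> \<eta>" "r = \<pi> \<xi>' \<eta>'" by blast
  have "\<pi> \<xi>' \<eta>' = \<pi> \<xi> \<eta>'" using sharp_apply[OF b, of \<eta>' \<xi>'] sharp_apply[OF b, of \<eta>' \<xi>] *(1) by simp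
  also have "\<dots> = - \<pi> \<eta>' \<xi>" by (rule bivector_antisym[OF b])
  also have "\<pi> \<eta>' \<xi> = \<pi> \<eta> \<xi>" using sharp_apply[OF b, of \<xi> \<eta>'] sharp_apply[OF b, of \<xi> \<eta>] *(2) by simp
  also have "- \<pi> \<eta> \<xi> = \<pi> \<xi> \<eta>" using bivector_antisym[OF b, of \<xi> \<eta>] by simp
  finally show "r = \<pi> \<xi> \<eta>" using * by simp
qed blast

text \<open>Pairing a vector with a sharp under \<omega> is, up to sign, evaluation of a covector,
  so multiplication by the imaginary unit can be moved between covectors and vectors. Invariance of
  \<omega> under it then becomes the symmetry of the form on covectors.\<close>

lemma positive_bivector_imp_positive_form:
  assumes "positive_bivector \<pi>" shows "positive_form \<pi>"
proof -
  let ?S = "range (sharp \<pi>)" and ?\<omega> = "symplectic_form \<pi>"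
  have b: "is_bivector \<pi>" and sub: "vec.subspace ?S"
    and inv: "\<And>u v. u \<in> ?S \<Longrightarrow> v \<in> ?S \<Longrightarrow> ?\<omega> (\<i> *s u) (\<i> *s v) = ?\<omega> u v"
    and pos: "\<And>u. u \<in> ?S \<Longrightarrow> u \<noteq> 0 \<Longrightarrow> ?\<omega> u (\<i> *s u) > 0"
    using assms unfolding positive_bivector_def Let_def by auto
  have J: "\<i> *s u \<in> ?S" if "u \<in> ?S" for u using sub that by (simp add: vec.subspace_scale)
  have \<omega>r: "?\<omega> u (sharp \<pi> \<eta>) = \<eta> u" if "u \<in> ?S" for u and \<eta> :: "(complex^'a) \<Rightarrow>\<^sub>L real"
    using that by (auto simp: symplectic_form_sharp[OF b] sharp_apply[OF b])
  have \<omega>l: "?\<omega> (sharp \<pi> \<xi>) v = - \<xi> v" if "v \<in> ?S" for v and \<xi> :: "(complex^'a) \<Rightarrow>\<^sub>L real"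
    using that by (auto simp: symplectic_form_sharp[OF b] sharp_apply[OF b] bivector_antisym[OF b, of \<xi>])
  have sharp_J: "\<pi> (\<xi> o\<^sub>L times_i) \<eta> = ?\<omega> (sharp \<pi> \<xi>) (\<i> *s sharp \<pi> \<eta>)" for \<xi> \<eta>
    using sharp_apply[OF b, of "\<xi> o\<^sub>L times_i" \<eta>]
    by (simp add: \<omega>l[OF J] bivector_antisym[OF b, of _ \<eta>] times_i_apply)
  have "\<pi> (\<xi> o\<^sub>L times_i) \<eta> = - \<pi> \<xi> (\<eta> o\<^sub>L times_i)" for \<xi> \<eta>
  proof -
    have "sharp \<pi> (- \<eta>) = - sharp \<pi> \<eta>"
      by (rule sharp_eqI[OF b])
         (simp add: sharp_apply[OF b] blinfun.minus_right bilinear_lneg[OF bivector_bilinear[OF b]])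
    then have "\<i> *s (\<i> *s sharp \<pi> \<eta>) = sharp \<pi> (- \<eta>)"
      by (simp add: vector_smult_assoc)
    then have "?\<omega> (sharp \<pi> \<xi>) (\<i> *s sharp \<pi> \<eta>) = ?\<omega> (\<i> *s sharp \<pi> \<xi>) (sharp \<pi> (- \<eta>))"
      using inv[of "sharp \<pi> \<xi>" "\<i> *s sharp \<pi> \<eta>"] J by simp
    also have "\<dots> = - \<pi> \<xi> (\<eta> o\<^sub>L times_i)"
      using sharp_apply[OF b, of "\<eta> o\<^sub>L times_i" \<xi>]
      by (simp add: \<omega>r[OF J] times_i_apply blinfun.minus_left)
    finally show ?thesis by (simp add: sharp_J)
  qed
  moreover have "\<pi> (\<xi> o\<^sub>L times_i) \<xi> \<ge> 0" for \<xi>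
  proof (cases "sharp \<pi> \<xi> = 0")
    \<comment> \<open>Strict positivity of \<omega> says nothing about the kernel of
      \<open>sharp\<close>; there the value is 0.\<close>
    case True
    have "?\<omega> (sharp \<pi> \<xi>) (\<i> *s sharp \<pi> \<xi>) = - \<xi> (\<i> *s sharp \<pi> \<xi>)" by (rule \<omega>l[OF J]) simp
    then show ?thesis using True by (simp add: sharp_J)
  next
    case False
    then show ?thesis using pos[of "sharp \<pi> \<xi>"] by (simp add: sharp_J)
  qed
  ultimately show ?thesis using b by (simp add: positive_form_def)
qed

lemma positive_form_push:
  assumes "positive_form \<pi>" "times_i o\<^sub>L L = L o\<^sub>L times_i" shows "positive_form (push_bivector L \<pi>)"
  using assms by (simp add: positive_form_def push_bivector_def is_bivector_push[unfolded push_bivector_def]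
      blinfun_compose_assoc) (metis blinfun_compose_assoc)

lemma psd_form_zero:
  fixes B :: "'v::real_vector \<Rightarrow> 'v \<Rightarrow> real"
  assumes "bilinear B" "\<And>x y. B x y = B y x" "\<And>x. B x x \<ge> 0" "B x x = 0"
  shows "B x y = 0"
proof (rule ccontr)
  assume ne: "B x y \<noteq> 0"
  \<comment> \<open>As \<open>B x x = 0\<close>, the form at \<open>y + t *\<^sub>R x\<close> is
    affine in t; this t gives it the value -1.\<close>
  define t where "t = - (B y y + 1) / (2 * B x y)"
  have "0 \<le> B (y + t *\<^sub>R x) (y + t *\<^sub>R x)" by (rule assms)
  also have "\<dots> = B y y + 2 * t * B x y"
    using assms(2)[of y x] assms(4)
    by (simp add: bilinear_ladd[OF assms(1)] bilinear_radd[OF assms(1)] bilinear_lmul[OF assms(1)]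
        bilinear_rmul[OF assms(1)])
  also have "\<dots> = - 1" using ne by (simp add: t_def field_simps)
  finally show False by simp
qed

text \<open>Gram-Schmidt for a possibly degenerate form: a new spanning vector v is first made
  orthogonal to the span of F, and the component of \<eta> along the result v' is then
  removed.\<close>

lemma psd_form_projection:
  fixes B :: "'v::real_vector \<Rightarrow> 'v \<Rightarrow> real"
  assumes "bilinear B" "\<And>x y. B x y = B y x" "\<And>x. B x x \<ge> 0" "finite F"
  shows "\<exists>\<alpha>\<in>span F. \<forall>\<gamma>\<in>span F. B (\<eta> - \<alpha>) \<gamma> = 0"
  using assms(4)
proof (induction F arbitrary: \<eta> rule: finite_induct)
  case empty
  then show ?case using bilinear_rzero[OF assms(1)] by simp
next
  case (insert v F)
  have lin: "linear (B x)" for x using assms(1) by (auto simp: bilinear_def)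
  obtain \<alpha> where \<alpha>: "\<alpha> \<in> span F" "\<And>\<gamma>. \<gamma> \<in> span F \<Longrightarrow> B (\<eta> - \<alpha>) \<gamma> = 0" using insert.IH by blast
  obtain \<delta> where \<delta>: "\<delta> \<in> span F" "\<And>\<gamma>. \<gamma> \<in> span F \<Longrightarrow> B (v - \<delta>) \<gamma> = 0" using insert.IH by blast
  define v' where "v' = v - \<delta>"
  \<comment> \<open>If \<open>B v' v' = 0\<close>, division by zero gives k the value 0. This is
    harmless, since v' is then orthogonal to everything by \<open>psd_form_zero\<close>.\<close>
  define k where "k = B (\<eta> - \<alpha>) v' / B v' v'"
  have mono: "span F \<subseteq> span (insert v F)" by (rule span_mono) auto
  have v': "v' \<in> span (insert v F)"
    unfolding v'_def using \<delta>(1) mono by (intro span_diff) (auto intro: span_base)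
  have kv: "k * B v' v' = B (\<eta> - \<alpha>) v'"
  proof (cases "B v' v' = 0")
    case True
    then show ?thesis using psd_form_zero[OF assms(1-3), of v' "\<eta> - \<alpha>"] assms(2) by simp
  qed (simp add: k_def)
  have "B (\<eta> - (\<alpha> + k *\<^sub>R v')) \<gamma> = 0" if \<gamma>: "\<gamma> \<in> span (insert v F)" for \<gamma>
  proof -
    obtain r where r: "\<gamma> - r *\<^sub>R v \<in> span F" using \<gamma> span_breakdown_eq[of \<gamma> v F] by blast
    define \<phi> where "\<phi> = \<gamma> - r *\<^sub>R v + r *\<^sub>R \<delta>"
    have \<phi>: "\<phi> \<in> span F" unfolding \<phi>_def using r \<delta>(1) by (intro span_add span_scale)
    have eq: "\<gamma> = \<phi> + r *\<^sub>R v'" by (simp add: \<phi>_def v'_def algebra_simps)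
    have 1: "B (\<eta> - (\<alpha> + k *\<^sub>R v')) x = B (\<eta> - \<alpha>) x - k * B v' x" for x
      by (simp add: bilinear_lsub[OF assms(1)] bilinear_ladd[OF assms(1)] bilinear_lmul[OF assms(1)])
    show ?thesis
      unfolding eq linear_add[OF lin] linear_cmul[OF lin] 1
      using \<alpha>(2)[OF \<phi>] \<delta>(2)[OF \<phi>] kv by (simp add: v'_def)
  qed
  moreover have "\<alpha> + k *\<^sub>R v' \<in> span (insert v F)"
    using \<alpha>(1) mono v' by (intro span_add span_scale) auto
  ultimately show ?case by blast
qed

lemma covector_inner: "\<exists>a. (\<xi>::'e::euclidean_space \<Rightarrow>\<^sub>L real) = blinfun_inner_right a"
proof
  show "\<xi> = blinfun_inner_right (\<Sum>b\<in>Basis. \<xi> b *\<^sub>R b)"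
    by (subst covector_expand, rule blinfun_eqI)
       (simp add: blinfun.sum_left blinfun.scaleR_left inner_sum_left)
qed

text \<open>As W is complex, its annihilator is stable under composition with
  \<open>times_i\<close>; hence \<open>sharp \<pi> \<xi>\<close> lies in W when
  \<open>?B \<xi>\<close> vanishes on the annihilator. Subtracting an orthogonal projection gives
  every covector on W such an extension \<xi>, and the sharp of the extension is unique although the
  extension is not.\<close>

lemma positive_form_dirac_pullback:
  fixes W :: "(complex^'d::finite) set"
  assumes \<pi>: "positive_form \<pi>" and W: "subspace W" "\<And>w. w \<in> W \<Longrightarrow> \<i> *s w \<in> W"
  shows "\<exists>\<beta>. is_bivector \<beta> \<and> range (sharp \<beta>) \<subseteq> W \<and>
     dirac_pullback W (graph_bivector \<pi>) = graph_bivector_in W \<beta>"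
proof -
  let ?J = "\<lambda>\<xi>::(complex^'d) \<Rightarrow>\<^sub>L real. \<xi> o\<^sub>L times_i"
  let ?B = "\<lambda>\<xi> \<eta>. \<pi> (?J \<xi>) \<eta>"
  have b: "is_bivector \<pi>" and J: "\<And>\<xi> \<eta>. \<pi> (?J \<xi>) \<eta> = - \<pi> \<xi> (?J \<eta>)" and pos: "\<And>\<xi>. \<pi> (?J \<xi>) \<xi> \<ge> 0"
    using \<pi> by (auto simp: positive_form_def)
  note bil = bivector_bilinear[OF b]
  have Bbil: "bilinear ?B" using bil
    by (simp add: bilinear_def linear_iff bounded_bilinear.add_left[OF bounded_bilinear_blinfun_compose]
        bounded_bilinear.scaleR_left[OF bounded_bilinear_blinfun_compose])
  have Bsym: "?B \<xi> \<eta> = ?B \<eta> \<xi>" for \<xi> \<eta>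
    using J[of \<xi> \<eta>] bivector_antisym[OF b, of \<xi> "?J \<eta>"] by simp
  define Ann where "Ann = {\<xi>::(complex^'d) \<Rightarrow>\<^sub>L real. \<forall>w\<in>W. \<xi> w = 0}"
  have AnnJ: "?J \<xi> \<in> Ann" if "\<xi> \<in> Ann" for \<xi>
    using that W(2) by (auto simp: Ann_def times_i_apply)
  have sharp_add: "sharp \<pi> (\<xi> + \<eta>) = sharp \<pi> \<xi> + sharp \<pi> \<eta>"
    and sharp_scale: "sharp \<pi> (r *\<^sub>R \<xi>) = r *\<^sub>R sharp \<pi> \<xi>" for \<xi> \<eta> r
    by (auto intro!: sharp_eqI[OF b] simp: sharp_apply[OF b] blinfun.add_right blinfun.scaleR_right
        bilinear_ladd[OF bil] bilinear_lmul[OF bil])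
  \<comment> \<open>The difference \<delta> annihilates W and its sharp lies in W, so
    \<open>?B \<delta> \<delta> = 0\<close>. A null vector of a semidefinite form lies in the
    radical, and therefore \<open>sharp \<pi> \<delta> = 0\<close>.\<close>
  have unique: "sharp \<pi> \<xi> = sharp \<pi> \<eta>"
    if "sharp \<pi> \<xi> \<in> W" "sharp \<pi> \<eta> \<in> W" "\<And>w. w \<in> W \<Longrightarrow> \<xi> w = \<eta> w" for \<xi> \<eta>
  proof -
    define \<delta> where "\<delta> = \<xi> + (-1) *\<^sub>R \<eta>"
    have s\<delta>: "sharp \<pi> \<delta> = sharp \<pi> \<xi> - sharp \<pi> \<eta>"
      unfolding \<delta>_def sharp_add sharp_scale by simp
    have "sharp \<pi> \<delta> \<in> W" unfolding s\<delta> using that(1,2) W(1) by (simp add: subspace_diff)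
    moreover have "\<delta> \<in> Ann" using that(3) by (simp add: \<delta>_def Ann_def blinfun.diff_left)
    ultimately have "\<pi> \<delta> (?J \<delta>) = 0"
      using AnnJ[of \<delta>] sharp_apply[OF b, of "?J \<delta>" \<delta>] by (simp add: Ann_def del: blinfun_apply_blinfun_compose)
    then have "?B \<delta> \<delta> = 0" using J by simp
    then have "?B \<delta> \<gamma> = 0" for \<gamma> using psd_form_zero[OF Bbil Bsym pos] by simp
    then have z: "\<pi> \<delta> (?J \<gamma>) = 0" for \<gamma> using J[of \<delta> \<gamma>] by simp
    have "\<pi> \<delta> \<gamma> = 0" for \<gamma>
      using z[of "?J \<gamma>"] by (simp add: times_i_times_i bilinear_rneg[OF bil])
    then have "sharp \<pi> \<delta> = 0" by (intro sharp_eqI[OF b]) simp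
    then show ?thesis by (simp add: s\<delta>)
  qed
  have "\<exists>\<xi>. (\<forall>w\<in>W. blinfun_apply \<xi> w = blinfun_apply \<eta> w) \<and> sharp \<pi> \<xi> \<in> W" for \<eta> :: "(complex^'d) \<Rightarrow>\<^sub>L real"
  proof -
    obtain F where F: "finite F" "span F = W\<^sup>\<bottom>"
      by (rule basis_subspace_exists[OF subspace_orthogonal_comp[of W]])
    obtain e :: "complex^'d" where e: "\<eta> = blinfun_inner_right e" using covector_inner by blast
    let ?B' = "\<lambda>x y. ?B (blinfun_inner_right x) (blinfun_inner_right y)"
    have "blinfun_inner_right (x + y) = blinfun_inner_right x + blinfun_inner_right y"
      "blinfun_inner_right (r *\<^sub>R x) = r *\<^sub>R blinfun_inner_right x" for x y :: "complex^'d" and r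
      by (auto intro!: blinfun_eqI simp: inner_add_left blinfun.add_left blinfun.scaleR_left)
    then have "bilinear ?B'"
      using Bbil by (simp add: bilinear_def linear_iff)
    from psd_form_projection[OF this Bsym pos F(1)] obtain \<alpha> where
      \<alpha>: "\<alpha> \<in> W\<^sup>\<bottom>" "\<And>\<gamma>. \<gamma> \<in> W\<^sup>\<bottom> \<Longrightarrow> ?B' (e - \<alpha>) \<gamma> = 0" unfolding F(2) by blast
    define \<xi> where "\<xi> = blinfun_inner_right (e - \<alpha>)"
    have "\<xi> w = \<eta> w" if "w \<in> W" for w
    proof -
      have "w \<bullet> \<alpha> = 0" using \<alpha>(1) that by (simp add: orthogonal_comp_def orthogonal_def)
      then show ?thesis by (simp add: \<xi>_def e inner_diff_left inner_commute[of \<alpha>])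
    qed
    moreover have "sharp \<pi> \<xi> \<in> W\<^sup>\<bottom>\<^sup>\<bottom>"
      unfolding orthogonal_comp_def[of "W\<^sup>\<bottom>"]
    proof (rule CollectI, rule ballI)
      fix \<gamma> assume \<gamma>: "\<gamma> \<in> W\<^sup>\<bottom>"
      \<comment> \<open>\<open>?B\<close> at \<xi> and \<open>?J\<close> of a covector is \<pi> at
        \<xi> and that covector, so the projection property has to be used at \<open>?J\<close> of
        an annihilating covector, which again annihilates W.\<close>
      obtain c where c: "?J (blinfun_inner_right \<gamma>) = blinfun_inner_right c" using covector_inner by blast
      have "blinfun_inner_right \<gamma> \<in> Ann"
        using \<gamma> by (auto simp: Ann_def orthogonal_comp_def orthogonal_def inner_commute)
      then have "blinfun_inner_right c \<in> Ann" unfolding c[symmetric] by (rule AnnJ)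
      then have "c \<in> W\<^sup>\<bottom>" by (auto simp: Ann_def orthogonal_comp_def orthogonal_def inner_commute)
      then have "?B \<xi> (?J (blinfun_inner_right \<gamma>)) = 0" unfolding c \<xi>_def by (rule \<alpha>(2))
      then have "\<pi> \<xi> (blinfun_inner_right \<gamma>) = 0"
        by (simp add: J times_i_times_i bilinear_rneg[OF bil])
      then show "orthogonal \<gamma> (sharp \<pi> \<xi>)"
        using sharp_apply[OF b, of "blinfun_inner_right \<gamma>" \<xi>] by (simp add: orthogonal_def)
    qed
    ultimately show ?thesis using orthogonal_comp_self[OF W(1)] by auto
  qed
  then obtain X where X: "\<And>\<eta> w. w \<in> W \<Longrightarrow> blinfun_apply (X \<eta>) w = blinfun_apply \<eta> w" "\<And>\<eta>. sharp \<pi> (X \<eta>) \<in> W" by metis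
  define U where "U \<eta> = sharp \<pi> (X \<eta>)" for \<eta>
  have UI: "U \<eta> = sharp \<pi> \<xi>" if "sharp \<pi> \<xi> \<in> W" "\<And>w. w \<in> W \<Longrightarrow> blinfun_apply \<xi> w = blinfun_apply \<eta> w" for \<xi> \<eta>
    unfolding U_def using that X by (intro unique) auto
  \<comment> \<open>The extension \<open>X\<close> is an arbitrary choice and need not be linear. By
    \<open>unique\<close>, \<open>U\<close> does not depend on the choice, which makes it
    linear.\<close>
  have linU: "linear U"
  proof (rule linearI)
    show "U (\<xi> + \<eta>) = U \<xi> + U \<eta>" for \<xi> \<eta>
      unfolding U_def[of \<xi>] U_def[of \<eta>] sharp_add[symmetric]
      by (rule UI) (auto simp: sharp_add X subspace_add[OF W(1)] blinfun.add_left)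
    show "U (r *\<^sub>R \<xi>) = r *\<^sub>R U \<xi>" for \<xi> r
      unfolding U_def[of \<xi>] sharp_scale[symmetric]
      by (rule UI) (auto simp: sharp_scale X subspace_scale[OF W(1)] blinfun.scaleR_left)
  qed
  define \<beta> :: "(complex^'d) bivector" where "\<beta> = (\<lambda>\<eta> \<eta>'. blinfun_apply \<eta>' (U \<eta>))"
  have \<beta>: "is_bivector \<beta>"
  proof -
    have "\<beta> \<eta> \<eta> = 0" for \<eta>
    proof -
      \<comment> \<open>\<open>U \<eta>\<close> lies in W, where \<eta> and \<open>X \<eta>\<close>
        agree, so the value is \<open>\<pi> (X \<eta>) (X \<eta>)\<close>.\<close>
      have "blinfun_apply \<eta> (U \<eta>) = blinfun_apply (X \<eta>) (U \<eta>)" using X by (simp add: U_def)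
      then show ?thesis by (simp add: \<beta>_def U_def sharp_apply[OF b] bivector_refl[OF b])
    qed
    moreover have "bilinear \<beta>"
      by (simp add: bilinear_def linear_iff \<beta>_def linear_add[OF linU] linear_cmul[OF linU]
          blinfun.add_right blinfun.add_left blinfun.scaleR_right blinfun.scaleR_left)
    ultimately show ?thesis by (simp add: is_bivector_def)
  qed
  have sharp_\<beta>: "sharp \<beta> \<eta> = U \<eta>" for \<eta>
    by (rule sharp_eqI[OF \<beta>]) (simp add: \<beta>_def)
  have "dirac_pullback W (graph_bivector \<pi>) = graph_bivector_in W \<beta>"
  proof (intro equalityI subsetI)
    fix p assume "p \<in> dirac_pullback W (graph_bivector \<pi>)"
    then obtain \<xi> where "sharp \<pi> \<xi> \<in> W" "p = (sharp \<pi> \<xi>, restrict (blinfun_apply \<xi>) W)"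
      by (auto simp: dirac_pullback_def graph_bivector_def)
    then show "p \<in> graph_bivector_in W \<beta>"
      using UI[of \<xi> \<xi>] by (auto simp: graph_bivector_in_def sharp_\<beta> intro!: exI[of _ \<xi>])
  next
    fix p assume "p \<in> graph_bivector_in W \<beta>"
    then obtain \<eta> where "p = (U \<eta>, restrict (blinfun_apply \<eta>) W)"
      by (auto simp: graph_bivector_in_def sharp_\<beta>)
    moreover have "restrict (blinfun_apply \<eta>) W = restrict (blinfun_apply (X \<eta>)) W"
      by (rule restrict_ext) (simp add: X)
    ultimately show "p \<in> dirac_pullback W (graph_bivector \<pi>)"
      using X(2)[of \<eta>] unfolding dirac_pullback_def graph_bivector_def U_def by blast
  qed
  moreover have "range (sharp \<beta>) \<subseteq> W" using X(2) by (auto simp: sharp_\<beta> U_def)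
  ultimately show ?thesis using \<beta> by blast
qed

text \<open>Naturality under an invertible linear map. It allows the pullback to be computed at one
  point of an orbit only.\<close>

lemma dirac_pullback_transport:
  fixes M :: "'a::euclidean_space \<Rightarrow>\<^sub>L 'b::euclidean_space"
  assumes \<pi>: "is_bivector \<pi>" and \<beta>: "is_bivector \<beta>"
    and inv: "M o\<^sub>L M' = id_blinfun" "M' o\<^sub>L M = id_blinfun"
    and eq: "dirac_pullback W (graph_bivector \<pi>) = graph_bivector_in W \<beta>"
  shows "dirac_pullback (M ` W) (graph_bivector (push_bivector M \<pi>)) = graph_bivector_in (M ` W) (push_bivector M \<beta>)"
proof -
  have MM': "blinfun_apply M (blinfun_apply M' x) = x" and M'M: "blinfun_apply M' (blinfun_apply M y) = y" for x y
    using inv by (metis blinfun_apply_blinfun_compose id_blinfun.rep_eq id_apply)+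
  have comp: "(\<xi> o\<^sub>L M') o\<^sub>L M = \<xi>" for \<xi>
    by (simp add: blinfun_compose_assoc inv blinfun_compose_id)
  \<comment> \<open>The isomorphism that \<open>M\<close> induces on pairs: vectors move by
    \<open>M\<close>, covectors on W by precomposition with \<open>M'\<close>. Both sides of the
    claim are images under it.\<close>
  define \<Phi> :: "'a \<times> ('a \<Rightarrow> real) \<Rightarrow> 'b \<times> ('b \<Rightarrow> real)" where "\<Phi> = (\<lambda>(u, f). (blinfun_apply M u, restrict (\<lambda>y. f (blinfun_apply M' y)) (M ` W)))"
  have \<Phi>: "\<Phi> (u, restrict (blinfun_apply (\<xi> o\<^sub>L M)) W) = (M u, restrict (blinfun_apply \<xi>) (blinfun_apply M ` W))" for u \<xi>
    by (auto simp: \<Phi>_def MM' M'M intro!: restrict_ext)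
  have "dirac_pullback (M ` W) (graph_bivector (push_bivector M \<pi>)) = \<Phi> ` dirac_pullback W (graph_bivector \<pi>)"
  proof (intro equalityI subsetI)
    fix p assume "p \<in> dirac_pullback (M ` W) (graph_bivector (push_bivector M \<pi>))"
    then obtain \<xi> where \<xi>: "M (sharp \<pi> (\<xi> o\<^sub>L M)) \<in> M ` W"
      "p = (M (sharp \<pi> (\<xi> o\<^sub>L M)), restrict (blinfun_apply \<xi>) (blinfun_apply M ` W))"
      by (auto simp: dirac_pullback_def graph_bivector_def sharp_push[OF \<pi>])
    then have "sharp \<pi> (\<xi> o\<^sub>L M) \<in> W" using M'M by (metis imageE)
    then have "(sharp \<pi> (\<xi> o\<^sub>L M), restrict (blinfun_apply (\<xi> o\<^sub>L M)) W) \<in> dirac_pullback W (graph_bivector \<pi>)"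
      unfolding dirac_pullback_def graph_bivector_def by blast
    then show "p \<in> \<Phi> ` dirac_pullback W (graph_bivector \<pi>)"
      unfolding \<xi>(2) \<Phi>[symmetric] by (rule imageI)
  next
    fix p assume "p \<in> \<Phi> ` dirac_pullback W (graph_bivector \<pi>)"
    then obtain \<xi> where \<xi>: "sharp \<pi> \<xi> \<in> W" "p = \<Phi> (sharp \<pi> \<xi>, restrict (blinfun_apply \<xi>) W)"
      by (auto simp: dirac_pullback_def graph_bivector_def)
    have "p = (M (sharp \<pi> \<xi>), restrict (blinfun_apply (\<xi> o\<^sub>L M')) (M ` W))"
      unfolding \<xi>(2) using \<Phi>[of "sharp \<pi> \<xi>" "\<xi> o\<^sub>L M'"] by (simp only: comp)
    moreover have "M (sharp \<pi> \<xi>) = sharp (push_bivector M \<pi>) (\<xi> o\<^sub>L M')"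
      by (simp only: sharp_push[OF \<pi>] comp)
    ultimately show "p \<in> dirac_pullback (M ` W) (graph_bivector (push_bivector M \<pi>))"
      using \<xi>(1) unfolding dirac_pullback_def graph_bivector_def by blast
  qed
  also have "\<dots> = \<Phi> ` graph_bivector_in W \<beta>" by (simp only: eq)
  also have "\<dots> = graph_bivector_in (M ` W) (push_bivector M \<beta>)"
  proof (intro equalityI subsetI)
    fix p assume "p \<in> \<Phi> ` graph_bivector_in W \<beta>"
    then obtain \<xi> where \<xi>: "p = \<Phi> (sharp \<beta> \<xi>, restrict (blinfun_apply \<xi>) W)"
      by (auto simp: graph_bivector_in_def)
    have "p = (M (sharp \<beta> \<xi>), restrict (blinfun_apply (\<xi> o\<^sub>L M')) (M ` W))"
      unfolding \<xi> using \<Phi>[of "sharp \<beta> \<xi>" "\<xi> o\<^sub>L M'"] by (simp only: comp)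
    moreover have "M (sharp \<beta> \<xi>) = sharp (push_bivector M \<beta>) (\<xi> o\<^sub>L M')"
      by (simp only: sharp_push[OF \<beta>] comp)
    ultimately show "p \<in> graph_bivector_in (M ` W) (push_bivector M \<beta>)"
      unfolding graph_bivector_in_def by blast
  next
    fix p assume "p \<in> graph_bivector_in (M ` W) (push_bivector M \<beta>)"
    then obtain \<xi> where \<xi>: "p = (M (sharp \<beta> (\<xi> o\<^sub>L M)), restrict (blinfun_apply \<xi>) (blinfun_apply M ` W))"
      by (auto simp: graph_bivector_in_def sharp_push[OF \<beta>])
    show "p \<in> \<Phi> ` graph_bivector_in W \<beta>"
      unfolding \<xi> \<Phi>[symmetric] graph_bivector_in_def by blast
  qed
  finally show ?thesis .
qed

text \<open>\<open>\<beta> \<zeta> \<eta>\<close> is \<eta> evaluated at a vector of W, and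
  antisymmetry handles the other slot. So an ambient bivector whose sharp takes values in W really
  is a bivector on W.\<close>

lemma bivector_cong_on_range:
  fixes \<beta> :: "'e::euclidean_space bivector"
  assumes "is_bivector \<beta>" "range (sharp \<beta>) \<subseteq> W"
    and "\<And>w. w \<in> W \<Longrightarrow> blinfun_apply \<xi> w = blinfun_apply \<xi>' w"
      "\<And>w. w \<in> W \<Longrightarrow> blinfun_apply \<eta> w = blinfun_apply \<eta>' w"
  shows "\<beta> \<xi> \<eta> = \<beta> \<xi>' \<eta>'"
proof -
  have *: "\<beta> \<zeta> \<eta> = \<beta> \<zeta> \<eta>'" if "\<And>w. w \<in> W \<Longrightarrow> blinfun_apply \<eta> w = blinfun_apply \<eta>' w" for \<zeta> \<eta> \<eta>'
    using that assms(2) sharp_apply[OF assms(1), of _ \<zeta>, symmetric] by (simp add: image_subset_iff)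
  show ?thesis using *[OF assms(4)] *[OF assms(3)] bivector_antisym[OF assms(1)] by metis
qed

text \<open>The order of quantifiers is the point: one b serves all M. In the application n is the
  Lie algebra of the group, L the infinitesimal action at a base point, and M the multiplication by
  a group element, so that \<open>M o\<^sub>L L\<close> is the infinitesimal action at another point
  of the orbit.\<close>

lemma uniform_dirac_pullback:
  fixes n :: "(complex^'d::finite) set" and L :: "(complex^'d) \<Rightarrow>\<^sub>L (complex^'d)"
  assumes \<pi>: "positive_form \<pi>" and L: "times_i o\<^sub>L L = L o\<^sub>L times_i"
    and n: "subspace n" "\<And>w. w \<in> n \<Longrightarrow> \<i> *s w \<in> n" and inj: "inj_on L n"
  shows "\<exists>b. is_bivector b \<and> (\<forall>M M' :: (complex^'d) \<Rightarrow>\<^sub>L (complex^'d). M o\<^sub>L M' = id_blinfun \<longrightarrow> M' o\<^sub>L M = id_blinfun \<longrightarrow>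
     range (sharp (push_bivector (M o\<^sub>L L) b)) \<subseteq> (M o\<^sub>L L) ` n \<and>
     dirac_pullback ((M o\<^sub>L L) ` n) (graph_bivector (push_bivector (M o\<^sub>L L) \<pi>)) =
       graph_bivector_in ((M o\<^sub>L L) ` n) (push_bivector (M o\<^sub>L L) b))"
proof -
  let ?W = "L ` n"
  have linL: "linear (blinfun_apply L)" by (simp add: blinfun.bounded_linear_right bounded_linear.linear)
  have W: "subspace ?W" using n(1) linL by (simp add: linear_subspace_image)
  have WJ: "\<i> *s w \<in> ?W" if w: "w \<in> ?W" for w
  proof -
    obtain v where v: "v \<in> n" "w = L v" using w by blast
    have "\<i> *s w = (times_i o\<^sub>L L) v" by (simp add: v times_i_apply)
    also have "\<dots> = L (\<i> *s v)" unfolding L by (simp add: times_i_apply)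
    finally show ?thesis using n(2)[OF v(1)] by simp
  qed
  obtain \<beta> where \<beta>: "is_bivector \<beta>" "range (sharp \<beta>) \<subseteq> ?W"
     "dirac_pullback ?W (graph_bivector (push_bivector L \<pi>)) = graph_bivector_in ?W \<beta>"
    using positive_form_dirac_pullback[OF positive_form_push[OF \<pi> L] W WJ] by blast
  \<comment> \<open>The bivector \<beta> lives on the image of n and is pulled back to n by a left
    inverse of L there. \<open>L\<close> after \<open>R\<close> is the identity only on that image,
    which is all that \<beta> sees.\<close>
  obtain R where R: "linear R" "\<And>v. v \<in> n \<Longrightarrow> R (L v) = v"
    using linear_exists_left_inverse_on[OF linL n(1)] inj by blast
  then have Rb: "bounded_linear R" by (simp add: linear_conv_bounded_linear)
  define R' where "R' = Blinfun R"
  have R'[simp]: "blinfun_apply R' = R" using Rb by (simp add: R'_def bounded_linear_Blinfun_apply)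
  define b where "b = push_bivector R' \<beta>"
  have b: "is_bivector b" by (simp add: b_def is_bivector_push \<beta>)
  have pb: "push_bivector (M o\<^sub>L L) b = push_bivector M \<beta>" for M :: "(complex^'d) \<Rightarrow>\<^sub>L (complex^'d)"
    unfolding b_def push_bivector_compose
    unfolding push_bivector_def
    by (intro ext bivector_cong_on_range[OF \<beta>(1,2)]) (auto simp: R)
  have \<pi>b: "is_bivector (push_bivector L \<pi>)" using \<pi> by (simp add: is_bivector_push positive_form_def)
  have "range (sharp (push_bivector (M o\<^sub>L L) b)) \<subseteq> (M o\<^sub>L L) ` n \<and>
     dirac_pullback ((M o\<^sub>L L) ` n) (graph_bivector (push_bivector (M o\<^sub>L L) \<pi>)) =
       graph_bivector_in ((M o\<^sub>L L) ` n) (push_bivector (M o\<^sub>L L) b)"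
    if M: "M o\<^sub>L M' = id_blinfun" "M' o\<^sub>L M = id_blinfun" for M M' :: "(complex^'d) \<Rightarrow>\<^sub>L (complex^'d)"
  proof -
    have im: "(M o\<^sub>L L) ` n = M ` ?W" by (auto simp: image_image)
    have "range (sharp (push_bivector M \<beta>)) \<subseteq> M ` ?W"
      using \<beta>(2) by (auto simp: sharp_push[OF \<beta>(1)] image_subset_iff)
    moreover have "dirac_pullback (M ` ?W) (graph_bivector (push_bivector (M o\<^sub>L L) \<pi>)) =
        graph_bivector_in (M ` ?W) (push_bivector M \<beta>)"
      using dirac_pullback_transport[OF \<pi>b \<beta>(1) M \<beta>(3)] by (simp only: push_bivector_compose)
    ultimately show ?thesis unfolding im pb ..
  qed
  with b show ?thesis by blast
qed

section \<open>Holomorphic maps and monomial maps\<close>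

lemma holomorphic_map_onI:
  assumes "smooth_on W f"
    and "\<And>z. z \<in> W \<Longrightarrow> \<exists>f'. (f has_derivative f') (at z) \<and> (\<forall>v. f' (\<i> *s v) = \<i> * f' v)"
  shows "holomorphic_map_on W f"
  unfolding holomorphic_map_on_def using assms total_derivI by metis

lemma holomorphic_map_on_smooth: "holomorphic_map_on W f \<Longrightarrow> smooth_on W f"
  by (simp add: holomorphic_map_on_def)

lemma holomorphic_map_on_deriv:
  assumes "holomorphic_map_on W f" "z \<in> W"
  shows "(f has_derivative total_deriv f z) (at z)" "total_deriv f z (\<i> *s v) = \<i> * total_deriv f z v"
  using assms by (auto simp: holomorphic_map_on_def intro: smooth_on_total_deriv_works)

lemma holomorphic_map_on_cong:
  assumes "open W" "\<And>z. z \<in> W \<Longrightarrow> f z = g z"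
  shows "holomorphic_map_on W f \<longleftrightarrow> holomorphic_map_on W g"
proof -
  have "total_deriv f z = total_deriv g z" if "z \<in> W" for z
    using total_deriv_cong[OF assms(1) that] assms(2) by blast
  then show ?thesis
    using smooth_on_cong[of W f g] assms by (auto simp: holomorphic_map_on_def)
qed

lemma holomorphic_map_on_const: "open W \<Longrightarrow> holomorphic_map_on W (\<lambda>z. c)"
  by (rule holomorphic_map_onI) (auto intro!: smooth_on_const exI[of _ "\<lambda>v. 0"])

lemma holomorphic_map_on_component: "open W \<Longrightarrow> holomorphic_map_on W (\<lambda>z. z $ k)"
  by (rule holomorphic_map_onI)
     (auto intro!: smooth_on_linear bounded_linear_vec_nth exI[of _ "\<lambda>v. v $ k"]
        bounded_linear_imp_has_derivative)

lemma holomorphic_map_on_mult: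
  assumes "open W" "holomorphic_map_on W f" "holomorphic_map_on W g"
  shows "holomorphic_map_on W (\<lambda>z. f z * g z)"
proof (rule holomorphic_map_onI)
  show "smooth_on W (\<lambda>z. f z * g z)"
    using assms by (intro smooth_on_mult holomorphic_map_on_smooth)
  fix z assume z: "z \<in> W"
  note D = holomorphic_map_on_deriv[OF assms(2) z] holomorphic_map_on_deriv[OF assms(3) z]
  show "\<exists>f'. ((\<lambda>z. f z * g z) has_derivative f') (at z) \<and> (\<forall>v. f' (\<i> *s v) = \<i> * f' v)"
  proof (intro exI conjI)
    show "((\<lambda>z. f z * g z) has_derivative (\<lambda>v. f z * total_deriv g z v + total_deriv f z v * g z)) (at z)"
      by (rule has_derivative_mult[OF D(1,3)])
  qed (simp add: D algebra_simps)
qed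

lemma holomorphic_map_on_prod:
  "open W \<Longrightarrow> (\<And>i. i \<in> A \<Longrightarrow> holomorphic_map_on W (f i)) \<Longrightarrow> holomorphic_map_on W (\<lambda>z. \<Prod>i\<in>A. f i z)"
  by (induction A rule: infinite_finite_induct)
     (auto intro!: holomorphic_map_on_const holomorphic_map_on_mult)

lemma holomorphic_map_on_power_int:
  assumes "open W" "holomorphic_map_on W f" "\<And>z. z \<in> W \<Longrightarrow> f z \<noteq> 0"
  shows "holomorphic_map_on W (\<lambda>z. f z powi n)"
proof (rule holomorphic_map_onI)
  show "smooth_on W (\<lambda>z. f z powi n)"
    using assms by (intro smooth_on_power_int holomorphic_map_on_smooth)
  fix z assume z: "z \<in> W"
  show "\<exists>f'. ((\<lambda>z. f z powi n) has_derivative f') (at z) \<and> (\<forall>v. f' (\<i> *s v) = \<i> * f' v)"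
  proof (intro exI conjI)
    show "((\<lambda>z. f z powi n) has_derivative (\<lambda>v. total_deriv f z v * (of_int n * f z powi (n - 1)))) (at z)"
      by (rule has_derivative_power_int[OF assms(3)[OF z] holomorphic_map_on_deriv(1)[OF assms(2) z]])
  qed (simp add: holomorphic_map_on_deriv(2)[OF assms(2) z])
qed

lemma holomorphic_map_on_compose:
  fixes f :: "complex^'m::finite \<Rightarrow> complex^'n::finite"
  assumes "open W" "open T" "\<And>k. holomorphic_map_on W (\<lambda>z. f z $ k)" "f ` W \<subseteq> T" "holomorphic_map_on T g"
  shows "holomorphic_map_on W (\<lambda>z. g (f z))"
proof (rule holomorphic_map_onI)
  have f: "smooth_on W f"
    using assms(3) holomorphic_map_on_smooth by (intro smooth_on_vec[OF assms(1)]) blast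
  show "smooth_on W (\<lambda>z. g (f z))"
    by (rule smooth_on_compose[OF assms(1,2) f assms(4) holomorphic_map_on_smooth[OF assms(5)]])
  fix z assume z: "z \<in> W"
  then have fz: "f z \<in> T" using assms(4) by auto
  note Df = smooth_on_total_deriv_works[OF f z]
  have "total_deriv f z (\<i> *s v) = \<i> *s total_deriv f z v" for v
  proof -
    have "blinfun_apply (total_deriv (\<lambda>z. f z $ k) z) = (\<lambda>v. total_deriv f z v $ k)" for k
      by (rule total_derivI) (rule bounded_linear.has_derivative[OF bounded_linear_vec_nth Df])
    then show ?thesis
      using holomorphic_map_on_deriv(2)[OF assms(3) z] by (simp add: vec_eq_iff)
  qed
  then show "\<exists>f'. ((\<lambda>z. g (f z)) has_derivative f') (at z) \<and> (\<forall>v. f' (\<i> *s v) = \<i> * f' v)"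
    using has_derivative_compose[OF Df holomorphic_map_on_deriv(1)[OF assms(5) fz]]
      holomorphic_map_on_deriv(2)[OF assms(5) fz]
    by (intro exI[of _ "\<lambda>v. total_deriv g (f z) (total_deriv f z v)"]) simp
qed

section \<open>Monomial automorphisms of the vertex domains\<close>

definition chart_domain :: "'d set \<Rightarrow> (complex^'d::finite) set" where
  "chart_domain I = {z. \<forall>j. j \<notin> I \<longrightarrow> z $ j \<noteq> 0}"

text \<open>The coordinates outside \<open>I\<close> are carried along unchanged. This makes the
  monomials at a vertex part of an automorphism of \<open>chart_domain I\<close>, whose inverse is
  the same map with negated exponents.\<close>

definition monomial_map ::
    "('d \<Rightarrow> 'd \<Rightarrow> int) \<Rightarrow> 'd set \<Rightarrow> complex^'d::finite \<Rightarrow> complex^'d" where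
  "monomial_map m I z = (\<chi> i. if i \<in> I then z $ i * (\<Prod>j\<in>-I. z $ j powi m i j) else z $ i)"

lemma open_chart_domain: "open (chart_domain I)"
proof -
  have "chart_domain I = (\<Inter>j\<in>-I. {z. z $ j \<noteq> 0})" by (auto simp: chart_domain_def)
  moreover have "open {z::complex^'a. z $ j \<noteq> 0}" for j
    by (intro open_Collect_neq continuous_intros)
  ultimately show ?thesis by (auto intro!: open_INT)
qed

lemma monomial_map_mult: "monomial_map m I (g * z) = monomial_map m I g * monomial_map m I z"
  by (simp add: monomial_map_def vec_eq_iff power_int_mult_distrib prod.distrib)

lemma monomial_map_in_chart_domain:
  "z \<in> chart_domain I \<Longrightarrow> monomial_map m I z \<in> chart_domain I"
  by (simp add: chart_domain_def monomial_map_def)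

lemma monomial_map_inverse:
  assumes "z \<in> chart_domain I"
  shows "monomial_map (\<lambda>i j. - m i j) I (monomial_map m I z) = z"
proof -
  have "(\<Prod>j\<in>-I. z $ j powi m i j) * (\<Prod>j\<in>-I. z $ j powi (- m i j)) = 1" for i
    unfolding prod.distrib[symmetric]
    using assms by (intro prod.neutral) (auto simp: chart_domain_def power_int_minus)
  then show ?thesis by (simp add: monomial_map_def vec_eq_iff mult.assoc)
qed

lemma monomial_map_inverse':
  "z \<in> chart_domain I \<Longrightarrow> monomial_map m I (monomial_map (\<lambda>i j. - m i j) I z) = z"
  using monomial_map_inverse[of z I "\<lambda>i j. - m i j"] by simp

lemma chart_domain_nonzero: "z \<in> chart_domain I \<Longrightarrow> j \<notin> I \<Longrightarrow> z $ j \<noteq> 0"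
  by (simp add: chart_domain_def)

lemma holomorphic_monomial_map:
  "holomorphic_map_on (chart_domain I) (\<lambda>z. monomial_map m I z $ i)"
  unfolding monomial_map_def
  by (cases "i \<in> I") (auto intro!: holomorphic_map_on_mult holomorphic_map_on_prod
      holomorphic_map_on_power_int holomorphic_map_on_component open_chart_domain
      dest: chart_domain_nonzero)

lemma smooth_monomial_map: "smooth_on (chart_domain I) (monomial_map m I)"
  by (rule smooth_on_vec[OF open_chart_domain])
     (rule holomorphic_map_on_smooth[OF holomorphic_monomial_map])

lemma has_vector_derivative_power_int:
  fixes f :: "real \<Rightarrow> complex"
  assumes "(f has_vector_derivative f') (at t)" "f t \<noteq> 0"
  shows "((\<lambda>s. f s powi n) has_vector_derivative (f t powi n * (of_int n * f' / f t))) (at t)"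
proof -
  have *: "f t powi (n - 1) = f t powi n / f t" using assms(2) by (simp add: power_int_diff)
  show ?thesis
    using has_derivative_power_int[OF assms(2) assms(1)[unfolded has_vector_derivative_def], of n]
    unfolding has_vector_derivative_def
    by (rule has_derivative_eq_rhs) (auto simp: * fun_eq_iff scaleR_conv_of_real)
qed

lemma has_vector_derivative_prod_power_int:
  fixes f :: "'i \<Rightarrow> real \<Rightarrow> complex"
  assumes "\<And>j. j \<in> A \<Longrightarrow> (f j has_vector_derivative f' j) (at t)" "\<And>j. j \<in> A \<Longrightarrow> f j t \<noteq> 0"
  shows "((\<lambda>s. \<Prod>j\<in>A. f j s powi n j) has_vector_derivative
     ((\<Prod>j\<in>A. f j t powi n j) * (\<Sum>j\<in>A. of_int (n j) * f' j / f j t))) (at t)"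
  using assms
proof (induction A rule: infinite_finite_induct)
  case (insert k A)
  have "((\<lambda>s. f k s powi n k * (\<Prod>j\<in>A. f j s powi n j)) has_vector_derivative
     (f k t powi n k * ((\<Prod>j\<in>A. f j t powi n j) * (\<Sum>j\<in>A. of_int (n j) * f' j / f j t))
      + (f k t powi n k * (of_int (n k) * f' k / f k t)) * (\<Prod>j\<in>A. f j t powi n j))) (at t)"
    using insert by (intro has_vector_derivative_mult has_vector_derivative_power_int) auto
  then show ?case using insert by (simp add: algebra_simps)
qed auto

text \<open>Logarithmic differentiation of a monomial that is constant along \<gamma>. Its factor
  with index i may vanish, so \<open>\<gamma> 0 $ i\<close> is kept as a factor and only the
  coordinates outside \<open>I\<close> are divided by.\<close>

lemma monomial_curve_velocity:
  fixes \<gamma> :: "real \<Rightarrow> complex^'d::finite"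
  assumes \<gamma>: "(\<gamma> has_vector_derivative v) (at 0)" "\<gamma> 0 \<in> chart_domain I" and i: "i \<in> I"
    and const: "\<epsilon> > 0" "\<And>t. \<bar>t\<bar> < \<epsilon> \<Longrightarrow> monomial_map m I (\<gamma> t) $ i = c"
  shows "v $ i + \<gamma> 0 $ i * (\<Sum>j\<in>-I. of_int (m i j) * v $ j / \<gamma> 0 $ j) = 0"
proof -
  let ?P = "\<Prod>j\<in>-I. \<gamma> 0 $ j powi m i j"
  have comp: "((\<lambda>t. \<gamma> t $ j) has_vector_derivative v $ j) (at 0)" for j
    by (rule bounded_linear.has_vector_derivative[OF bounded_linear_vec_nth \<gamma>(1)])
  have ne: "\<gamma> 0 $ j \<noteq> 0" if "j \<in> -I" for j using \<gamma>(2) that by (auto simp: chart_domain_def)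
  have "((\<lambda>t. \<gamma> t $ i * (\<Prod>j\<in>-I. \<gamma> t $ j powi m i j)) has_vector_derivative
      (\<gamma> 0 $ i * (?P * (\<Sum>j\<in>-I. of_int (m i j) * v $ j / \<gamma> 0 $ j)) + v $ i * ?P)) (at 0)"
    by (rule has_vector_derivative_mult[OF comp has_vector_derivative_prod_power_int[OF comp ne]])
  moreover have "((\<lambda>t. \<gamma> t $ i * (\<Prod>j\<in>-I. \<gamma> t $ j powi m i j)) has_vector_derivative 0) (at 0)"
    by (rule has_vector_derivative_transform_within_open[where f = "\<lambda>t. c" and S = "{-\<epsilon><..<\<epsilon>}"])
       (use const i in \<open>auto simp: monomial_map_def\<close>)
  ultimately have "\<gamma> 0 $ i * (?P * (\<Sum>j\<in>-I. of_int (m i j) * v $ j / \<gamma> 0 $ j)) + v $ i * ?P = 0"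
    using vector_derivative_unique_at by blast
  then have "?P * (v $ i + \<gamma> 0 $ i * (\<Sum>j\<in>-I. of_int (m i j) * v $ j / \<gamma> 0 $ j)) = 0"
    by (simp add: algebra_simps)
  moreover have "?P \<noteq> 0" using ne by simp
  ultimately show ?thesis by (blast dest: mult_eq_0_iff[THEN iffD1])
qed

section \<open>Quotients covered by monomial charts\<close>

lemma openin_quotient_topology:
  "openin (quotient_topology X f) W \<longleftrightarrow> W \<subseteq> f ` topspace X \<and> openin X {x \<in> topspace X. f x \<in> W}"
proof -
  have "istopology (\<lambda>W. W \<subseteq> f ` topspace X \<and> openin X {x \<in> topspace X. f x \<in> W})"
    unfolding istopology_def
  proof (intro conjI allI impI)
    fix S T assume "S \<subseteq> f ` topspace X \<and> openin X {x \<in> topspace X. f x \<in> S}"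
      "T \<subseteq> f ` topspace X \<and> openin X {x \<in> topspace X. f x \<in> T}"
    moreover have "{x \<in> topspace X. f x \<in> S \<inter> T} = {x \<in> topspace X. f x \<in> S} \<inter> {x \<in> topspace X. f x \<in> T}"
      by auto
    ultimately show "S \<inter> T \<subseteq> f ` topspace X" "openin X {x \<in> topspace X. f x \<in> S \<inter> T}"
      by (auto simp only: openin_Int)
  next
    fix K assume K: "\<forall>S\<in>K. S \<subseteq> f ` topspace X \<and> openin X {x \<in> topspace X. f x \<in> S}"
    have "{x \<in> topspace X. f x \<in> \<Union>K} = (\<Union>S\<in>K. {x \<in> topspace X. f x \<in> S})" by auto
    then show "openin X {x \<in> topspace X. f x \<in> \<Union>K}" using K by auto
    show "\<Union>K \<subseteq> f ` topspace X" using K by auto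
  qed
  then show ?thesis unfolding quotient_topology_def by (simp add: topology_inverse')
qed

lemma topspace_quotient_topology: "topspace (quotient_topology X f) = f ` topspace X"
proof
  show "topspace (quotient_topology X f) \<subseteq> f ` topspace X"
    using openin_quotient_topology[of X f "topspace (quotient_topology X f)"] by simp
  have "{x \<in> topspace X. f x \<in> f ` topspace X} = topspace X" by auto
  then have "openin (quotient_topology X f) (f ` topspace X)"
    by (simp add: openin_quotient_topology)
  then show "f ` topspace X \<subseteq> topspace (quotient_topology X f)" by (rule openin_subset)
qed

lemma second_countable_euclidean: "second_countable (euclidean :: 'a::second_countable_topology topology)"
proof -
  obtain B :: "'a set set" where B: "countable B" "topological_basis B"
    using ex_countable_basis by blast
  then show ?thesis unfolding second_countable_def
    by (metis open_openin topological_basisE topological_basis_open)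
qed

lemma bounded_bilinear_vec_mult: "bounded_bilinear ((*) :: complex^'d::finite \<Rightarrow> complex^'d \<Rightarrow> complex^'d)"
  unfolding bilinear_conv_bounded_bilinear[symmetric] bilinear_def
  by (auto intro!: linearI simp: vec_eq_iff algebra_simps)

lemma bounded_linear_vec_mult: "bounded_linear ((*) (g :: complex^'d::finite))"
  by (rule bounded_bilinear.bounded_linear_right[OF bounded_bilinear_vec_mult])

text \<open>What the quotient needs from the polytope: at each vertex, monomial equations for the
  group, and a function vanishing exactly off the vertex domain. In \<open>sep_scale\<close> the
  factor \<kappa> is common to all vertices, so inequalities between multiples of two of these
  functions are invariant under N. The type \<open>'n\<close> only fixes the dimension of the
  charts.\<close>

locale toric_quotient =
  fixes T :: "'n::finite itself"
    and N :: "(complex^'d::finite) set"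
    and V :: "'d set set"
    and m :: "'d set \<Rightarrow> 'd \<Rightarrow> 'd \<Rightarrow> int"
    and sep :: "'d set \<Rightarrow> complex^'d \<Rightarrow> real"
  assumes N_iff: "I \<in> V \<Longrightarrow> g \<in> N \<longleftrightarrow> (\<forall>j. g $ j \<noteq> 0) \<and> (\<forall>i\<in>I. monomial_map (m I) I g $ i = 1)"
    and card_V: "I \<in> V \<Longrightarrow> card I = CARD('n)"
    and sep_continuous: "I \<in> V \<Longrightarrow> continuous_on UNIV (sep I)"
    and sep_nonneg: "I \<in> V \<Longrightarrow> sep I z \<ge> 0"
    and sep_eq_0: "I \<in> V \<Longrightarrow> sep I z = 0 \<longleftrightarrow> z \<notin> chart_domain I"
    and sep_scale: "g \<in> N \<Longrightarrow> \<exists>\<kappa>>0. \<forall>I\<in>V. \<forall>z. sep I (g * z) = \<kappa> * sep I z"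
begin

definition \<Sigma> :: "(complex^'d) set" where "\<Sigma> = (\<Union>I\<in>V. chart_domain I)"

definition p :: "complex^'d \<Rightarrow> (complex^'d) set" where "p z = (\<lambda>g. g * z) ` N"

definition M :: "(complex^'d) set topology" where "M = quotient_topology (top_of_set \<Sigma>) p"

lemma open_\<Sigma>: "open \<Sigma>"
  unfolding \<Sigma>_def by (intro open_UN ballI open_chart_domain)

lemma chart_domain_subset_\<Sigma>: "I \<in> V \<Longrightarrow> chart_domain I \<subseteq> \<Sigma>"
  by (auto simp: \<Sigma>_def)

lemma one_in_N: "I \<in> V \<Longrightarrow> 1 \<in> N"
  by (simp add: N_iff[of I] monomial_map_def)

lemma mult_in_N: "I \<in> V \<Longrightarrow> g \<in> N \<Longrightarrow> h \<in> N \<Longrightarrow> g * h \<in> N"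
  by (simp add: N_iff[of I] monomial_map_mult)

definition vec_inverse :: "complex^'d \<Rightarrow> complex^'d" where
  "vec_inverse g = (\<chi> i. inverse (g $ i))"

lemma vec_inverse: "(\<And>j. g $ j \<noteq> 0) \<Longrightarrow> vec_inverse g * g = 1"
  by (simp add: vec_inverse_def vec_eq_iff)

lemma N_nonzero: "I \<in> V \<Longrightarrow> g \<in> N \<Longrightarrow> g $ j \<noteq> 0"
  by (simp add: N_iff[of I])

lemma vec_inverse_in_N:
  assumes I: "I \<in> V" and g: "g \<in> N" shows "vec_inverse g \<in> N"
proof -
  have *: "monomial_map (m I) I (vec_inverse g * g) $ i = monomial_map (m I) I 1 $ i" for i
    using vec_inverse[of g] N_nonzero[OF I g] by simp
  have "monomial_map (m I) I 1 $ i = 1" if "i \<in> I" for i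
    using one_in_N[OF I] that by (simp add: N_iff[OF I])
  then have "monomial_map (m I) I (vec_inverse g) $ i = 1" if "i \<in> I" for i
    using *[of i] g that by (simp add: N_iff[OF I] monomial_map_mult)
  then show ?thesis using N_nonzero[OF I g] by (simp add: N_iff[OF I]) (simp add: vec_inverse_def)
qed

lemma mult_in_chart_domain_iff:
  "I \<in> V \<Longrightarrow> g \<in> N \<Longrightarrow> g * z \<in> chart_domain J \<longleftrightarrow> z \<in> chart_domain J"
  by (simp add: chart_domain_def N_iff[of I])

lemma \<Sigma>E: "z \<in> \<Sigma> \<Longrightarrow> (\<And>I. I \<in> V \<Longrightarrow> z \<in> chart_domain I \<Longrightarrow> thesis) \<Longrightarrow> thesis"
  by (auto simp: \<Sigma>_def)

lemma mult_in_\<Sigma>_iff: "I \<in> V \<Longrightarrow> g \<in> N \<Longrightarrow> g * z \<in> \<Sigma> \<longleftrightarrow> z \<in> \<Sigma>"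
  using mult_in_chart_domain_iff by (auto simp: \<Sigma>_def)

lemma p_mult:
  assumes I: "I \<in> V" and g: "g \<in> N" shows "p (g * z) = p z"
proof -
  have *: "(\<lambda>h. h * (g * z)) ` N \<subseteq> (\<lambda>h. h * z) ` N" if "g \<in> N" for z g
    using mult_in_N[OF I _ that] by (auto simp: mult.assoc[symmetric])
  show ?thesis unfolding p_def
  proof (rule equalityI)
    show "(\<lambda>h. h * (g * z)) ` N \<subseteq> (\<lambda>h. h * z) ` N" by (rule *[OF g])
    have "vec_inverse g * (g * z) = z"
      using vec_inverse[of g] N_nonzero[OF I g] by (simp add: mult.assoc[symmetric])
    then show "(\<lambda>h. h * z) ` N \<subseteq> (\<lambda>h. h * (g * z)) ` N"
      using *[OF vec_inverse_in_N[OF I g], of "g * z"] by simp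
  qed
qed

lemma p_eq_iff:
  assumes z: "z \<in> \<Sigma>" shows "p y = p z \<longleftrightarrow> (\<exists>g\<in>N. y = g * z)"
proof
  obtain I where I: "I \<in> V" using z by (elim \<Sigma>E)
  assume "p y = p z"
  moreover have "y \<in> p y" unfolding p_def using one_in_N[OF I] by (intro image_eqI[of _ _ 1]) auto
  ultimately show "\<exists>g\<in>N. y = g * z" by (auto simp: p_def)
next
  obtain I where I: "I \<in> V" using z by (elim \<Sigma>E)
  assume "\<exists>g\<in>N. y = g * z" then show "p y = p z" using p_mult[OF I] by auto
qed

text \<open>The monomials at a vertex separate the orbits inside its domain.\<close>

lemma p_eq_iff_monomials:
  assumes I: "I \<in> V" and z: "z \<in> chart_domain I"
  shows "p y = p z \<longleftrightarrow> y \<in> chart_domain I \<and> (\<forall>i\<in>I. monomial_map (m I) I y $ i = monomial_map (m I) I z $ i)"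
proof -
  have z\<Sigma>: "z \<in> \<Sigma>" using chart_domain_subset_\<Sigma>[OF I] z by blast
  have "(\<exists>g\<in>N. y = g * z) \<longleftrightarrow>
      y \<in> chart_domain I \<and> (\<forall>i\<in>I. monomial_map (m I) I y $ i = monomial_map (m I) I z $ i)" (is "_ \<longleftrightarrow> ?R")
  proof
    assume "\<exists>g\<in>N. y = g * z"
    then show ?R using z by (auto simp: mult_in_chart_domain_iff[OF I] monomial_map_mult N_iff[OF I])
  next
    assume R: ?R
    \<comment> \<open>Coordinates in \<open>I\<close> may vanish, so y cannot be divided by z there.
      The group element is instead prescribed by its monomials: 1 inside \<open>I\<close>, and the
      quotients outside. Then \<open>g * z\<close> and y have the same monomials and the same
      coordinates outside \<open>I\<close>.\<close>
    let ?h = "(\<chi> i. if i \<in> I then 1 else y $ i / z $ i) :: complex^'d"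
    define g where "g = monomial_map (\<lambda>i j. - m I i j) I ?h"
    have ne: "y $ j \<noteq> 0" "z $ j \<noteq> 0" if "j \<notin> I" for j using R z that by (auto simp: chart_domain_def)
    have h: "?h \<in> chart_domain I" using ne by (auto simp: chart_domain_def)
    have mg: "monomial_map (m I) I g = ?h" unfolding g_def by (rule monomial_map_inverse'[OF h])
    have "g $ j \<noteq> 0" for j
      unfolding g_def monomial_map_def using ne by (auto simp: power_int_0_left_if)
    then have gN: "g \<in> N" by (simp add: N_iff[OF I] mg)
    have "monomial_map (m I) I (g * z) $ i = monomial_map (m I) I y $ i" for i
      using R z by (cases "i \<in> I") (auto simp: monomial_map_mult mg, auto simp: monomial_map_def chart_domain_def)
    then have eq: "monomial_map (m I) I (g * z) = monomial_map (m I) I y" by (simp add: vec_eq_iff)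
    have "g * z \<in> chart_domain I" using mult_in_chart_domain_iff[OF I gN] z by simp
    then have "g * z = monomial_map (\<lambda>i j. - m I i j) I (monomial_map (m I) I y)"
      unfolding eq[symmetric] by (rule monomial_map_inverse[symmetric])
    also have "\<dots> = y" using R by (intro monomial_map_inverse) simp
    finally have "y = g * z" by simp
    with gN show "\<exists>g\<in>N. y = g * z" by blast
  qed
  then show ?thesis by (simp add: p_eq_iff[OF z\<Sigma>])
qed

lemma topspace_M: "topspace M = p ` \<Sigma>"
  by (simp add: M_def topspace_quotient_topology)

lemma openin_M: "openin M W \<longleftrightarrow> W \<subseteq> p ` \<Sigma> \<and> open {z \<in> \<Sigma>. p z \<in> W}"
  by (auto simp: M_def openin_quotient_topology openin_open_eq[OF open_\<Sigma>])

lemma continuous_map_p: "continuous_map (top_of_set \<Sigma>) M p"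
  unfolding continuous_map_def by (auto simp: topspace_M openin_M openin_open_eq[OF open_\<Sigma>])

text \<open>The saturation of an open set under a group is a union of open sets, one for each group
  element.\<close>

lemma openin_p_image:
  assumes "open U" "U \<subseteq> \<Sigma>" shows "openin M (p ` U)"
proof -
  have "{z \<in> \<Sigma>. p z \<in> p ` U} = \<Sigma> \<inter> (\<Union>g\<in>N. (\<lambda>z. g * z) -` U)"
  proof (intro equalityI subsetI)
    fix z assume "z \<in> {z \<in> \<Sigma>. p z \<in> p ` U}"
    then obtain y where "z \<in> \<Sigma>" "y \<in> U" "p y = p z" by auto
    moreover from this obtain g where "g \<in> N" "y = g * z" using p_eq_iff[of z y] by auto
    ultimately show "z \<in> \<Sigma> \<inter> (\<Union>g\<in>N. (\<lambda>z. g * z) -` U)" by auto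
  next
    fix z assume "z \<in> \<Sigma> \<inter> (\<Union>g\<in>N. (\<lambda>z. g * z) -` U)"
    then obtain g where "z \<in> \<Sigma>" "g \<in> N" "g * z \<in> U" by auto
    then show "z \<in> {z \<in> \<Sigma>. p z \<in> p ` U}" using p_eq_iff[of z "g * z"] by blast
  qed
  moreover have "open \<dots>"
  proof (intro open_Int open_\<Sigma> open_UN ballI)
    fix g :: "complex^'d"
    show "open ((\<lambda>z. g * z) -` U)"
      by (rule open_vimage[OF assms(1) linear_continuous_on[OF bounded_linear_vec_mult]])
  qed
  ultimately show ?thesis using assms(2) by (simp only: openin_M image_mono simp_thms)
qed

lemma second_countable_M: "second_countable M"
proof (rule second_countable_open_map_image[OF continuous_map_p])
  show "open_map (top_of_set \<Sigma>) M p"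
    unfolding open_map_def using openin_p_image by (auto simp: openin_open_eq[OF open_\<Sigma>])
  show "p ` topspace (top_of_set \<Sigma>) = topspace M" by (simp add: topspace_M)
  show "second_countable (top_of_set \<Sigma>)"
    by (rule second_countable_subtopology[OF second_countable_euclidean])
qed

section \<open>Vertex charts and their holomorphic sections\<close>

definition index :: "'d set \<Rightarrow> 'n \<Rightarrow> 'd" where
  "index I = (SOME e. bij_betw e UNIV I)"

lemma index: "I \<in> V \<Longrightarrow> bij_betw (index I) UNIV I"
  unfolding index_def by (rule someI_ex[where P = "\<lambda>e. bij_betw e UNIV I"], rule finite_same_card_bij) (auto simp: card_V)

definition coords :: "'d set \<Rightarrow> complex^'d \<Rightarrow> complex^'n" where
  "coords I z = (\<chi> k. monomial_map (m I) I z $ index I k)"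

text \<open>A point of the quotient is an orbit, and an arbitrary representative is taken; monomials
  are constant on orbits, so \<open>chart_p\<close> gives the value at any point of the
  orbit.\<close>

definition chart :: "'d set \<Rightarrow> (complex^'d) set \<Rightarrow> complex^'n" where
  "chart I Y = coords I (SOME z. z \<in> Y)"

text \<open>A section of \<open>coords I\<close>. The coordinates outside \<open>I\<close> are free
  and copied from x, so the section passes through x.\<close>

definition lift :: "'d set \<Rightarrow> complex^'d \<Rightarrow> complex^'n \<Rightarrow> complex^'d" where
  "lift I x w = monomial_map (\<lambda>i j. - m I i j) I (\<chi> i. if i \<in> I then w $ inv_into UNIV (index I) i else x $ i)"

lemma coords_eq_iff:
  assumes I: "I \<in> V" and "z \<in> chart_domain I" "y \<in> chart_domain I"
  shows "coords I y = coords I z \<longleftrightarrow> p y = p z"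
proof -
  have "(\<forall>k. P (index I k)) \<longleftrightarrow> (\<forall>i\<in>I. P i)" for P
    using index[OF I] by (metis UNIV_I bij_betwE bij_betw_imp_surj_on imageE)
  then show ?thesis using assms by (simp add: p_eq_iff_monomials coords_def vec_eq_iff)
qed

lemma chart_p:
  assumes I: "I \<in> V" and z: "z \<in> chart_domain I" shows "chart I (p z) = coords I z"
proof -
  have "z \<in> p z" unfolding p_def using one_in_N[OF I] by (intro image_eqI[of _ _ 1]) auto
  then have "(SOME y. y \<in> p z) \<in> p z" by (rule someI)
  then obtain g where g: "g \<in> N" "(SOME y. y \<in> p z) = g * z" by (auto simp: p_def)
  have "p (g * z) = p z" by (rule p_mult[OF I g(1)])
  then show ?thesis
    unfolding chart_def g(2)
    by (subst coords_eq_iff[OF I z]) (auto simp: mult_in_chart_domain_iff[OF I g(1)] z)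
qed

lemma lift:
  assumes I: "I \<in> V" and x: "x \<in> chart_domain I"
  shows "lift I x w \<in> chart_domain I" "coords I (lift I x w) = w" "lift I x (coords I x) = x"
proof -
  let ?y = "\<lambda>w. (\<chi> i. if i \<in> I then w $ inv_into UNIV (index I) i else x $ i) :: complex^'d"
  have y: "?y w \<in> chart_domain I" for w using x by (simp add: chart_domain_def)
  show "lift I x w \<in> chart_domain I" unfolding lift_def by (rule monomial_map_in_chart_domain[OF y])
  have inj: "inj (index I)" using index[OF I] by (simp add: bij_betw_def)
  have mem: "index I k \<in> I" for k using index[OF I] by (auto simp: bij_betw_def)
  show "coords I (lift I x w) = w"
    unfolding coords_def lift_def monomial_map_inverse'[OF y]
    by (simp add: vec_eq_iff mem inj)
  have "?y (coords I x) = monomial_map (m I) I x"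
  proof -
    have "index I (inv_into UNIV (index I) i) = i" if "i \<in> I" for i
      using index[OF I] that by (intro f_inv_into_f) (simp add: bij_betw_def)
    then show ?thesis by (auto simp: vec_eq_iff coords_def) (simp add: monomial_map_def)
  qed
  then show "lift I x (coords I x) = x"
    unfolding lift_def by (simp add: monomial_map_inverse[OF x])
qed

lemma holomorphic_coords: "holomorphic_map_on (chart_domain I) (\<lambda>z. coords I z $ k)"
  unfolding coords_def by (simp add: holomorphic_monomial_map)

lemma smooth_coords: "smooth_on (chart_domain I) (coords I)"
  by (rule smooth_on_vec[OF open_chart_domain])
     (rule holomorphic_map_on_smooth[OF holomorphic_coords])

lemma holomorphic_lift:
  assumes x: "x \<in> chart_domain I" shows "holomorphic_map_on UNIV (\<lambda>w. lift I x w $ i)"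
  unfolding lift_def
proof (rule holomorphic_map_on_compose[OF open_UNIV open_chart_domain _ _ holomorphic_monomial_map])
  show "range (\<lambda>w. \<chi> i. if i \<in> I then w $ inv_into UNIV (index I) i else x $ i) \<subseteq> chart_domain I"
    using x by (auto simp: chart_domain_def)
  show "holomorphic_map_on UNIV (\<lambda>w. (\<chi> i. if i \<in> I then w $ inv_into UNIV (index I) i else x $ i) $ k)" for k
    by (cases "k \<in> I") (auto intro: holomorphic_map_on_component holomorphic_map_on_const)
qed

lemma smooth_lift: "x \<in> chart_domain I \<Longrightarrow> smooth_on UNIV (lift I x)"
  by (rule smooth_on_vec[OF open_UNIV]) (rule holomorphic_map_on_smooth[OF holomorphic_lift])

lemma p_in_chart_image_iff:
  "I \<in> V \<Longrightarrow> p z \<in> p ` chart_domain I \<longleftrightarrow> z \<in> chart_domain I"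
  using p_eq_iff_monomials by auto

lemma preimage_chart_image: "I \<in> V \<Longrightarrow> {z \<in> \<Sigma>. p z \<in> p ` chart_domain I \<and> P z} = {z \<in> chart_domain I. P z}"
  using p_in_chart_image_iff chart_domain_subset_\<Sigma> by blast

lemma openin_chart_image: "I \<in> V \<Longrightarrow> openin M (p ` chart_domain I)"
  by (intro openin_p_image open_chart_domain chart_domain_subset_\<Sigma>)

definition atlas :: "((complex^'d) set, complex^'n) chart set" where
  "atlas = quotient_atlas \<Sigma> p"

lemma chart_image_UNIV:
  assumes I: "I \<in> V" shows "chart I ` p ` chart_domain I = UNIV"
proof -
  have x: "1 \<in> chart_domain I" by (simp add: chart_domain_def)
  have "w \<in> chart I ` p ` chart_domain I" for w
    using lift(1,2)[OF I x, of w] chart_p[OF I lift(1)[OF I x, of w]] by (metis image_eqI)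
  then show ?thesis by auto
qed

text \<open>\<open>coords I\<close> is continuous and has the continuous section
  \<open>lift I 1\<close>, so a set is open exactly if its preimage is. Openness in the quotient is
  openness of that same preimage.\<close>

lemma chart_homeomorphism:
  assumes I: "I \<in> V"
  shows "homeomorphic_map (subtopology M (p ` chart_domain I)) (top_of_set UNIV) (chart I)"
  unfolding homeomorphic_map_def
proof
  have tsp: "topspace (subtopology M (p ` chart_domain I)) = p ` chart_domain I"
    using openin_subset[OF openin_chart_image[OF I]] by auto
  show "inj_on (chart I) (topspace (subtopology M (p ` chart_domain I)))"
    unfolding tsp by (intro inj_onI) (auto simp: chart_p[OF I] coords_eq_iff[OF I])
  show "quotient_map (subtopology M (p ` chart_domain I)) (top_of_set UNIV) (chart I)"
    unfolding quotient_map_def tsp chart_image_UNIV[OF I]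
  proof (intro conjI allI impI)
    fix U :: "(complex^'n) set"
    have "openin (subtopology M (p ` chart_domain I)) {Y \<in> p ` chart_domain I. chart I Y \<in> U} \<longleftrightarrow>
        openin M {Y \<in> p ` chart_domain I. chart I Y \<in> U}"
      by (subst openin_open_subtopology[OF openin_chart_image[OF I]]) auto
    also have "\<dots> \<longleftrightarrow> open {z \<in> chart_domain I. coords I z \<in> U}"
    proof -
      have "{z \<in> \<Sigma>. p z \<in> {Y \<in> p ` chart_domain I. chart I Y \<in> U}} = {z \<in> chart_domain I. coords I z \<in> U}"
        using p_in_chart_image_iff[OF I] chart_domain_subset_\<Sigma>[OF I] chart_p[OF I] by auto
      moreover have "{Y \<in> p ` chart_domain I. chart I Y \<in> U} \<subseteq> p ` \<Sigma>"
        using chart_domain_subset_\<Sigma>[OF I] by auto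
      ultimately show ?thesis by (simp add: openin_M)
    qed
    also have "\<dots> \<longleftrightarrow> open U"
    proof
      assume "open {z \<in> chart_domain I. coords I z \<in> U}"
      moreover have x: "1 \<in> chart_domain I" by (simp add: chart_domain_def)
      ultimately have "open (lift I 1 -` {z \<in> chart_domain I. coords I z \<in> U})"
        using smooth_on_continuous_on[OF smooth_lift[OF x]] by (intro open_vimage)
      then show "open U" using lift[OF I x] by (simp add: vimage_def)
    next
      assume "open U"
      then show "open {z \<in> chart_domain I. coords I z \<in> U}"
        using continuous_open_preimage[OF smooth_on_continuous_on[OF smooth_coords] open_chart_domain]
        by (simp add: vimage_def Int_def conj_commute)
    qed
    finally show "openin (subtopology M (p ` chart_domain I)) {x. x \<in> p ` chart_domain I \<and> chart I x \<in> U} =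
       openin (top_of_set UNIV) U" by simp
  qed simp
qed

text \<open>The section also settles the sheaf condition: if \<open>h\<close> composed with
  \<open>coords I\<close> is holomorphic, composing further with \<open>lift I 1\<close> returns
  \<open>h\<close>.\<close>

lemma chart_in_atlas:
  assumes I: "I \<in> V" shows "(p ` chart_domain I, chart I) \<in> atlas"
  unfolding atlas_def quotient_atlas_def M_def[symmetric] mem_Collect_eq prod.case chart_image_UNIV[OF I]
proof (intro conjI allI impI)
  show "openin M (p ` chart_domain I)" by (rule openin_chart_image[OF I])
  show "homeomorphic_map (subtopology M (p ` chart_domain I)) (top_of_set UNIV) (chart I)"
    by (rule chart_homeomorphism[OF I])
  fix W :: "(complex^'n) set" and h assume W: "open W \<and> W \<subseteq> UNIV"
  have eq: "{z \<in> \<Sigma>. p z \<in> p ` chart_domain I \<and> chart I (p z) \<in> W} = {z \<in> chart_domain I. coords I z \<in> W}"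
    using chart_p[OF I] by (auto simp: preimage_chart_image[OF I])
  let ?U = "{z \<in> chart_domain I. coords I z \<in> W}"
  have U: "open ?U"
    using continuous_open_preimage[OF smooth_on_continuous_on[OF smooth_coords] open_chart_domain, of W] W
    by (simp add: vimage_def Int_def conj_commute)
  have cong: "holomorphic_map_on ?U (h \<circ> chart I \<circ> p) \<longleftrightarrow> holomorphic_map_on ?U (\<lambda>z. h (coords I z))"
    by (rule holomorphic_map_on_cong[OF U]) (auto simp: chart_p[OF I])
  have x: "1 \<in> chart_domain I" by (simp add: chart_domain_def)
  have sub: "holomorphic_map_on S f \<Longrightarrow> S' \<subseteq> S \<Longrightarrow> holomorphic_map_on S' f"
    for S S' :: "(complex^'a::finite) set" and f
    unfolding holomorphic_map_on_def using smooth_on_subset by blast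
  show "holomorphic_map_on W h = holomorphic_map_on
     {z \<in> \<Sigma>. p z \<in> p ` chart_domain I \<and> chart I (p z) \<in> W} (h \<circ> chart I \<circ> p)"
    unfolding eq cong
  proof
    assume h: "holomorphic_map_on W h"
    show "holomorphic_map_on ?U (\<lambda>z. h (coords I z))"
    proof (rule holomorphic_map_on_compose[OF U _ _ _ h])
      show "holomorphic_map_on ?U (\<lambda>z. coords I z $ k)" for k
        by (rule sub[OF holomorphic_coords]) auto
    qed (use W in auto)
  next
    assume "holomorphic_map_on ?U (\<lambda>z. h (coords I z))"
    moreover have "holomorphic_map_on W (\<lambda>w. lift I 1 w $ k)" for k
      by (rule sub[OF holomorphic_lift[OF x]]) simp
    moreover have "lift I 1 ` W \<subseteq> ?U" using lift(1,2)[OF I x] by auto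
    ultimately have "holomorphic_map_on W (\<lambda>w. h (coords I (lift I 1 w)))"
      using W U by (intro holomorphic_map_on_compose[where f = "lift I 1" and T = ?U and g = "\<lambda>z. h (coords I z)"]) simp_all
    then show "holomorphic_map_on W h" by (simp add: lift(2)[OF I x])
  qed
qed auto

text \<open>A member of \<open>atlas\<close> may be any chart that satisfies the sheaf condition,
  not just a vertex chart. Arguments about a general chart start from these properties.\<close>

lemma atlasD:
  assumes "(W, \<psi>) \<in> atlas"
  shows "openin M W" "open (\<psi> ` W)" "homeomorphic_map (subtopology M W) (top_of_set (\<psi> ` W)) \<psi>"
    "inj_on \<psi> W" "W \<subseteq> p ` \<Sigma>" "open {z \<in> \<Sigma>. p z \<in> W}"
    "\<And>U h. open U \<Longrightarrow> U \<subseteq> \<psi> ` W \<Longrightarrow> holomorphic_map_on U h \<longleftrightarrow>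
         holomorphic_map_on {z \<in> \<Sigma>. p z \<in> W \<and> \<psi> (p z) \<in> U} (\<lambda>z. h (\<psi> (p z)))"
proof -
  show W: "openin M W" and o: "open (\<psi> ` W)" and hm: "homeomorphic_map (subtopology M W) (top_of_set (\<psi> ` W)) \<psi>"
    and "\<And>U h. open U \<Longrightarrow> U \<subseteq> \<psi> ` W \<Longrightarrow> holomorphic_map_on U h \<longleftrightarrow>
         holomorphic_map_on {z \<in> \<Sigma>. p z \<in> W \<and> \<psi> (p z) \<in> U} (\<lambda>z. h (\<psi> (p z)))"
    using assms unfolding atlas_def quotient_atlas_def M_def[symmetric] by (auto simp: o_def)
  have "topspace (subtopology M W) = W" using openin_subset[OF W] by auto
  then show "inj_on \<psi> W" using hm by (simp add: homeomorphic_map_def)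
  show "W \<subseteq> p ` \<Sigma>" "open {z \<in> \<Sigma>. p z \<in> W}" using W by (auto simp: openin_M)
qed

lemma open_atlas_image:
  assumes "(W, \<psi>) \<in> atlas" "openin M U" "U \<subseteq> W" shows "open (\<psi> ` U)"
proof -
  note A = atlasD[OF assms(1)]
  have "openin (subtopology M W) U" using assms(2,3) by (simp add: openin_open_subtopology[OF A(1)])
  then have "openin (top_of_set (\<psi> ` W)) (\<psi> ` U)"
    using homeomorphic_imp_open_map[OF A(3)] by (simp add: open_map_def)
  then show ?thesis using A(2) by (simp add: openin_open_eq)
qed

lemma holomorphic_chart_comp:
  assumes "(W, \<psi>) \<in> atlas" shows "holomorphic_map_on {z \<in> \<Sigma>. p z \<in> W} (\<lambda>z. \<psi> (p z) $ k)"
proof -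
  have "{z \<in> \<Sigma>. p z \<in> W \<and> \<psi> (p z) \<in> \<psi> ` W} = {z \<in> \<Sigma>. p z \<in> W}" by auto
  then show ?thesis
    using atlasD(7)[OF assms atlasD(2)[OF assms] subset_refl, of "\<lambda>w. w $ k"]
      holomorphic_map_on_component[OF atlasD(2)[OF assms], of k] by simp
qed

lemma smooth_chart_comp:
  assumes "(W, \<psi>) \<in> atlas" shows "smooth_on {z \<in> \<Sigma>. p z \<in> W} (\<lambda>z. \<psi> (p z))"
  by (rule smooth_on_vec[OF atlasD(6)[OF assms]])
     (rule holomorphic_map_on_smooth[OF holomorphic_chart_comp[OF assms]])

lemma chart_comp_image: "(W, \<psi>) \<in> atlas \<Longrightarrow> (\<lambda>z. \<psi> (p z)) ` {z \<in> \<Sigma>. p z \<in> W} = \<psi> ` W"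
  using atlasD(5) by blast

text \<open>The sheaf condition of the second chart makes its components, composed with
  \<open>p\<close>, holomorphic upstairs; the sheaf condition of the first chart brings them down as
  functions of its own coordinates.\<close>

lemma smooth_transition:
  assumes a: "(W, \<psi>) \<in> atlas" and b: "(W', \<psi>') \<in> atlas"
  shows "smooth_on (\<psi> ` (W \<inter> W')) (\<psi>' \<circ> inv_into W \<psi>)"
proof -
  have oM: "openin M (W \<inter> W')" using atlasD(1)[OF a] atlasD(1)[OF b] by blast
  have o: "open (\<psi> ` (W \<inter> W'))" by (rule open_atlas_image[OF a oM]) simp
  have o': "open (\<psi>' ` (W \<inter> W'))" by (rule open_atlas_image[OF b oM]) simp
  let ?O = "{z \<in> \<Sigma>. p z \<in> W \<inter> W'}"
  have O: "open ?O" using oM by (simp add: openin_M)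
  have e1: "{z \<in> \<Sigma>. p z \<in> W \<and> \<psi> (p z) \<in> \<psi> ` (W \<inter> W')} = ?O"
    using atlasD(4)[OF a] by (auto simp: inj_on_def)
  have e2: "{z \<in> \<Sigma>. p z \<in> W' \<and> \<psi>' (p z) \<in> \<psi>' ` (W \<inter> W')} = ?O"
    using atlasD(4)[OF b] by (auto simp: inj_on_def)
  have "holomorphic_map_on (\<psi> ` (W \<inter> W')) (\<lambda>w. (\<psi>' \<circ> inv_into W \<psi>) w $ k)" for k
  proof -
    have "holomorphic_map_on ?O (\<lambda>z. \<psi>' (p z) $ k)"
      using atlasD(7)[OF b o', of "\<lambda>w. w $ k"] holomorphic_map_on_component[OF o', of k] by (auto simp: e2)
    then have "holomorphic_map_on ?O (\<lambda>z. (\<psi>' \<circ> inv_into W \<psi>) (\<psi> (p z)) $ k)"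
      using atlasD(4)[OF a] by (subst holomorphic_map_on_cong[OF O, where g = "\<lambda>z. \<psi>' (p z) $ k"]) auto
    then show ?thesis
      using atlasD(7)[OF a o, of "\<lambda>w. (\<psi>' \<circ> inv_into W \<psi>) w $ k"] by (auto simp: e1)
  qed
  then show ?thesis by (intro smooth_on_vec[OF o] holomorphic_map_on_smooth)
qed

text \<open>A general chart inherits sections from a vertex chart: change to the vertex coordinates,
  then lift through the given point x.\<close>

lemma local_section:
  assumes b: "(W, \<psi>) \<in> atlas" and x: "x \<in> \<Sigma>" "p x \<in> W"
  obtains U s where "open U" "\<psi> (p x) \<in> U" "U \<subseteq> \<psi> ` W" "smooth_on U s"
    "\<And>w. w \<in> U \<Longrightarrow> s w \<in> \<Sigma> \<and> p (s w) \<in> W \<and> \<psi> (p (s w)) = w" "s (\<psi> (p x)) = x"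
proof -
  obtain I where I: "I \<in> V" "x \<in> chart_domain I" using x(1) by (elim \<Sigma>E)
  define U where "U = \<psi> ` (W \<inter> p ` chart_domain I)"
  define t where "t = chart I \<circ> inv_into W \<psi>"
  define s where "s = (\<lambda>w. lift I x (t w))"
  have U: "open U" unfolding U_def
    by (rule open_atlas_image[OF b]) (use atlasD(1)[OF b] openin_chart_image[OF I(1)] in auto)
  have t: "smooth_on U t" unfolding t_def U_def by (rule smooth_transition[OF b chart_in_atlas[OF I(1)]])
  show ?thesis
  proof
    show "open U" by fact
    show "\<psi> (p x) \<in> U" using x I by (auto simp: U_def)
    show "U \<subseteq> \<psi> ` W" by (auto simp: U_def)
    show "smooth_on U s" unfolding s_def
      by (rule smooth_on_compose[OF U open_UNIV t _ smooth_lift[OF I(2)]]) auto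
    show "s (\<psi> (p x)) = x"
      using atlasD(4)[OF b] x I lift(3)[OF I] chart_p[OF I] by (simp add: s_def t_def)
    fix w assume "w \<in> U"
    then obtain y where y: "y \<in> chart_domain I" "p y \<in> W" "w = \<psi> (p y)" by (auto simp: U_def)
    then have tw: "t w = coords I y" using atlasD(4)[OF b] chart_p[OF I(1) y(1)] by (simp add: t_def)
    have "p (s w) = p y"
      using coords_eq_iff[OF I(1) y(1) lift(1)[OF I, of "t w"]] lift(2)[OF I] by (simp add: s_def tw)
    moreover have "s w \<in> \<Sigma>" using lift(1)[OF I] chart_domain_subset_\<Sigma>[OF I(1)] by (auto simp: s_def)
    ultimately show "s w \<in> \<Sigma> \<and> p (s w) \<in> W \<and> \<psi> (p (s w)) = w" using y by simp
  qed
qed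

text \<open>Points in a common vertex domain are separated by \<open>coords\<close>. Otherwise x has
  a vertex set \<open>I\<close> whose domain misses y; with \<open>J\<close> a vertex set for y, the
  sets where \<open>sep J\<close> is less, respectively greater, than C times \<open>sep I\<close>
  are open, disjoint and invariant, because N scales both functions by the same factor.\<close>

lemma Hausdorff_M: "Hausdorff_space M"
  unfolding Hausdorff_space_def topspace_M
proof (intro allI impI, elim conjE imageE)
  fix X Y x y assume xy: "X \<noteq> Y" "X = p x" "x \<in> \<Sigma>" "Y = p y" "y \<in> \<Sigma>"
  obtain I where I: "I \<in> V" "x \<in> chart_domain I" using xy(3) by (elim \<Sigma>E)
  obtain J where J: "J \<in> V" "y \<in> chart_domain J" using xy(5) by (elim \<Sigma>E)
  show "\<exists>U W. openin M U \<and> openin M W \<and> X \<in> U \<and> Y \<in> W \<and> disjnt U W"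
  proof (cases "y \<in> chart_domain I")
    case True
    then have "coords I x \<noteq> coords I y" using xy coords_eq_iff[OF I(1) True I(2)] by simp
    then obtain A B where AB: "open A" "open B" "coords I x \<in> A" "coords I y \<in> B" "A \<inter> B = {}"
      using hausdorff by metis
    let ?P = "\<lambda>A. {z \<in> chart_domain I. coords I z \<in> A}"
    have o: "open (?P A)" if "open A" for A
      using continuous_open_preimage[OF smooth_on_continuous_on[OF smooth_coords] open_chart_domain, of A] that
      by (simp add: vimage_def Int_def conj_commute)
    have sub: "?P A \<subseteq> \<Sigma>" for A using chart_domain_subset_\<Sigma>[OF I(1)] by auto
    have "disjnt (p ` ?P A) (p ` ?P B)"
      using AB(5) coords_eq_iff[OF I(1)] by (auto simp: disjnt_iff) (metis IntI empty_iff)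
    then show ?thesis using o[OF AB(1)] o[OF AB(2)] AB xy I True
      by (intro exI[of _ "p ` ?P A"] exI[of _ "p ` ?P B"]) (auto intro!: openin_p_image sub)
  next
    case False
    \<comment> \<open>Gives \<open>C * sep I x = sep J x + 1\<close>, so x satisfies the first
      inequality. At y the second one holds for every C, as
      \<open>sep I y = 0 < sep J y\<close>.\<close>
    define C where "C = (sep J x + 1) / sep I x"
    have Ix: "sep I x > 0" using sep_nonneg[OF I(1), of x] sep_eq_0[OF I(1), of x] I(2) by fastforce
    have C: "C > 0" "C * sep I x > sep J x" using Ix sep_nonneg[OF J(1), of x] by (auto simp: C_def)
    have Jy: "sep J y > 0" using sep_nonneg[OF J(1), of y] sep_eq_0[OF J(1), of y] J(2) by fastforce
    have Iy: "sep I y = 0" using sep_eq_0[OF I(1)] False by simp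
    let ?A = "{z \<in> \<Sigma>. sep J z < C * sep I z}" and ?B = "{z \<in> \<Sigma>. C * sep I z < sep J z}"
    have "open {z. sep J z < C * sep I z}" "open {z. C * sep I z < sep J z}"
      by (intro open_Collect_less continuous_intros sep_continuous I J)+
    then have o: "open ?A" "open ?B" using open_\<Sigma> by (auto simp: Collect_conj_eq)
    have inv: "(g * z \<in> ?A \<longleftrightarrow> z \<in> ?A) \<and> (g * z \<in> ?B \<longleftrightarrow> z \<in> ?B)" if g: "g \<in> N" for g z
    proof -
      obtain \<kappa> where \<kappa>: "\<kappa> > 0" "\<And>I z. I \<in> V \<Longrightarrow> sep I (g * z) = \<kappa> * sep I z" using sep_scale[OF g] by blast
      have "\<kappa> * a < C * (\<kappa> * b) \<longleftrightarrow> a < C * b" "C * (\<kappa> * b) < \<kappa> * a \<longleftrightarrow> C * b < a" for a b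
        using \<kappa>(1) by (metis mult.left_commute mult_less_cancel_left_pos)+
      then show ?thesis using mult_in_\<Sigma>_iff[OF I(1) g] by (simp add: \<kappa>(2) I J)
    qed
    have "disjnt (p ` ?A) (p ` ?B)"
      unfolding disjnt_iff
    proof (intro allI notI, elim conjE)
      fix Y assume "Y \<in> p ` ?A" "Y \<in> p ` ?B"
      then obtain a b where ab: "a \<in> ?A" "b \<in> ?B" "p a = p b" by auto
      then obtain g where "g \<in> N" "a = g * b" using p_eq_iff[of b a] by auto
      then show False using inv[of g b] ab by auto
    qed
    moreover have "x \<in> ?A" using xy C by auto
    then have "X \<in> p ` ?A" unfolding xy(2) by (rule imageI)
    moreover have "y \<in> ?B" using xy Iy Jy by auto
    then have "Y \<in> p ` ?B" unfolding xy(4) by (rule imageI)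
    moreover have "openin M (p ` ?A)" "openin M (p ` ?B)" using o by (auto intro!: openin_p_image)
    ultimately show ?thesis by (intro exI[of _ "p ` ?A"] exI[of _ "p ` ?B"]) (intro conjI)
  qed
qed

lemma smooth_manifold_M: "smooth_manifold M atlas"
  unfolding smooth_manifold_def smooth_atlas_def
proof (intro conjI Hausdorff_M second_countable_M)
  show "\<forall>(U, \<phi>)\<in>atlas. openin M U \<and> open (\<phi> ` U) \<and> homeomorphic_map (subtopology M U) (top_of_set (\<phi> ` U)) \<phi>"
  proof clarify
    fix U \<phi> assume "(U, \<phi>) \<in> atlas"
    from atlasD(1-3)[OF this]
    show "openin M U \<and> open (\<phi> ` U) \<and> homeomorphic_map (subtopology M U) (top_of_set (\<phi> ` U)) \<phi>"
      by simp
  qed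
  show "(\<Union>(U, \<phi>)\<in>atlas. U) = topspace M"
  proof
    show "(\<Union>(U, \<phi>)\<in>atlas. U) \<subseteq> topspace M" using atlasD(5) by (auto simp: topspace_M)
    show "topspace M \<subseteq> (\<Union>(U, \<phi>)\<in>atlas. U)"
    proof
      fix X assume "X \<in> topspace M"
      then obtain I where "I \<in> V" "X \<in> p ` chart_domain I" by (auto simp: topspace_M \<Sigma>_def)
      then show "X \<in> (\<Union>(U, \<phi>)\<in>atlas. U)" by (intro UN_I[OF chart_in_atlas]) auto
    qed
  qed
  show "\<forall>(U, \<phi>)\<in>atlas. \<forall>(W, \<psi>)\<in>atlas. smooth_on (\<phi> ` (U \<inter> W)) (\<psi> \<circ> inv_into U \<phi>)"
    by (clarify, rule smooth_transition)
qed

end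

section \<open>The Poisson structures on the total space, the quotient and the fibres\<close>

lemma has_vector_derivative_vecI:
  fixes f :: "real \<Rightarrow> complex^'d::finite"
  assumes "\<And>i. ((\<lambda>t. f t $ i) has_vector_derivative v $ i) (at t)"
  shows "(f has_vector_derivative v) (at t)"
  unfolding has_vector_derivative_def
proof (subst has_derivative_componentwise_within, intro ballI)
  fix b :: "complex^'d" assume "b \<in> Basis"
  then obtain k c where b: "b = axis k c" by (auto simp: Basis_vec_def)
  show "((\<lambda>x. f x \<bullet> b) has_derivative (\<lambda>x. (x *\<^sub>R v) \<bullet> b)) (at t)"
    using has_derivative_inner_left[OF assms[of k, unfolded has_vector_derivative_def], of c]
    by (simp add: b inner_axis)
qed

lemma exp_action_scaleR: "exp_action (t *\<^sub>R w) x = (\<chi> i. exp (of_real t * w $ i) * x $ i)"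
  by (simp add: exp_action_def scaleR_conv_of_real[where 'a = complex])

text \<open>The closed form of the infinitesimal action of \<open>exp_action\<close>; the sign is
  that of the convention in \<open>infinitesimal_action\<close>.\<close>

definition exp_field :: "complex^'d::finite \<Rightarrow> complex^'d \<Rightarrow> complex^'d" where
  "exp_field x a = - (a * x)"

lemma has_vector_derivative_exp_action:
  "((\<lambda>t::real. exp_action (t *\<^sub>R w) x) has_vector_derivative (w * x)) (at 0)"
proof (rule has_vector_derivative_vecI)
  fix i
  have "((\<lambda>t::real. exp (t *\<^sub>R w $ i) * x $ i) has_vector_derivative (w $ i * exp (0 *\<^sub>R w $ i)) * x $ i) (at 0)"
    by (intro has_vector_derivative_mult_left exp_scaleR_has_vector_derivative_left)
  then show "((\<lambda>t. exp_action (t *\<^sub>R w) x $ i) has_vector_derivative (w * x) $ i) (at 0)"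
    by (simp add: exp_action_def)
qed

lemma infinitesimal_exp_action: "infinitesimal_action exp_action a x = exp_field x a"
  using vector_derivative_at[OF has_vector_derivative_exp_action[of "- a" x]]
  by (simp add: infinitesimal_action_def exp_field_def)

interpretation exp_field: commuting_action "exp_field :: complex^'d::finite \<Rightarrow> complex^'d \<Rightarrow> complex^'d"
proof (rule commuting_action.intro)
  show "bounded_bilinear (exp_field :: complex^'d \<Rightarrow> complex^'d \<Rightarrow> complex^'d)"
    unfolding bilinear_conv_bounded_bilinear[symmetric] bilinear_def
    by (auto intro!: linearI simp: exp_field_def vec_eq_iff algebra_simps)
qed (simp add: exp_field_def vec_eq_iff)

lemma action_bivector_exp: "action_bivector exp_action \<pi> = exp_field.field \<pi>"
  by (simp add: fun_eq_iff action_bivector_def exp_field.field_def infinitesimal_exp_action)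

lemma exp_field_apply: "blinfun_apply (Blinfun (exp_field x)) a = - (a * x)"
  by (simp add: bounded_linear_Blinfun_apply[OF exp_field.bounded_linear_B] exp_field_def)

lemma Blinfun_mult_apply: "blinfun_apply (Blinfun ((*) g)) z = (g::complex^'d::finite) * z"
  by (simp add: bounded_linear_Blinfun_apply[OF bounded_linear_vec_mult])

text \<open>Multiplication is commutative, so a group element carries the infinitesimal action at x
  to the one at \<open>g * x\<close>. The invariance of the bivector field and the transport along
  fibres both rest on this.\<close>

lemma exp_field_mult: "Blinfun (exp_field (g * x)) = Blinfun ((*) g) o\<^sub>L Blinfun (exp_field x)"
  by (rule blinfun_eqI) (simp add: exp_field_apply Blinfun_mult_apply algebra_simps)

lemma exp_field_times_i: "times_i o\<^sub>L Blinfun (exp_field x) = Blinfun (exp_field x) o\<^sub>L times_i"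
  by (rule blinfun_eqI) (simp add: exp_field_apply times_i_apply vec_eq_iff)

lemma total_deriv_local_rep_open_atlas:
  "open S \<Longrightarrow> z \<in> S \<Longrightarrow> total_deriv (local_rep (S, id) b f) z = total_deriv (\<lambda>z. snd b (f z)) z"
  by (rule total_deriv_cong) (auto simp: local_rep_def)

lemma smooth_manifold_open:
  fixes S :: "'e::euclidean_space set"
  assumes "open S" shows "smooth_manifold (top_of_set S) (open_atlas S)"
  unfolding smooth_manifold_def smooth_atlas_def open_atlas_def
proof (intro conjI)
  show "Hausdorff_space (top_of_set S)" by (simp add: Hausdorff_space_subtopology)
  show "second_countable (top_of_set S)"
    by (rule second_countable_subtopology[OF second_countable_euclidean])
  have "smooth_on S (id \<circ> inv_into S id)"
    by (subst smooth_on_cong[OF assms, where g = id])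
       (auto intro!: smooth_on_linear[OF assms] simp: id_def bounded_linear_ident)
  then show "\<forall>(U, \<phi>)\<in>{(S, id)}. \<forall>(W, \<psi>)\<in>{(S, id)}. smooth_on (\<phi> ` (U \<inter> W)) (\<psi> \<circ> inv_into U \<phi>)"
    by simp
qed (use assms in \<open>auto simp: subtopology_subtopology homeomorphic_map_id\<close>)

lemma poisson_manifold_open:
  fixes S :: "'e::euclidean_space set"
  assumes "open S" "poisson_on S P" shows "poisson_manifold (top_of_set S) (open_atlas S) (\<lambda>_. P)"
  unfolding poisson_manifold_def smooth_bivector_field_def
proof (intro conjI smooth_manifold_open assms(1))
  have "total_deriv (local_rep (S, id) (S, id) id) x = id_blinfun" if "x \<in> S" for x
  proof -
    have "blinfun_apply (total_deriv (\<lambda>z::'e. z) x) = (\<lambda>z. z)"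
      by (rule total_derivI) (rule has_derivative_ident)
    then show ?thesis
      using total_deriv_local_rep_open_atlas[OF assms(1) that, of "(S, id)" id] by (intro blinfun_eqI) simp
  qed
  then show "\<forall>a\<in>open_atlas S. \<forall>b\<in>open_atlas S. \<forall>x\<in>fst a \<inter> fst b.
      P (snd b x) = push_bivector (total_deriv (local_rep a b id) (snd a x)) (P (snd a x))"
    by (auto simp: open_atlas_def push_bivector_id)
qed (use assms in \<open>auto simp: open_atlas_def poisson_on_def\<close>)

context toric_quotient
begin

context
  fixes \<pi> :: "(complex^'d) bivector"
  assumes bivector: "is_bivector \<pi>"
begin

definition \<pi>\<^sub>\<Sigma> :: "complex^'d \<Rightarrow> (complex^'d) bivector" where
  "\<pi>\<^sub>\<Sigma> = action_bivector exp_action \<pi>"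

definition \<pi>\<^sub>M :: "((complex^'d) set, complex^'n) bivector_field" where
  "\<pi>\<^sub>M = pushforward (open_atlas \<Sigma>) (\<lambda>_. \<pi>\<^sub>\<Sigma>) p"

lemma \<pi>\<^sub>\<Sigma>: "\<pi>\<^sub>\<Sigma> x = push_bivector (Blinfun (exp_field x)) \<pi>"
  by (simp add: \<pi>\<^sub>\<Sigma>_def action_bivector_exp exp_field.field_def)

lemma poisson_on_\<pi>\<^sub>\<Sigma>: "open S \<Longrightarrow> poisson_on S \<pi>\<^sub>\<Sigma>"
  unfolding \<pi>\<^sub>\<Sigma>_def action_bivector_exp by (rule exp_field.poisson_field[OF _ bivector])

lemma poisson_manifold_\<Sigma>: "poisson_manifold (top_of_set \<Sigma>) (open_atlas \<Sigma>) (\<lambda>_. \<pi>\<^sub>\<Sigma>)"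
  by (rule poisson_manifold_open[OF open_\<Sigma> poisson_on_\<pi>\<^sub>\<Sigma>[OF open_\<Sigma>]])

text \<open>Differentiating \<open>\<psi> (p (g * z)) = \<psi> (p z)\<close> in z shows that the
  derivatives at the two points differ by multiplication with g, which \<open>exp_field_mult\<close>
  absorbs into the bivector.\<close>

lemma push_invariant:
  assumes b: "(W, \<psi>) \<in> atlas" and z: "z \<in> \<Sigma>" "p z \<in> W" and y: "p y = p z"
  shows "push_bivector (total_deriv (\<lambda>z. \<psi> (p z)) y) (\<pi>\<^sub>\<Sigma> y) =
    push_bivector (total_deriv (\<lambda>z. \<psi> (p z)) z) (\<pi>\<^sub>\<Sigma> z)"
proof -
  obtain I where I: "I \<in> V" using z by (elim \<Sigma>E)
  obtain g where g: "g \<in> N" "y = g * z" using y p_eq_iff[OF z(1)] by auto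
  let ?F = "\<lambda>z. \<psi> (p z)" and ?O = "{z \<in> \<Sigma>. p z \<in> W}"
  have gz: "g * z \<in> ?O" using z p_mult[OF I g(1)] mult_in_\<Sigma>_iff[OF I g(1)] by simp
  have "total_deriv ?F z = total_deriv (\<lambda>z. ?F (g * z)) z"
    by (rule total_deriv_cong[OF atlasD(6)[OF b]]) (use z p_mult[OF I g(1)] in auto)
  also have "\<dots> = total_deriv ?F (g * z) o\<^sub>L total_deriv ((*) g) z"
    by (rule total_deriv_compose)
       (auto intro: smooth_on_differentiable[OF smooth_chart_comp[OF b] gz]
          bounded_linear_imp_differentiable bounded_linear_vec_mult)
  also have "total_deriv ((*) g) z = Blinfun ((*) g)"
    by (rule blinfun_eqI) (simp add: total_deriv_linear[OF bounded_linear_vec_mult] Blinfun_mult_apply)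
  finally show ?thesis
    by (simp add: g(2) \<pi>\<^sub>\<Sigma> push_bivector_compose exp_field_mult blinfun_compose_assoc)
qed

text \<open>Discharges the definite description in \<open>pushforward\<close>: points with equal
  chart value lie on one orbit, since \<psi> is injective, and there the pushed bivectors
  agree.\<close>

lemma \<pi>\<^sub>M_chart:
  assumes b: "(W, \<psi>) \<in> atlas" and z: "z \<in> \<Sigma>" "p z \<in> W"
  shows "\<pi>\<^sub>M (W, \<psi>) (\<psi> (p z)) = push_bivector (total_deriv (\<lambda>z. \<psi> (p z)) z) (\<pi>\<^sub>\<Sigma> z)"
  unfolding \<pi>\<^sub>M_def pushforward_def
proof (rule the_equality)
  show "\<exists>a\<in>open_atlas \<Sigma>. \<exists>x\<in>fst a \<inter> p -` fst (W, \<psi>). snd (W, \<psi>) (p x) = \<psi> (p z) \<and>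
      push_bivector (total_deriv (\<lambda>z. \<psi> (p z)) z) (\<pi>\<^sub>\<Sigma> z) =
      push_bivector (total_deriv (local_rep a (W, \<psi>) p) (snd a x)) (\<pi>\<^sub>\<Sigma> (snd a x))"
    using z by (auto simp: open_atlas_def total_deriv_local_rep_open_atlas[OF open_\<Sigma>] intro!: exI[of _ z] bexI[of _ z])
  fix \<sigma> assume "\<exists>a\<in>open_atlas \<Sigma>. \<exists>x\<in>fst a \<inter> p -` fst (W, \<psi>). snd (W, \<psi>) (p x) = \<psi> (p z) \<and>
      \<sigma> = push_bivector (total_deriv (local_rep a (W, \<psi>) p) (snd a x)) (\<pi>\<^sub>\<Sigma> (snd a x))"
  then obtain x where x: "x \<in> \<Sigma>" "p x \<in> W" "\<psi> (p x) = \<psi> (p z)"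
      "\<sigma> = push_bivector (total_deriv (\<lambda>z. \<psi> (p z)) x) (\<pi>\<^sub>\<Sigma> x)"
    by (auto simp: open_atlas_def total_deriv_local_rep_open_atlas[OF open_\<Sigma>])
  then have "p x = p z" using atlasD(4)[OF b] z by (auto dest: inj_onD)
  then show "\<sigma> = push_bivector (total_deriv (\<lambda>z. \<psi> (p z)) z) (\<pi>\<^sub>\<Sigma> z)"
    using push_invariant[OF b z, of x] x(4) by simp
qed

lemma is_bivector_\<pi>\<^sub>\<Sigma>: "is_bivector (\<pi>\<^sub>\<Sigma> x)"
  by (simp add: \<pi>\<^sub>\<Sigma> is_bivector_push bivector)

text \<open>As a function on \<Sigma> the pushed bivector is visibly smooth; a local section turns
  it into a smooth function on the chart.\<close>

lemma smooth_\<pi>\<^sub>M: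
  assumes b: "(W, \<psi>) \<in> atlas" shows "smooth_bivector_on (\<psi> ` W) (\<pi>\<^sub>M (W, \<psi>))"
  unfolding smooth_bivector_on_def
proof (intro conjI ballI allI)
  fix y assume "y \<in> \<psi> ` W"
  then obtain z where z: "z \<in> \<Sigma>" "p z \<in> W" "y = \<psi> (p z)" using chart_comp_image[OF b] by blast
  show "is_bivector (\<pi>\<^sub>M (W, \<psi>) y)"
    unfolding z(3) \<pi>\<^sub>M_chart[OF b z(1,2)] by (rule is_bivector_push[OF is_bivector_\<pi>\<^sub>\<Sigma>])
next
  let ?F = "\<lambda>z. \<psi> (p z)" and ?O = "{z \<in> \<Sigma>. p z \<in> W}"
  fix \<xi> \<eta> :: "(complex^'n) \<Rightarrow>\<^sub>L real"
  have O: "open ?O" by (rule atlasD(6)[OF b])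
  have Q: "smooth_on ?O (\<lambda>z. push_bivector (total_deriv ?F z) (\<pi>\<^sub>\<Sigma> z) \<xi> \<eta>)"
  proof -
    have sm: "smooth_on ?O (\<lambda>z. blinfun_apply (\<xi> o\<^sub>L total_deriv ?F z) v)" for \<xi> :: "(complex^'n) \<Rightarrow>\<^sub>L real" and v
      using smooth_on_linear_compose[OF O blinfun.bounded_linear_right smooth_on_total_deriv[OF O smooth_chart_comp[OF b]]]
      by simp
    have "smooth_bivector_on ?O \<pi>\<^sub>\<Sigma>" using poisson_on_\<pi>\<^sub>\<Sigma>[OF O] by (simp add: poisson_on_def)
    then show ?thesis unfolding push_bivector_def[of "total_deriv _ _"]
      by (intro smooth_on_bivector_apply[OF O _ is_bivector_\<pi>\<^sub>\<Sigma> sm sm]) (simp add: smooth_bivector_on_def)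
  qed
  show "smooth_on (\<psi> ` W) (\<lambda>y. \<pi>\<^sub>M (W, \<psi>) y \<xi> \<eta>)"
  proof (rule smooth_on_local)
    fix y assume "y \<in> \<psi> ` W"
    then obtain z where z: "z \<in> \<Sigma>" "p z \<in> W" "y = \<psi> (p z)" using chart_comp_image[OF b] by blast
    obtain U s where s: "open U" "\<psi> (p z) \<in> U" "U \<subseteq> \<psi> ` W" "smooth_on U s"
      "\<And>w. w \<in> U \<Longrightarrow> s w \<in> \<Sigma> \<and> p (s w) \<in> W \<and> \<psi> (p (s w)) = w"
      by (rule local_section[OF b z(1,2)]) blast
    have "smooth_on U (\<lambda>w. push_bivector (total_deriv ?F (s w)) (\<pi>\<^sub>\<Sigma> (s w)) \<xi> \<eta>)"
      by (rule smooth_on_compose[OF s(1) O s(4) _ Q]) (use s(5) in auto)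
    moreover have "push_bivector (total_deriv ?F (s w)) (\<pi>\<^sub>\<Sigma> (s w)) \<xi> \<eta> = \<pi>\<^sub>M (W, \<psi>) w \<xi> \<eta>" if "w \<in> U" for w
      using \<pi>\<^sub>M_chart[OF b, of "s w"] s(5)[OF that] by simp
    ultimately have "smooth_on U (\<lambda>y. \<pi>\<^sub>M (W, \<psi>) y \<xi> \<eta>)"
      by (subst smooth_on_cong[OF s(1), where g = "\<lambda>w. push_bivector (total_deriv ?F (s w)) (\<pi>\<^sub>\<Sigma> (s w)) \<xi> \<eta>"]) auto
    then show "\<exists>U. open U \<and> y \<in> U \<and> smooth_on (U \<inter> \<psi> ` W) (\<lambda>y. \<pi>\<^sub>M (W, \<psi>) y \<xi> \<eta>)"
      using s(1,2) z(3) smooth_on_subset by (metis Int_lower1)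
  qed
qed

lemma poisson_manifold_M: "poisson_manifold M atlas \<pi>\<^sub>M"
  unfolding poisson_manifold_def smooth_bivector_field_def
proof (intro conjI smooth_manifold_M ballI)
  fix a assume "a \<in> atlas"
  then show "smooth_bivector_on (snd a ` fst a) (\<pi>\<^sub>M a)" using smooth_\<pi>\<^sub>M by (cases a) auto
next
  fix a b X assume ab: "a \<in> atlas" "b \<in> atlas" and X: "X \<in> fst a \<inter> fst b"
  obtain W \<psi> W' \<psi>' where eq: "a = (W, \<psi>)" "b = (W', \<psi>')" by (cases a, cases b)
  note a = ab(1)[unfolded eq] and b = ab(2)[unfolded eq]
  obtain z where z: "z \<in> \<Sigma>" "p z \<in> W" "p z \<in> W'" "X = p z"
    using X atlasD(5)[OF a] by (auto simp: eq)
  let ?O = "{z \<in> \<Sigma>. p z \<in> W} \<inter> {z \<in> \<Sigma>. p z \<in> W'}"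
  have O: "open ?O" by (intro open_Int atlasD(6)[OF a] atlasD(6)[OF b])
  have "total_deriv (\<lambda>z. \<psi>' (p z)) z = total_deriv (\<lambda>z. local_rep a b id (\<psi> (p z))) z"
    by (rule total_deriv_cong[OF O]) (use z atlasD(4)[OF a] in \<open>auto simp: local_rep_def eq\<close>)
  also have "\<dots> = total_deriv (local_rep a b id) (\<psi> (p z)) o\<^sub>L total_deriv (\<lambda>z. \<psi> (p z)) z"
  proof (rule total_deriv_compose)
    show "(\<lambda>z. \<psi> (p z)) differentiable at z"
      by (rule smooth_on_differentiable[OF smooth_chart_comp[OF a]]) (use z in auto)
    show "local_rep a b id differentiable at (\<psi> (p z))"
      using smooth_on_differentiable[OF smooth_transition[OF a b], of "\<psi> (p z)"] z
      by (auto simp: local_rep_def eq)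
  qed
  finally show "\<pi>\<^sub>M b (snd b X) = push_bivector (total_deriv (local_rep a b id) (snd a X)) (\<pi>\<^sub>M a (snd a X))"
    using z by (simp add: eq \<pi>\<^sub>M_chart[OF a] \<pi>\<^sub>M_chart[OF b] push_bivector_compose)
next
  fix a assume "a \<in> atlas"
  moreover obtain W \<psi> where eq: "a = (W, \<psi>)" by (cases a)
  ultimately have a: "(W, \<psi>) \<in> atlas" by simp
  note im = chart_comp_image[OF a]
  have "poisson_on ((\<lambda>z. \<psi> (p z)) ` {z \<in> \<Sigma>. p z \<in> W}) (\<pi>\<^sub>M (W, \<psi>))"
    by (rule poisson_on_pushforward[OF atlasD(6)[OF a] _ smooth_chart_comp[OF a] poisson_on_\<pi>\<^sub>\<Sigma>[OF atlasD(6)[OF a]]])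
       (use atlasD(2)[OF a] smooth_\<pi>\<^sub>M[OF a] \<pi>\<^sub>M_chart[OF a] in \<open>auto simp: im\<close>)
  then show "poisson_on (snd a ` fst a) (\<pi>\<^sub>M a)" by (simp add: eq im)
qed

text \<open>The derivative of a local section through z is a right inverse.\<close>

lemma surj_total_deriv:
  assumes b: "(W, \<psi>) \<in> atlas" and z: "z \<in> \<Sigma>" "p z \<in> W"
  shows "surj (blinfun_apply (total_deriv (\<lambda>z. \<psi> (p z)) z))"
proof -
  let ?F = "\<lambda>z. \<psi> (p z)"
  obtain U s where s: "open U" "\<psi> (p z) \<in> U" "smooth_on U s"
      "\<And>w. w \<in> U \<Longrightarrow> s w \<in> \<Sigma> \<and> p (s w) \<in> W \<and> \<psi> (p (s w)) = w" "s (\<psi> (p z)) = z"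
    by (rule local_section[OF b z]) blast
  have "total_deriv (\<lambda>w. ?F (s w)) (?F z) = total_deriv ?F (s (?F z)) o\<^sub>L total_deriv s (?F z)"
    by (rule total_deriv_compose)
       (use s z smooth_on_differentiable[OF s(3)] smooth_on_differentiable[OF smooth_chart_comp[OF b]] in auto)
  moreover have "total_deriv (\<lambda>w. ?F (s w)) (?F z) = total_deriv (\<lambda>w. w) (?F z)"
    by (rule total_deriv_cong[OF s(1,2)]) (use s(4) in auto)
  moreover have "blinfun_apply (total_deriv (\<lambda>w. w) (?F z)) v = v" for v
    using total_deriv_linear[OF bounded_linear_ident] by metis
  ultimately have "total_deriv ?F z (total_deriv s (?F z) v) = v" for v
    using s(5) by (metis blinfun_apply_blinfun_compose)
  then show ?thesis by (metis surjI)
qed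

lemma poisson_submersion_p:
  "poisson_submersion (top_of_set \<Sigma>) (open_atlas \<Sigma>) (\<lambda>_. \<pi>\<^sub>\<Sigma>) M atlas \<pi>\<^sub>M p"
proof -
  have sm: "smooth_map (top_of_set \<Sigma>) (open_atlas \<Sigma>) M atlas p"
    unfolding smooth_map_def
  proof (intro conjI ballI continuous_map_p)
    fix a b assume "a \<in> open_atlas \<Sigma>" and b: "b \<in> atlas"
    then have a: "a = (\<Sigma>, id)" by (simp add: open_atlas_def)
    obtain W \<psi> where eq: "b = (W, \<psi>)" by (cases b)
    have im: "snd a ` (fst a \<inter> p -` fst b) = {z \<in> \<Sigma>. p z \<in> W}" by (auto simp: a eq)
    show "smooth_on (snd a ` (fst a \<inter> p -` fst b)) (local_rep a b p)"
      unfolding im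
      by (subst smooth_on_cong[OF atlasD(6)[OF b[unfolded eq]], where g = "\<lambda>z. \<psi> (p z)"])
         (use smooth_chart_comp[OF b[unfolded eq]] in \<open>auto simp: local_rep_def a eq\<close>)
  qed
  then show ?thesis
    unfolding poisson_submersion_def submersion_def poisson_map_def
    using surj_total_deriv \<pi>\<^sub>M_chart
    by (auto simp: open_atlas_def total_deriv_local_rep_open_atlas[OF open_\<Sigma>])
qed

end

text \<open>The Lie algebra of N: the linearisation at 1 of the monomial equations for the vertex
  set \<open>I\<close>.\<close>

definition fibre_algebra :: "'d set \<Rightarrow> (complex^'d) set" where
  "fibre_algebra I = {w. \<forall>i\<in>I. w $ i + (\<Sum>j\<in>-I. of_int (m I i j) * w $ j) = 0}"

lemma subspace_fibre_algebra: "subspace (fibre_algebra I)"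
  unfolding subspace_def fibre_algebra_def
proof (intro conjI ballI allI CollectI; (unfold mem_Collect_eq)?)
  fix x y :: "complex^'d" and r :: real and i
  assume x: "\<forall>i\<in>I. x $ i + (\<Sum>j\<in>-I. of_int (m I i j) * x $ j) = 0" and i: "i \<in> I"
  have "(r *\<^sub>R x) $ i + (\<Sum>j\<in>-I. of_int (m I i j) * (r *\<^sub>R x) $ j)
     = r *\<^sub>R (x $ i + (\<Sum>j\<in>-I. of_int (m I i j) * x $ j))"
    by (simp add: scaleR_add_right scaleR_sum_right)
  then show "(r *\<^sub>R x) $ i + (\<Sum>j\<in>-I. of_int (m I i j) * (r *\<^sub>R x) $ j) = 0" using x i by simp
  assume y: "\<forall>i\<in>I. y $ i + (\<Sum>j\<in>-I. of_int (m I i j) * y $ j) = 0"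
  have "(x + y) $ i + (\<Sum>j\<in>-I. of_int (m I i j) * (x + y) $ j)
     = (x $ i + (\<Sum>j\<in>-I. of_int (m I i j) * x $ j)) + (y $ i + (\<Sum>j\<in>-I. of_int (m I i j) * y $ j))"
    by (simp add: distrib_left sum.distrib)
  then show "(x + y) $ i + (\<Sum>j\<in>-I. of_int (m I i j) * (x + y) $ j) = 0" using x y i by simp
qed simp

lemma times_i_fibre_algebra: "w \<in> fibre_algebra I \<Longrightarrow> \<i> *s w \<in> fibre_algebra I"
proof -
  assume w: "w \<in> fibre_algebra I"
  have "(\<i> *s w) $ i + (\<Sum>j\<in>-I. of_int (m I i j) * (\<i> *s w) $ j)
     = \<i> * (w $ i + (\<Sum>j\<in>-I. of_int (m I i j) * w $ j))" for i
    by (simp add: distrib_left sum_distrib_left mult.left_commute)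
  then show ?thesis using w by (simp add: fibre_algebra_def)
qed

lemma exp_in_N:
  assumes I: "I \<in> V" and w: "w \<in> fibre_algebra I"
  shows "(\<chi> i. exp (of_real t * w $ i)) \<in> N"
proof -
  have "monomial_map (m I) I (\<chi> i. exp (of_real t * w $ i)) $ i = 1" if i: "i \<in> I" for i
  proof -
    have "monomial_map (m I) I (\<chi> i. exp (of_real t * w $ i)) $ i
       = exp (of_real t * w $ i) * (\<Prod>j\<in>-I. exp (of_int (m I i j) * (of_real t * w $ j)))"
      using i by (simp add: monomial_map_def exp_power_int)
    also have "\<dots> = exp (of_real t * (w $ i + (\<Sum>j\<in>-I. of_int (m I i j) * w $ j)))"
      by (simp add: exp_sum[symmetric] exp_add[symmetric] distrib_left sum_distrib_left mult.left_commute)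
    also have "\<dots> = 1" using w i by (simp add: fibre_algebra_def)
    finally show ?thesis .
  qed
  then show ?thesis by (simp add: N_iff[OF I])
qed

context
  fixes I z0
  assumes I: "I \<in> V" and z0: "z0 \<in> chart_domain I"
begin

definition "fibre = {x \<in> \<Sigma>. p x = p z0}"

lemma fibre_iff:
  "x \<in> fibre \<longleftrightarrow> x \<in> chart_domain I \<and> (\<forall>i\<in>I. monomial_map (m I) I x $ i = monomial_map (m I) I z0 $ i)"
  using p_eq_iff_monomials[OF I z0] chart_domain_subset_\<Sigma>[OF I] by (auto simp: fibre_def)

lemma fibre_iff_orbit: "x \<in> fibre \<longleftrightarrow> (\<exists>g\<in>N. x = g * z0)"
  using p_eq_iff[of z0 x] mult_in_\<Sigma>_iff[OF I] z0 chart_domain_subset_\<Sigma>[OF I] by (auto simp: fibre_def)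

text \<open>The fibre lies in one vertex domain, so a single straightening map serves all its
  points: the monomial automorphism, translated by c to make the prescribed monomials 0. As c
  vanishes outside \<open>I\<close>, the translation preserves
  \<open>chart_domain I\<close>.\<close>

lemma embedded_fibre: "embedded_submanifold fibre"
  unfolding embedded_submanifold_def
proof
  fix x assume x: "x \<in> fibre"
  define c :: "complex^'d" where "c = (\<chi> i. if i \<in> I then monomial_map (m I) I z0 $ i else 0)"
  define \<theta> where "\<theta> = (\<lambda>z. monomial_map (m I) I z - c)"
  define \<theta>' where "\<theta>' = (\<lambda>w. monomial_map (\<lambda>i j. - m I i j) I (w + c))"
  let ?U = "chart_domain I" and ?L = "{w::complex^'d. \<forall>i\<in>I. w $ i = 0}"
  have trans: "w + c \<in> ?U \<longleftrightarrow> w \<in> ?U" "w - c \<in> ?U \<longleftrightarrow> w \<in> ?U" for w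
    by (auto simp: chart_domain_def c_def)
  have \<theta>'\<theta>: "\<theta>' (\<theta> z) = z" if "z \<in> ?U" for z
    using that by (simp add: \<theta>_def \<theta>'_def monomial_map_inverse)
  have \<theta>\<theta>': "\<theta> (\<theta>' w) = w" if "w \<in> ?U" for w
    using that by (simp add: \<theta>_def \<theta>'_def monomial_map_inverse' trans)
  have \<theta>U: "\<theta> z \<in> ?U" if "z \<in> ?U" for z
    using that by (simp add: \<theta>_def trans monomial_map_in_chart_domain)
  have \<theta>'U: "\<theta>' z \<in> ?U" if "z \<in> ?U" for z
    using that by (simp add: \<theta>'_def trans monomial_map_in_chart_domain)
  have im: "\<theta> ` ?U = ?U" using \<theta>U \<theta>'U \<theta>\<theta>' by (auto simp: image_iff) metis
  have inj: "inj_on \<theta> ?U" using \<theta>'\<theta> by (metis inj_onI)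
  have s\<theta>: "smooth_on ?U \<theta>"
    unfolding \<theta>_def diff_conv_add_uminus
    by (intro smooth_on_add smooth_monomial_map smooth_on_const open_chart_domain)
  have "smooth_on ?U (\<lambda>w. w + c)"
    by (intro smooth_on_add smooth_on_linear bounded_linear_ident smooth_on_const open_chart_domain)
  then have "smooth_on ?U \<theta>'"
    unfolding \<theta>'_def
    by (rule smooth_on_compose[OF open_chart_domain open_chart_domain _ _ smooth_monomial_map]) (auto simp: trans)
  moreover have "inv_into ?U \<theta> w = \<theta>' w" if "w \<in> ?U" for w
    by (rule inv_into_f_eq[OF inj \<theta>'U[OF that] \<theta>\<theta>'[OF that]])
  ultimately have "smooth_on ?U (inv_into ?U \<theta>)"
    by (subst smooth_on_cong[OF open_chart_domain, where g = \<theta>']) auto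
  moreover have "subspace ?L" by (simp add: subspace_def)
  moreover have "\<theta> ` (fibre \<inter> ?U) = ?U \<inter> ?L"
  proof (intro equalityI subsetI)
    fix w assume "w \<in> \<theta> ` (fibre \<inter> ?U)"
    then show "w \<in> ?U \<inter> ?L" using \<theta>U by (auto simp: fibre_iff \<theta>_def c_def)
  next
    fix w assume w: "w \<in> ?U \<inter> ?L"
    then have "monomial_map (m I) I (\<theta>' w) = w + c" by (simp add: \<theta>'_def monomial_map_inverse' trans)
    then have "\<theta>' w \<in> fibre" using w \<theta>'U by (simp add: fibre_iff c_def)
    then show "w \<in> \<theta> ` (fibre \<inter> ?U)"
      using w \<theta>'U \<theta>\<theta>' by (intro image_eqI[of _ _ "\<theta>' w"]) auto
  qed
  ultimately show "\<exists>W (\<theta>::complex^'d \<Rightarrow> complex^'d) L. open W \<and> x \<in> W \<and> open (\<theta> ` W) \<and> inj_on \<theta> W \<and> smooth_on W \<theta> \<and>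
      smooth_on (\<theta> ` W) (inv_into W \<theta>) \<and> subspace L \<and> \<theta> ` (fibre \<inter> W) = \<theta> ` W \<inter> L"
    using x inj s\<theta> by (intro exI[of _ ?U] exI[of _ \<theta>] exI[of _ ?L]) (simp add: im fibre_iff open_chart_domain)
qed

text \<open>Velocities of curves in the fibre satisfy the logarithmically differentiated equations.
  Conversely, the orbit of x under the one-parameter group of w stays in the fibre and has velocity
  \<open>w * x\<close>.\<close>

lemma tangent_fibre:
  assumes x: "x \<in> fibre" shows "tangent_space fibre x = (\<lambda>w. w * x) ` fibre_algebra I"
proof (intro equalityI subsetI)
  have xU: "x \<in> chart_domain I" using x by (simp add: fibre_iff)
  {
    fix v assume "v \<in> tangent_space fibre x"
    then obtain \<gamma> \<epsilon> where \<gamma>: "\<epsilon> > 0" "\<gamma> ` {-\<epsilon><..<\<epsilon>} \<subseteq> fibre" "\<gamma> 0 = x" "(\<gamma> has_vector_derivative v) (at 0)"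
      by (auto simp: tangent_space_def)
    have "monomial_map (m I) I (\<gamma> t) $ i = monomial_map (m I) I z0 $ i" if "i \<in> I" "\<bar>t\<bar> < \<epsilon>" for t i
    proof -
      have "\<gamma> t \<in> fibre" using that(2) \<gamma>(2) by (auto simp: abs_less_iff)
      then show ?thesis using that(1) by (simp add: fibre_iff)
    qed
    then have vel: "v $ i + x $ i * (\<Sum>j\<in>-I. of_int (m I i j) * v $ j / x $ j) = 0" if "i \<in> I" for i
      using monomial_curve_velocity[OF \<gamma>(4) _ that \<gamma>(1), of "m I"] xU that unfolding \<gamma>(3) by blast
    \<comment> \<open>Outside \<open>I\<close> one may divide by x. Inside, where x may vanish, the
      component is dictated by the equations of \<open>fibre_algebra\<close>, and \<open>vel\<close>
      yields \<open>v = w * x\<close> there as well.\<close>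
    define w :: "complex^'d" where
      "w = (\<chi> i. if i \<in> I then - (\<Sum>j\<in>-I. of_int (m I i j) * v $ j / x $ j) else v $ i / x $ i)"
    have "w \<in> fibre_algebra I" by (simp add: fibre_algebra_def w_def)
    moreover have "v = w * x"
      unfolding vec_eq_iff
    proof
      fix i
      show "v $ i = (w * x) $ i"
      proof (cases "i \<in> I")
        case True
        then show ?thesis using vel[OF True] by (simp add: w_def eq_neg_iff_add_eq_0 mult.commute)
      next
        case False
        then show ?thesis using xU by (simp add: w_def chart_domain_def)
      qed
    qed
    ultimately show "v \<in> (\<lambda>w. w * x) ` fibre_algebra I" by blast
  }
  {
    fix v assume "v \<in> (\<lambda>w. w * x) ` fibre_algebra I"
    then obtain w where w: "w \<in> fibre_algebra I" "v = w * x" by blast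
    let ?\<gamma> = "\<lambda>t::real. exp_action (t *\<^sub>R w) x"
    have "smooth_on {-1<..<1} ?\<gamma>"
      unfolding exp_action_scaleR
      by (rule smooth_on_vec) (auto intro!: smooth_on_mult smooth_on_const smooth_on_exp_line)
    moreover have "?\<gamma> t \<in> fibre" for t
    proof -
      obtain g where g: "g \<in> N" "x = g * z0" using x by (auto simp: fibre_iff_orbit)
      have "?\<gamma> t = ((\<chi> i. exp (of_real t * w $ i)) * g) * z0"
        by (simp add: exp_action_scaleR vec_eq_iff g mult.assoc)
      then show ?thesis using mult_in_N[OF I exp_in_N[OF I w(1)] g(1)] by (auto simp: fibre_iff_orbit)
    qed
    moreover have "?\<gamma> 0 = x" by (simp add: exp_action_def vec_eq_iff)
    ultimately show "v \<in> tangent_space fibre x"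
      using has_vector_derivative_exp_action[of w x] unfolding tangent_space_def w(2)
      by (intro CollectI exI[of _ ?\<gamma>] exI[of _ 1]) auto
  }
qed

text \<open>The infinitesimal action at z0 is injective on the Lie algebra: z0 has no zero outside
  \<open>I\<close>, and the components outside \<open>I\<close> determine the others. So
  \<open>uniform_dirac_pullback\<close> yields one b, whose field under the same action is the
  bivector on the fibre.\<close>

lemma poisson_dirac_fibre:
  assumes \<pi>: "positive_form \<pi>" shows "poisson_dirac \<Sigma> (action_bivector exp_action \<pi>) fibre"
proof -
  let ?n = "fibre_algebra I" and ?L = "Blinfun (exp_field z0)"
  have "inj_on (blinfun_apply ?L) ?n"
  proof (rule inj_onI)
    fix v w assume vw: "v \<in> ?n" "w \<in> ?n" "?L v = ?L w"
    then have "v $ j * z0 $ j = w $ j * z0 $ j" for j by (simp add: exp_field_apply vec_eq_iff)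
    then have out: "v $ j = w $ j" if "j \<notin> I" for j
      using z0 that chart_domain_nonzero by (metis mult_right_cancel)
    moreover have "v $ i = w $ i" if "i \<in> I" for i
    proof -
      have "(\<Sum>j\<in>-I. of_int (m I i j) * v $ j) = (\<Sum>j\<in>-I. of_int (m I i j) * w $ j)"
        using out by (intro sum.cong) auto
      moreover have "v $ i + (\<Sum>j\<in>-I. of_int (m I i j) * v $ j) = 0"
        "w $ i + (\<Sum>j\<in>-I. of_int (m I i j) * w $ j) = 0"
        using vw(1,2) that by (auto simp: fibre_algebra_def)
      ultimately show ?thesis by (simp add: eq_neg_iff_add_eq_0[symmetric])
    qed
    ultimately have "v $ i = w $ i" for i by (cases "i \<in> I") auto
    then show "v = w" by (simp add: vec_eq_iff)
  qed
  from uniform_dirac_pullback[OF \<pi> exp_field_times_i subspace_fibre_algebra times_i_fibre_algebra this]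
  obtain b where b: "is_bivector b" and
    key: "\<And>M M' :: (complex^'d) \<Rightarrow>\<^sub>L (complex^'d). M o\<^sub>L M' = id_blinfun \<Longrightarrow> M' o\<^sub>L M = id_blinfun \<Longrightarrow>
       range (sharp (push_bivector (M o\<^sub>L ?L) b)) \<subseteq> (M o\<^sub>L ?L) ` ?n \<and>
       dirac_pullback ((M o\<^sub>L ?L) ` ?n) (graph_bivector (push_bivector (M o\<^sub>L ?L) \<pi>)) =
         graph_bivector_in ((M o\<^sub>L ?L) ` ?n) (push_bivector (M o\<^sub>L ?L) b)"
    by blast
  have main: "range (sharp (exp_field.field b x)) \<subseteq> tangent_space fibre x \<and>
      dirac_pullback (tangent_space fibre x) (graph_bivector (action_bivector exp_action \<pi> x)) =
        graph_bivector_in (tangent_space fibre x) (exp_field.field b x)" if x: "x \<in> fibre" for x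
  proof -
    obtain g where g: "g \<in> N" "x = g * z0" using x by (auto simp: fibre_iff_orbit)
    let ?M = "Blinfun ((*) g)" and ?M' = "Blinfun ((*) (vec_inverse g))"
    have inv: "vec_inverse g * g = 1" using vec_inverse[of g] N_nonzero[OF I g(1)] by blast
    moreover from inv have "g * vec_inverse g = 1" by (simp add: mult.commute)
    ultimately have M: "?M o\<^sub>L ?M' = id_blinfun" "?M' o\<^sub>L ?M = id_blinfun"
      by (auto intro!: blinfun_eqI simp: Blinfun_mult_apply mult.assoc[symmetric])
    have comp: "?M o\<^sub>L ?L = Blinfun (exp_field x)" by (simp add: g(2) exp_field_mult)
    have "(blinfun_apply (Blinfun (exp_field x))) ` ?n = (\<lambda>w. w * x) ` uminus ` ?n"
      by (auto simp: exp_field_apply image_image)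
    \<comment> \<open>The sign in \<open>exp_field\<close> disappears because the Lie algebra is a
      subspace.\<close>
    also have "uminus ` ?n = ?n" using subspace_fibre_algebra[of I]
      by (auto simp: image_iff subspace_neg intro!: bexI[of _ "- _"])
    also have "(\<lambda>w. w * x) ` ?n = tangent_space fibre x" by (rule tangent_fibre[OF x, symmetric])
    finally show ?thesis
      using key[OF M] by (simp add: comp action_bivector_exp exp_field.field_def)
  qed
  \<comment> \<open>Since b does not depend on the point, its field is smooth on the whole space,
    which supplies the local extensions.\<close>
  have "smooth_on_submanifold fibre (\<lambda>x. exp_field.field b x \<xi> \<eta>)" for \<xi> \<eta>
    using exp_field.smooth_field[OF open_UNIV b]
    unfolding smooth_on_submanifold_def smooth_bivector_on_def by (metis UNIV_I open_UNIV)
  moreover have "is_bivector (exp_field.field b x)" for x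
    by (simp add: exp_field.field_def is_bivector_push b)
  moreover have "fibre \<subseteq> \<Sigma>" by (auto simp: fibre_def)
  ultimately show ?thesis
    unfolding poisson_dirac_def using embedded_fibre main
    by (intro conjI exI[of _ "exp_field.field b"]) auto
qed

end

lemma has_poisson_fibres_p:
  assumes \<pi>: "positive_form \<pi>" shows "has_poisson_fibres \<Sigma> (action_bivector exp_action \<pi>) (topspace M) p"
  unfolding has_poisson_fibres_def topspace_M
proof
  fix Y assume "Y \<in> p ` \<Sigma>"
  then obtain I z0 where "I \<in> V" "z0 \<in> chart_domain I" "Y = p z0" by (auto simp: \<Sigma>_def)
  then show "poisson_dirac \<Sigma> (action_bivector exp_action \<pi>) {x \<in> \<Sigma>. p x = Y}"
    using poisson_dirac_fibre[OF _ _ \<pi>, of I z0] by (simp add: fibre_def)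
qed

end

section \<open>Delzant polytopes\<close>

lemma zspan_family:
  assumes "finite I" "inj_on u I"
  shows "x \<in> zmod.span (u ` I) \<longleftrightarrow> (\<exists>k. x = (\<Sum>i\<in>I. of_int (k i) *\<^sub>R u i))"
proof
  assume "x \<in> zmod.span (u ` I)"
  then obtain k where "x = (\<Sum>v\<in>u ` I. of_int (k v) *\<^sub>R v)"
    using zmod.span_finite[OF finite_imageI[OF assms(1)]] by auto
  then have "x = (\<Sum>i\<in>I. of_int (k (u i)) *\<^sub>R u i)" by (simp add: sum.reindex[OF assms(2)])
  then show "\<exists>k. x = (\<Sum>i\<in>I. of_int (k i) *\<^sub>R u i)" by (rule exI[of _ "\<lambda>i. k (u i)"])
next
  assume "\<exists>k. x = (\<Sum>i\<in>I. of_int (k i) *\<^sub>R u i)"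
  then show "x \<in> zmod.span (u ` I)"
    by (auto intro!: zmod.span_sum zmod.span_scale intro: zmod.span_base)
qed

lemma zspan_subset_span: "zmod.span B \<subseteq> span (B::'a::real_vector set)"
proof
  fix x assume "x \<in> zmod.span B"
  then show "x \<in> span B"
    by (induction rule: zmod.span_induct_alt) (auto intro: span_add span_scale span_base span_zero)
qed

text \<open>The transition matrices between the two families are integral and inverse to each other, and
  \<open>P Q = 1\<close>, \<open>Q P = 1\<close> for matrices of a priori different shapes force equal sizes by
  comparing traces.\<close>

lemma card_zbasis:
  fixes B U :: "'a::real_vector set"
  assumes B: "finite B" "independent B" and U: "finite U" "zmod.independent U"
    and eq: "zmod.span B = zmod.span U"
  shows "card B = card U"
proof -
  have "\<exists>k. b = (\<Sum>x\<in>U. of_int (k x) *\<^sub>R x)" if "b \<in> B" for b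
    using zspan_family[OF U(1), of id b] zmod.span_base[OF that] eq by simp
  then obtain P where P: "\<And>b. b \<in> B \<Longrightarrow> b = (\<Sum>x\<in>U. of_int (P b x) *\<^sub>R x)" by metis
  have "\<exists>k. x = (\<Sum>b\<in>B. of_int (k b) *\<^sub>R b)" if "x \<in> U" for x
    using zspan_family[OF B(1), of id x] zmod.span_base[OF that] eq by simp
  then obtain Q where Q: "\<And>x. x \<in> U \<Longrightarrow> x = (\<Sum>b\<in>B. of_int (Q x b) *\<^sub>R b)" by metis
  have PQ: "(\<Sum>x\<in>U. P b x * Q x b) = 1" if b: "b \<in> B" for b
  proof -
    have "b = (\<Sum>x\<in>U. of_int (P b x) *\<^sub>R (\<Sum>b'\<in>B. of_int (Q x b') *\<^sub>R b'))"
      using P[OF b] Q by (metis (no_types, lifting) sum.cong)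
    also have "\<dots> = (\<Sum>b'\<in>B. of_int (\<Sum>x\<in>U. P b x * Q x b') *\<^sub>R b')"
      by (simp add: scaleR_sum_right scaleR_sum_left) (rule sum.swap)
    finally have "(\<Sum>b'\<in>B. (of_int (\<Sum>x\<in>U. P b x * Q x b') - (if b' = b then 1 else 0)) *\<^sub>R b') = 0"
      using b B(1) by (simp add: scaleR_diff_left sum_subtractf if_distrib[of "\<lambda>c. c *\<^sub>R _"] cong: if_cong)
    from independentD[OF B(2,1) subset_refl this b]
    have "real_of_int (\<Sum>x\<in>U. P b x * Q x b) = of_int 1" by simp
    then show ?thesis by (simp only: of_int_eq_iff)
  qed
  have QP: "(\<Sum>b\<in>B. Q x b * P b x) = 1" if x: "x \<in> U" for x
  proof -
    have "x = (\<Sum>b\<in>B. of_int (Q x b) *\<^sub>R (\<Sum>x'\<in>U. of_int (P b x') *\<^sub>R x'))"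
      using Q[OF x] P by (metis (no_types, lifting) sum.cong)
    also have "\<dots> = (\<Sum>x'\<in>U. of_int (\<Sum>b\<in>B. Q x b * P b x') *\<^sub>R x')"
      by (simp add: scaleR_sum_right scaleR_sum_left) (rule sum.swap)
    finally have "(\<Sum>x'\<in>U. of_int ((\<Sum>b\<in>B. Q x b * P b x') - (if x' = x then 1 else 0)) *\<^sub>R x') = 0"
      using x U(1) by (simp add: scaleR_diff_left sum_subtractf if_distrib[of "\<lambda>c. c *\<^sub>R _"]
          if_distrib[of of_int] cong: if_cong)
    from zmod.independentD[OF U(2,1) subset_refl this x] show ?thesis by simp
  qed
  have "int (card B) = (\<Sum>b\<in>B. \<Sum>x\<in>U. P b x * Q x b)" by (simp add: PQ)
  also have "\<dots> = (\<Sum>x\<in>U. \<Sum>b\<in>B. Q x b * P b x)" by (subst sum.swap) (simp add: mult.commute)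
  also have "\<dots> = int (card U)" by (simp add: QP)
  finally show ?thesis by simp
qed

text \<open>\<open>zbasis_family\<close> asserts independence over the integers only. Equal
  cardinality with a real basis generating the lattice, together with spanning, upgrades it to
  independence over the reals.\<close>

lemma zbasis_family_basis:
  fixes \<Lambda> :: "'a::euclidean_space set"
  assumes \<Lambda>: "full_lattice \<Lambda>" and I: "finite I" "zbasis_family \<Lambda> u I"
  shows "card I = DIM('a)" "independent (u ` I)" "span (u ` I) = UNIV"
proof -
  obtain B where B: "independent B" "span B = UNIV" "zmod.span B = \<Lambda>"
    using \<Lambda> by (auto simp: full_lattice_def)
  have fin: "finite B" using B(1) by (rule independent_imp_finite)
  have u: "inj_on u I" "zmod.independent (u ` I)" "zmod.span (u ` I) = \<Lambda>"
    using I(2) by (auto simp: zbasis_family_def)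
  have "card B = card (u ` I)"
    by (rule card_zbasis) (use fin B u I(1) in auto)
  moreover have "card B = DIM('a)" using B(1,2) by (metis dim_UNIV dim_eq_card dim_span)
  ultimately have card: "card (u ` I) = DIM('a)" by simp
  then show "card I = DIM('a)" by (simp add: card_image[OF u(1)])
  have "B \<subseteq> span (u ` I)"
    using zmod.span_superset[of B] zspan_subset_span[of "u ` I"] B(3) u(3) by auto
  then show sp: "span (u ` I) = UNIV" using B(2) span_mono[of B "span (u ` I)"] by (auto simp: span_span)
  show "independent (u ` I)"
    by (rule card_le_dim_spanning[of _ UNIV]) (use sp card I(1) in auto)
qed

locale delzant_polytope =
  fixes \<Lambda> :: "(real^'n::finite) set" and u :: "'d::finite \<Rightarrow> real^'n" and c :: "'d \<Rightarrow> real"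
  assumes lattice: "full_lattice \<Lambda>" and delzant: "delzant \<Lambda> u c"
begin

definition vertex_sets :: "'d set set" where
  "vertex_sets = {I. \<exists>v. v extreme_point_of polytope_of u c \<and> I = {i. v \<bullet> u i = c i}}"

definition vertex :: "'d set \<Rightarrow> real^'n" where
  "vertex I = (SOME v. v extreme_point_of polytope_of u c \<and> I = {i. v \<bullet> u i = c i})"

definition mat :: "'d set \<Rightarrow> 'd \<Rightarrow> 'd \<Rightarrow> int" where
  "mat I = (SOME m. \<forall>j. u j = (\<Sum>i\<in>I. of_int (m i j) *\<^sub>R u i))"

text \<open>For i in \<open>I\<close>, the coordinate at \<open>u i\<close> of the combination of
  all normals with coefficients a, in the basis of normals at the vertex.\<close>

definition coef :: "'d set \<Rightarrow> real^'d \<Rightarrow> 'd \<Rightarrow> real" where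
  "coef I a i = a $ i + (\<Sum>j\<in>-I. of_int (mat I i j) * a $ j)"

text \<open>For a lattice polytope this is the modulus of the monomial in homogeneous coordinates
  that represents the vertex. The exponents are real since vertices need not be lattice points; they
  are positive outside \<open>I\<close>.\<close>

definition sep :: "'d set \<Rightarrow> complex^'d \<Rightarrow> real" where
  "sep I z = (\<Prod>j\<in>-I. norm (z $ j) powr (vertex I \<bullet> u j - c j))"

abbreviation "NC \<equiv> complexification (kernel_group \<Lambda> u)"

lemma compact_polytope: "compact (polytope_of u c)" and range_u: "range u \<subseteq> \<Lambda>"
  and zbasis_vertex: "v extreme_point_of polytope_of u c \<Longrightarrow> zbasis_family \<Lambda> u {i. v \<bullet> u i = c i}"
  using delzant by (auto simp: delzant_def Let_def)

lemma vertex: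
  assumes "I \<in> vertex_sets"
  shows "vertex I extreme_point_of polytope_of u c" "I = {i. vertex I \<bullet> u i = c i}"
proof -
  have "\<exists>v. v extreme_point_of polytope_of u c \<and> I = {i. v \<bullet> u i = c i}"
    using assms by (simp add: vertex_sets_def)
  from someI_ex[OF this]
  show "vertex I extreme_point_of polytope_of u c" "I = {i. vertex I \<bullet> u i = c i}"
    by (simp_all add: vertex_def)
qed

lemma vertex_ge: "I \<in> vertex_sets \<Longrightarrow> vertex I \<bullet> u j \<ge> c j"
  using vertex(1)[of I] by (auto simp: extreme_point_of_def polytope_of_def)

lemma vertex_gt: "I \<in> vertex_sets \<Longrightarrow> j \<notin> I \<Longrightarrow> vertex I \<bullet> u j > c j"
  using vertex_ge[of I j] vertex(2)[of I] by (metis (mono_tags) less_eq_real_def mem_Collect_eq)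

lemma vertex_eq: "I \<in> vertex_sets \<Longrightarrow> j \<in> I \<Longrightarrow> vertex I \<bullet> u j = c j"
  using vertex(2)[of I] by blast

context
  fixes I assumes I: "I \<in> vertex_sets"
begin

lemma zbasis: "zbasis_family \<Lambda> u I"
  using zbasis_vertex[OF vertex(1)[OF I]] vertex(2)[OF I] by simp

lemma card_vertex_set: "card I = CARD('n)" and independent_u: "independent (u ` I)"
  and inj_u: "inj_on u I"
  using zbasis_family_basis[OF lattice _ zbasis] zbasis by (auto simp: zbasis_family_def)

lemma in_lattice_iff: "x \<in> \<Lambda> \<longleftrightarrow> (\<exists>k. x = (\<Sum>i\<in>I. of_int (k i) *\<^sub>R u i))"
  using zspan_family[OF _ inj_u, of x] zbasis by (simp add: zbasis_family_def)

lemma mat: "u j = (\<Sum>i\<in>I. of_int (mat I i j) *\<^sub>R u i)"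
proof -
  have "\<forall>j. \<exists>k. u j = (\<Sum>i\<in>I. of_int (k i) *\<^sub>R u i)"
    using range_u by (auto simp: in_lattice_iff[symmetric])
  then obtain k where "\<forall>j. u j = (\<Sum>i\<in>I. of_int (k j i) *\<^sub>R u i)" by metis
  then have "\<exists>m. \<forall>j. u j = (\<Sum>i\<in>I. of_int (m i j) *\<^sub>R u i)" by (intro exI[of _ "\<lambda>i j. k j i"])
  from someI_ex[OF this] show ?thesis unfolding mat_def by blast
qed

lemma sum_eq_coef: "(\<Sum>j\<in>UNIV. a $ j *\<^sub>R u j) = (\<Sum>i\<in>I. coef I a i *\<^sub>R u i)"
proof -
  have "(\<Sum>j\<in>UNIV. a $ j *\<^sub>R u j) = (\<Sum>i\<in>I. a $ i *\<^sub>R u i) + (\<Sum>j\<in>-I. a $ j *\<^sub>R u j)"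
    by (subst sum.union_disjoint[symmetric]) auto
  also have "(\<Sum>j\<in>-I. a $ j *\<^sub>R u j) = (\<Sum>j\<in>-I. a $ j *\<^sub>R (\<Sum>i\<in>I. of_int (mat I i j) *\<^sub>R u i))"
    using mat by (metis (no_types, lifting))
  also have "\<dots> = (\<Sum>i\<in>I. (\<Sum>j\<in>-I. of_int (mat I i j) * a $ j) *\<^sub>R u i)"
    by (simp add: scaleR_sum_right scaleR_sum_left mult.commute) (rule sum.swap)
  finally show ?thesis by (simp add: coef_def scaleR_add_left sum.distrib)
qed

lemma sum_u_unique:
  assumes "(\<Sum>i\<in>I. a i *\<^sub>R u i) = (\<Sum>i\<in>I. b i *\<^sub>R u i)" "i \<in> I" shows "a i = b i"
proof -
  have "(\<Sum>i\<in>I. (a i - b i) *\<^sub>R u i) = 0" using assms(1) by (simp add: scaleR_diff_left sum_subtractf)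
  then have "(\<Sum>v\<in>u ` I. (a (inv_into I u v) - b (inv_into I u v)) *\<^sub>R v) = 0"
    by (simp add: sum.reindex[OF inj_u] inj_u)
  from independentD[OF independent_u _ subset_refl this, of "u i"] show ?thesis
    using assms(2) inj_u by simp
qed

lemma sum_in_lattice_iff: "(\<Sum>j\<in>UNIV. a $ j *\<^sub>R u j) \<in> \<Lambda> \<longleftrightarrow> (\<forall>i\<in>I. coef I a i \<in> \<int>)"
proof
  assume "(\<Sum>j\<in>UNIV. a $ j *\<^sub>R u j) \<in> \<Lambda>"
  then obtain k where "(\<Sum>i\<in>I. coef I a i *\<^sub>R u i) = (\<Sum>i\<in>I. of_int (k i) *\<^sub>R u i)"
    by (auto simp: in_lattice_iff sum_eq_coef)
  from sum_u_unique[OF this] show "\<forall>i\<in>I. coef I a i \<in> \<int>" by simp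
next
  assume "\<forall>i\<in>I. coef I a i \<in> \<int>"
  then have "\<forall>i\<in>I. \<exists>k. coef I a i = of_int k" by (auto elim: Ints_cases)
  then obtain k where "\<And>i. i \<in> I \<Longrightarrow> coef I a i = of_int (k i)" by metis
  then have "(\<Sum>i\<in>I. coef I a i *\<^sub>R u i) = (\<Sum>i\<in>I. of_int (k i) *\<^sub>R u i)" by simp
  then show "(\<Sum>j\<in>UNIV. a $ j *\<^sub>R u j) \<in> \<Lambda>" by (auto simp: in_lattice_iff sum_eq_coef)
qed

lemma sum_eq_0_iff: "(\<Sum>j\<in>UNIV. a $ j *\<^sub>R u j) = 0 \<longleftrightarrow> (\<forall>i\<in>I. coef I a i = 0)"
  using sum_u_unique[of "coef I a" "\<lambda>_. 0"] by (auto simp: sum_eq_coef)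

lemma coef_diff: "coef I (a - b) i = coef I a i - coef I b i"
  by (simp add: coef_def right_diff_distrib sum_subtractf)

lemma coef_scale: "coef I (t *\<^sub>R a) i = t * coef I a i"
  by (simp add: coef_def distrib_left sum_distrib_left mult.left_commute)

lemma coef_Ints: "(\<And>j. a $ j \<in> \<int>) \<Longrightarrow> coef I a i \<in> \<int>"
  unfolding coef_def by (intro Ints_add Ints_sum Ints_mult) auto

section \<open>The complexified kernel as the solution set of monomial equations\<close>

lemma torus_exp_eqD:
  assumes "torus_exp (of_real_vec a) = torus_exp (of_real_vec b)" shows "(a - b) $ j \<in> \<int>"
proof -
  have "exp (2 * of_real pi * \<i> * of_real (a $ j)) = exp (2 * of_real pi * \<i> * of_real (b $ j))"
    using assms by (simp add: torus_exp_def of_real_vec_def vec_eq_iff)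
  then obtain n :: int where "2 * of_real pi * \<i> * complex_of_real (a $ j) = 2 * of_real pi * \<i> * of_real (b $ j) + (of_int (2 * n) * pi) * \<i>"
    unfolding exp_eq by blast
  from arg_cong[OF this, of Im] have "pi * (2 * (a $ j - b $ j - of_int n)) = 0"
    by (simp add: algebra_simps)
  then have "a $ j - b $ j = of_int n" by simp
  then show ?thesis by simp
qed

lemma lie_algebra_kernel: "a \<in> lie_algebra (kernel_group \<Lambda> u) \<longleftrightarrow> (\<forall>i\<in>I. coef I a i = 0)"
proof
  assume a: "a \<in> lie_algebra (kernel_group \<Lambda> u)"
  show "\<forall>i\<in>I. coef I a i = 0"
  proof (rule ballI, rule ccontr)
    fix i assume i: "i \<in> I" and ne: "coef I a i \<noteq> 0"
    \<comment> \<open>Brings the coefficient of \<open>t *\<^sub>R a\<close> to 1/2, whereas every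
      multiple of a must have integral coefficients.\<close>
    define t where "t = 1 / (2 * coef I a i)"
    obtain a' where a': "torus_exp (of_real_vec (t *\<^sub>R a)) = torus_exp (of_real_vec a')"
      "(\<Sum>j\<in>UNIV. a' $ j *\<^sub>R u j) \<in> \<Lambda>"
      using a unfolding lie_algebra_def kernel_group_def by blast
    have "coef I (t *\<^sub>R a - a') i \<in> \<int>" by (rule coef_Ints[OF torus_exp_eqD[OF a'(1)]])
    moreover have "coef I a' i \<in> \<int>" using a'(2) i by (simp add: sum_in_lattice_iff)
    ultimately have "coef I (t *\<^sub>R a - a') i + coef I a' i \<in> \<int>" by (rule Ints_add)
    then have "(1/2 :: real) \<in> \<int>" using ne by (simp add: coef_diff coef_scale t_def)
    then obtain k :: int where "(1/2 :: real) = of_int k" by (auto elim: Ints_cases)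
    then have "real_of_int (2 * k) = of_int 1" by simp
    then have "2 * k = 1" by (simp only: of_int_eq_iff)
    then show False by presburger
  qed
next
  assume "\<forall>i\<in>I. coef I a i = 0"
  then have "(\<Sum>j\<in>UNIV. (t *\<^sub>R a) $ j *\<^sub>R u j) \<in> \<Lambda>" for t :: real
    unfolding sum_in_lattice_iff by (simp add: coef_scale)
  then show "a \<in> lie_algebra (kernel_group \<Lambda> u)"
    unfolding lie_algebra_def kernel_group_def by blast
qed

lemma monomial_torus_exp:
  assumes "i \<in> I"
  shows "monomial_map (mat I) I (torus_exp w) $ i =
    exp (2 * of_real pi * \<i> * Complex (coef I (\<chi> j. Re (w $ j)) i) (coef I (\<chi> j. Im (w $ j)) i))"
proof -
  let ?s = "w $ i + (\<Sum>j\<in>-I. of_int (mat I i j) * w $ j)"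
  have "monomial_map (mat I) I (torus_exp w) $ i
     = exp (2 * of_real pi * \<i> * w $ i) * (\<Prod>j\<in>-I. exp (of_int (mat I i j) * (2 * of_real pi * \<i> * w $ j)))"
    using assms by (simp add: monomial_map_def torus_exp_def exp_power_int)
  also have "\<dots> = exp (2 * of_real pi * \<i> * ?s)"
    by (simp add: exp_sum[symmetric] exp_add[symmetric] distrib_left sum_distrib_left mult.left_commute)
  also have "?s = Complex (coef I (\<chi> j. Re (w $ j)) i) (coef I (\<chi> j. Im (w $ j)) i)"
    by (simp add: complex_eq_iff coef_def)
  finally show ?thesis .
qed

text \<open>In logarithmic coordinates the monomial equations say that the coefficients of the real
  part are integers, which is the lattice condition of the compact kernel, and that those of the
  imaginary part vanish, which is its Lie algebra condition.\<close>

lemma NC_iff: "g \<in> NC \<longleftrightarrow> (\<forall>j. g $ j \<noteq> 0) \<and> (\<forall>i\<in>I. monomial_map (mat I) I g $ i = 1)"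
proof
  assume "g \<in> NC"
  then obtain h b where h: "g = h * torus_exp (\<i> *s of_real_vec b)" "h \<in> kernel_group \<Lambda> u"
    and b: "b \<in> lie_algebra (kernel_group \<Lambda> u)"
    unfolding complexification_def by blast
  then obtain a where g: "g = torus_exp (of_real_vec a) * torus_exp (\<i> *s of_real_vec b)"
    and a: "(\<Sum>j\<in>UNIV. a $ j *\<^sub>R u j) \<in> \<Lambda>"
    unfolding kernel_group_def by blast
  note a = a[unfolded sum_in_lattice_iff] and b = b[unfolded lie_algebra_kernel]
  have g': "g = torus_exp (\<chi> j. Complex (a $ j) (b $ j))"
    unfolding g torus_exp_def of_real_vec_def
    by (simp add: vec_eq_iff exp_add[symmetric] distrib_left[symmetric] Complex_eq)
  have "monomial_map (mat I) I g $ i = 1" if i: "i \<in> I" for i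
  proof -
    obtain k :: int where "coef I a i = of_int k" using a i by (auto elim: Ints_cases)
    then show ?thesis
      using b i unfolding g' monomial_torus_exp[OF i]
      by (auto simp: exp_eq_1 intro!: exI[of _ k])
  qed
  moreover have "g $ j \<noteq> 0" for j by (simp add: g' torus_exp_def)
  ultimately show "(\<forall>j. g $ j \<noteq> 0) \<and> (\<forall>i\<in>I. monomial_map (mat I) I g $ i = 1)" by blast
next
  assume g: "(\<forall>j. g $ j \<noteq> 0) \<and> (\<forall>i\<in>I. monomial_map (mat I) I g $ i = 1)"
  \<comment> \<open>Any logarithm would do: two choices differ by an integer in the real part of
    \<open>w $ j\<close>, which affects neither condition.\<close>
  define w where "w = (\<chi> j. Ln (g $ j) / (2 * of_real pi * \<i>))"
  define a where "a = (\<chi> j. Re (w $ j))"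
  define b where "b = (\<chi> j. Im (w $ j))"
  have gw: "g = torus_exp w" using g by (simp add: torus_exp_def w_def vec_eq_iff exp_Ln)
  have "coef I a i \<in> \<int> \<and> coef I b i = 0" if i: "i \<in> I" for i
  proof -
    have "exp (2 * of_real pi * \<i> * Complex (coef I a i) (coef I b i)) = 1"
      using g i monomial_torus_exp[OF i, of w] by (simp add: gw a_def b_def)
    then obtain n :: int where "coef I b i = 0" "2 * pi * coef I a i = of_int (2 * n) * pi"
      unfolding exp_eq_1 by auto
    then show ?thesis by auto
  qed
  then have "torus_exp (of_real_vec a) \<in> kernel_group \<Lambda> u" "b \<in> lie_algebra (kernel_group \<Lambda> u)"
    using sum_in_lattice_iff lie_algebra_kernel by (auto simp: kernel_group_def)
  moreover have "g = torus_exp (of_real_vec a) * torus_exp (\<i> *s of_real_vec b)"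
    unfolding gw torus_exp_def of_real_vec_def a_def b_def
    by (simp add: vec_eq_iff exp_add[symmetric] distrib_left[symmetric] complex_eq[symmetric])
  ultimately show "g \<in> NC" unfolding complexification_def by blast
qed

text \<open>A power with positive exponent is continuous also at base 0, and
  \<open>vertex_gt\<close> makes the exponents outside \<open>I\<close> positive.\<close>

lemma sep_continuous: "continuous_on UNIV (sep I)"
  unfolding sep_def
  by (intro continuous_on_prod continuous_on_powr' continuous_intros) (use vertex_gt[OF I] in auto)

lemma sep_nonneg: "sep I z \<ge> 0"
  unfolding sep_def by (intro prod_nonneg) simp

lemma sep_eq_0: "sep I z = 0 \<longleftrightarrow> z \<notin> chart_domain I"
  unfolding sep_def chart_domain_def by auto

end

lemma lie_algebra_NC:
  assumes "g \<in> NC" "I \<in> vertex_sets"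
  obtains b where "(\<Sum>j\<in>UNIV. b $ j *\<^sub>R u j) = 0" "\<And>j. norm (g $ j) = exp (b $ j)"
proof -
  obtain a b where g: "g = torus_exp (of_real_vec a) * torus_exp (\<i> *s of_real_vec b)"
    and b: "b \<in> lie_algebra (kernel_group \<Lambda> u)"
    using assms(1) unfolding complexification_def kernel_group_def by blast
  have "(\<Sum>j\<in>UNIV. b $ j *\<^sub>R u j) = 0"
    using b by (simp add: lie_algebra_kernel[OF assms(2)] sum_eq_0_iff[OF assms(2)])
  \<comment> \<open>The compact factor has modulus 1 and the other one has modulus
    \<open>exp (- 2 * pi * b $ j)\<close>; hence the rescaled vector as witness.\<close>
  moreover have "(\<Sum>j\<in>UNIV. ((- 2 * pi) *\<^sub>R b) $ j *\<^sub>R u j) = (- 2 * pi) *\<^sub>R (\<Sum>j\<in>UNIV. b $ j *\<^sub>R u j)"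
    by (simp only: scaleR_sum_right vector_scaleR_component real_scaleR_def scaleR_scaleR)
  ultimately have "(\<Sum>j\<in>UNIV. ((- 2 * pi) *\<^sub>R b) $ j *\<^sub>R u j) = 0" by simp
  moreover have "norm (g $ j) = exp (((- 2 * pi) *\<^sub>R b) $ j)" for j
    by (simp add: g torus_exp_def of_real_vec_def norm_mult)
  ultimately show ?thesis by (rule that)
qed

text \<open>The exponents of \<^term>\<open>sep I\<close> are the values at the vertex of the affine functions defining
  the facets, so that \<open>\<Sum>\<^sub>j b\<^sub>j u\<^sub>j = 0\<close> makes the scaling factor independent of the vertex.\<close>

lemma sep_scale:
  assumes g: "g \<in> NC" shows "\<exists>\<kappa>>0. \<forall>I\<in>vertex_sets. \<forall>z. sep I (g * z) = \<kappa> * sep I z"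
proof (cases "vertex_sets = {}")
  case True
  then show ?thesis by (intro exI[of _ 1]) auto
next
  case False
  then obtain b where b: "(\<Sum>j\<in>UNIV. b $ j *\<^sub>R u j) = 0" "\<And>j. norm (g $ j) = exp (b $ j)"
    using lie_algebra_NC[OF g] by blast
  have "sep I (g * z) = exp (- (\<Sum>j\<in>UNIV. c j * b $ j)) * sep I z" if I: "I \<in> vertex_sets" for I z
  proof -
    let ?e = "\<lambda>j. vertex I \<bullet> u j - c j"
    have "sep I (g * z) = (\<Prod>j\<in>-I. exp (b $ j * ?e j)) * sep I z"
      by (simp add: sep_def norm_mult powr_mult b(2) prod.distrib exp_powr_real)
    also have "(\<Prod>j\<in>-I. exp (b $ j * ?e j)) = exp (\<Sum>j\<in>-I. b $ j * ?e j)" by (simp add: exp_sum)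
    also have "(\<Sum>j\<in>-I. b $ j * ?e j) = (\<Sum>j\<in>UNIV. b $ j * ?e j)"
      by (rule sum.mono_neutral_left) (auto simp: vertex_eq[OF I])
    also have "\<dots> = vertex I \<bullet> (\<Sum>j\<in>UNIV. b $ j *\<^sub>R u j) - (\<Sum>j\<in>UNIV. c j * b $ j)"
      by (simp add: inner_sum_right right_diff_distrib sum_subtractf mult.commute)
    finally show ?thesis by (simp add: b(1))
  qed
  then show ?thesis by (intro exI[of _ "exp (- (\<Sum>j\<in>UNIV. c j * b $ j))"]) simp
qed

text \<open>The constraints active at \<xi> cut out a face F, which is compact and therefore has an
  extreme point. An extreme point of a face is a vertex of the polytope, and the active constraints
  of \<xi> are active at it.\<close>

lemma exists_vertex_above:
  assumes "\<xi> \<in> polytope_of u c"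
  shows "\<exists>I\<in>vertex_sets. {i. \<xi> \<bullet> u i = c i} \<subseteq> I"
proof -
  let ?\<Delta> = "polytope_of u c"
  define F where "F = {\<zeta> \<in> ?\<Delta>. \<forall>i. \<xi> \<bullet> u i = c i \<longrightarrow> \<zeta> \<bullet> u i = c i}"
  have conv: "convex ?\<Delta>"
    unfolding polytope_of_def by (simp add: inner_commute[of _ "u _"] convex_INT convex_halfspace_ge)
  have F: "F face_of ?\<Delta>"
    unfolding face_of_def
  proof (intro conjI ballI impI)
    show "F \<subseteq> ?\<Delta>" by (auto simp: F_def)
    have "F = ?\<Delta> \<inter> (\<Inter>i\<in>{i. \<xi> \<bullet> u i = c i}. {\<zeta>. u i \<bullet> \<zeta> = c i})"
      by (auto simp: F_def inner_commute)
    then show "convex F" by (auto intro!: convex_Int conv convex_INT convex_hyperplane)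
    fix a b x assume a: "a \<in> ?\<Delta>" and b: "b \<in> ?\<Delta>" and x: "x \<in> F" and seg: "x \<in> open_segment a b"
    obtain t where t: "0 < t" "t < 1" "x = (1 - t) *\<^sub>R a + t *\<^sub>R b" using seg by (auto simp: in_segment)
    have "a \<bullet> u i = c i \<and> b \<bullet> u i = c i" if "\<xi> \<bullet> u i = c i" for i
    proof -
      have ge: "a \<bullet> u i \<ge> c i" "b \<bullet> u i \<ge> c i" using a b by (auto simp: polytope_of_def)
      have "(1 - t) * (a \<bullet> u i - c i) + t * (b \<bullet> u i - c i) = 0"
        using x that by (simp add: F_def t(3) inner_add_left algebra_simps)
      moreover have "(1 - t) * (a \<bullet> u i - c i) \<ge> 0" "t * (b \<bullet> u i - c i) \<ge> 0"
        using t ge by auto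
      ultimately have "(1 - t) * (a \<bullet> u i - c i) = 0" "t * (b \<bullet> u i - c i) = 0" by linarith+
      then show ?thesis using t by simp
    qed
    then show "a \<in> F" "b \<in> F" using a b by (auto simp: F_def)
  qed
  have "F \<noteq> {}" using assms by (auto simp: F_def)
  moreover have "compact F" using face_of_imp_compact[OF conv compact_polytope F] .
  ultimately obtain v where "v extreme_point_of F"
    using extreme_point_exists_convex[OF _ face_of_imp_convex[OF F]] by blast
  then have v: "v extreme_point_of ?\<Delta>" "v \<in> F" using extreme_point_of_face[OF F] by auto
  then show ?thesis
    by (intro bexI[of _ "{i. v \<bullet> u i = c i}"]) (auto simp: vertex_sets_def F_def)
qed

text \<open>The normals at a vertex are independent, so some direction w raises the constraints in
  \<open>I - J\<close> at unit rate and keeps those in J tight; a small step along it leaves the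
  remaining constraints strict.\<close>

lemma open_face_nonempty:
  assumes I: "I \<in> vertex_sets" and J: "J \<subseteq> I" shows "open_face u c J \<noteq> {}"
proof -
  obtain f :: "real^'n \<Rightarrow> real" where f: "linear f" "\<And>i. i \<in> I \<Longrightarrow> f (u i) = (if i \<in> J then 0 else 1)"
  proof -
    obtain f :: "real^'n \<Rightarrow> real" where "linear f"
      "\<forall>x\<in>u ` I. f x = (if inv_into I u x \<in> J then 0 else 1)"
      using linear_independent_extend[OF independent_u[OF I],
          of "\<lambda>x. if inv_into I u x \<in> J then 0 else (1::real)"] by blast
    then show ?thesis using inj_u[OF I] by (intro that[of f]) auto
  qed
  \<comment> \<open>The Riesz vector of the functional f.\<close>
  define w where "w = adjoint f 1"
  have w: "w \<bullet> x = f x" for x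
    using adjoint_works[OF f(1), of x 1] by (simp add: w_def inner_commute)
  \<comment> \<open>A step of length at most \<open>e j\<close> keeps constraint j strict even if w
    lowers it; the 1 in the denominator covers the case that w does not change it.\<close>
  define e where "e = (\<lambda>j. (vertex I \<bullet> u j - c j) / (\<bar>w \<bullet> u j\<bar> + 1))"
  have "\<exists>\<epsilon>>0. \<forall>j\<in>-I. \<epsilon> * \<bar>w \<bullet> u j\<bar> < vertex I \<bullet> u j - c j"
  proof -
    \<comment> \<open>The inserted 1 makes the set nonempty even if no constraint lies outside
      \<open>I\<close>.\<close>
    define \<epsilon> where "\<epsilon> = Min (insert 1 (e ` (-I)))"
    have epos: "e j > 0" if "j \<in> -I" for j using vertex_gt[OF I, of j] that by (auto simp: e_def intro!: divide_pos_pos)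
    have "\<epsilon> > 0" unfolding \<epsilon>_def using epos by (subst Min_gr_iff) auto
    moreover have "\<epsilon> * \<bar>w \<bullet> u j\<bar> < vertex I \<bullet> u j - c j" if j: "j \<in> -I" for j
    proof -
      have "\<epsilon> * \<bar>w \<bullet> u j\<bar> \<le> e j * \<bar>w \<bullet> u j\<bar>"
        unfolding \<epsilon>_def using j by (intro mult_right_mono Min_le) auto
      also have "\<dots> < e j * (\<bar>w \<bullet> u j\<bar> + 1)" using epos[OF j] by simp
      also have "\<dots> = vertex I \<bullet> u j - c j"
        unfolding e_def by (subst times_divide_eq_left, subst nonzero_mult_div_cancel_right) auto
      finally show ?thesis .
    qed
    ultimately show ?thesis by blast
  qed
  then obtain \<epsilon> where \<epsilon>: "\<epsilon> > 0" "\<And>j. j \<notin> I \<Longrightarrow> \<epsilon> * \<bar>w \<bullet> u j\<bar> < vertex I \<bullet> u j - c j" by auto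
  define \<xi> where "\<xi> = vertex I + \<epsilon> *\<^sub>R w"
  have val: "\<xi> \<bullet> u j = vertex I \<bullet> u j + \<epsilon> * (w \<bullet> u j)" for j by (simp add: \<xi>_def inner_add_left)
  have out: "\<xi> \<bullet> u j > c j" if "j \<notin> I" for j
  proof -
    have "- (\<epsilon> * (w \<bullet> u j)) \<le> \<epsilon> * \<bar>w \<bullet> u j\<bar>" 
      using mult_left_mono[of "- (w \<bullet> u j)" "\<bar>w \<bullet> u j\<bar>" \<epsilon>] \<epsilon>(1) by simp
    then show ?thesis using \<epsilon>(2)[OF that] by (simp add: val)
  qed
  have ins: "\<xi> \<bullet> u j = c j + (if j \<in> J then 0 else \<epsilon>)" if "j \<in> I" for j
    using f(2)[OF that] by (simp add: val w vertex_eq[OF I that])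
  have "\<xi> \<bullet> u j \<ge> c j" for j using out[of j] ins[of j] \<epsilon>(1) by (cases "j \<in> I") auto
  moreover have "\<xi> \<bullet> u j = c j \<longleftrightarrow> j \<in> J" for j
    using out[of j] ins[of j] \<epsilon>(1) J by (cases "j \<in> I") auto
  ultimately have "\<xi> \<in> open_face u c J" by (simp add: open_face_def polytope_of_def)
  then show ?thesis by blast
qed

text \<open>By the two preceding lemmas, the sets with nonempty open face are exactly the subsets of
  vertex sets, and z lies in \<open>chart_domain I\<close> exactly if its zero set is contained in
  \<open>I\<close>.\<close>

lemma Sigma_delzant_eq: "Sigma_delzant u c = (\<Union>I\<in>vertex_sets. chart_domain I)"
proof (intro equalityI subsetI)
  fix z assume "z \<in> Sigma_delzant u c"
  then obtain J \<xi> where J: "\<xi> \<in> open_face u c J" "z \<in> coord_stratum J" by (auto simp: Sigma_delzant_def)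
  then obtain I where "I \<in> vertex_sets" "{i. \<xi> \<bullet> u i = c i} \<subseteq> I"
    using exists_vertex_above[of \<xi>] by (auto simp: open_face_def)
  moreover have "{i. \<xi> \<bullet> u i = c i} = J" using J by (auto simp: open_face_def)
  ultimately show "z \<in> (\<Union>I\<in>vertex_sets. chart_domain I)"
    using J(2) by (auto simp: coord_stratum_def chart_domain_def)
next
  fix z assume "z \<in> (\<Union>I\<in>vertex_sets. chart_domain I)"
  then obtain I where I: "I \<in> vertex_sets" "z \<in> chart_domain I" by blast
  have "{i. z $ i = 0} \<subseteq> I" using I(2) by (auto simp: chart_domain_def)
  from open_face_nonempty[OF I(1) this] show "z \<in> Sigma_delzant u c"
    unfolding Sigma_delzant_def by (intro UN_I[of "{i. z $ i = 0}"]) (auto simp: coord_stratum_def)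
qed

sublocale toric_quotient "TYPE('n)" NC vertex_sets mat sep
  by standard (simp_all add: NC_iff card_vertex_set sep_continuous sep_nonneg sep_eq_0 sep_scale)

lemma Sigma_eq: "\<Sigma> = Sigma_delzant u c"
  by (simp add: \<Sigma>_def Sigma_delzant_eq)

lemma p_eq: "p = git_proj \<Lambda> u"
  by (simp add: fun_eq_iff p_def git_proj_def)

end

theorem proposition4p8:
  fixes \<Lambda> :: "(real^'n::finite) set"
    and u :: "'d::finite \<Rightarrow> real^'n"
    and c :: "'d \<Rightarrow> real"
    and \<pi> :: "(complex^'d) bivector"
  assumes "full_lattice \<Lambda>"
    and "delzant \<Lambda> u c"
    and "positive_bivector \<pi>"
  shows
    "let \<Sigma> = Sigma_delzant u c;
         p = git_proj \<Lambda> u;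
         atlas_\<Sigma> = open_atlas \<Sigma>;
         M = quotient_topology (top_of_set \<Sigma>) p;
         atlas_M = (quotient_atlas \<Sigma> p :: ((complex^'d) set, complex^'n) chart set);
         \<pi>_\<Sigma> = action_bivector exp_action \<pi>;
         \<pi>_M = (pushforward atlas_\<Sigma> (\<lambda>_. \<pi>_\<Sigma>) p :: ((complex^'d) set, complex^'n) bivector_field)
     in poisson_manifold (top_of_set \<Sigma>) atlas_\<Sigma> (\<lambda>_. \<pi>_\<Sigma>) \<and>
        poisson_manifold M atlas_M \<pi>_M \<and>
        poisson_submersion (top_of_set \<Sigma>) atlas_\<Sigma> (\<lambda>_. \<pi>_\<Sigma>) M atlas_M \<pi>_M p \<and>
        has_poisson_fibres \<Sigma> \<pi>_\<Sigma> (topspace M) p"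
proof -
  interpret delzant_polytope \<Lambda> u c by standard (rule assms)+
  have pos: "positive_form \<pi>" by (rule positive_bivector_imp_positive_form[OF assms(3)])
  then have biv: "is_bivector \<pi>" by (simp add: positive_form_def)
  note eqs = M_def[symmetric] atlas_def[symmetric] \<pi>\<^sub>\<Sigma>_def[OF biv, symmetric] \<pi>\<^sub>M_def[OF biv, symmetric]
  show ?thesis
    unfolding Let_def Sigma_eq[symmetric] p_eq[symmetric]
    using poisson_manifold_\<Sigma>[OF biv] poisson_manifold_M[OF biv] poisson_submersion_p[OF biv]
      has_poisson_fibres_p[OF pos]
    by (simp add: eqs)
qed

end
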